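(* Let $\nu>-1$ and let $k\in\mathbb{N}$, $k\ge1$. For any sequence $(\beta_N)_{N\ge1}$ of positive reals with $\beta_N\to\infty$ as $N\to\infty$, $$\lim_{N\to\infty}\left(\frac{\beta_N}{8N}\right)^{k}\mathcal{M}^{(\beta_N)}_N\left(-k,\frac{\beta_N}{2}(\nu+1)\right)=\zeta_\nu(2k),$$ where $\zeta_\nu$ is the Bessel zeta function.
   Context: For $\beta>0$, $\alpha>-1$ and $N\in\mathbb{N}$, the Laguerre $\beta$-ensemble is the probability measure on $(\lambda_1,\dots,\lambda_N)\in[0,\infty)^N$ whose density is proportional to $$\prod_{j=1}^N\lambda_j^{\alpha}e^{-\lambda_j}\prod_{1\le i<j\le N}|\lambda_j-\lambda_i|^{\beta}.$$ The inverse moments are $\mathcal{M}^{(\beta)}_N(-k,\alpha)=\mathbb{E}\left(\sum_{j=1}^N\lambda_j^{-k}\right)$, the expectation being with respect to this measure; they are finite when $k<\alpha+1$ (which holds for $\alpha=\frac{\beta_N}{2}(\nu+1)$ and all sufficiently large $N$). For $\nu>-1$ let $0<j_{\nu,1}<j_{\nu,2}<\cdots$ be the positive zeros of the Bessel function $J_\nu$. The Bessel zeta function is $\zeta_\nu(s)=\sum_{n=1}^\infty j_{\nu,n}^{-s}$ for $\mathrm{Re}(s)>1$. *)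

theory Defs
  imports "HOL-Probability.Probability"
begin

text \<open>
  The unnormalised density on \<open>\<real>\<^sup>N\<close>, with the variables indexed by \<open>1, \<dots>, N\<close>; the indicator
  confines the measure to \<open>[0, \<infinity>)\<^sup>N\<close>. The convention \<open>0 powr a = 0\<close> (also for \<open>a \<le> 0\<close>)
  affects only the points with some \<open>x j = 0\<close>, which form a null set.
\<close>

definition laguerre_weight :: "real \<Rightarrow> real \<Rightarrow> nat \<Rightarrow> (nat \<Rightarrow> real) \<Rightarrow> real" where
  "laguerre_weight \<beta> \<alpha> N x =
     (\<Prod>j=1..N. indicator {0..} (x j) * (x j powr \<alpha> * exp (- x j))) *
     (\<Prod>j=1..N. \<Prod>i=1..<j. \<bar>x j - x i\<bar> powr \<beta>)"

definition laguerre_partition :: "real \<Rightarrow> real \<Rightarrow> nat \<Rightarrow> ennreal" where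
  "laguerre_partition \<beta> \<alpha> N =
     (\<integral>\<^sup>+ x. ennreal (laguerre_weight \<beta> \<alpha> N x) \<partial>(\<Pi>\<^sub>M j\<in>{1..N}. lborel))"

definition laguerre_ensemble :: "real \<Rightarrow> real \<Rightarrow> nat \<Rightarrow> (nat \<Rightarrow> real) measure" where
  "laguerre_ensemble \<beta> \<alpha> N =
     density (\<Pi>\<^sub>M j\<in>{1..N}. lborel)
       (\<lambda>x. ennreal (laguerre_weight \<beta> \<alpha> N x) / laguerre_partition \<beta> \<alpha> N)"

text \<open>
  The moment \<open>\<M>\<^sub>N(p, \<alpha>)\<close> of integer order \<open>p\<close>; the inverse moments are those with \<open>p = - k\<close>.
  As for every Bochner integral, the value is \<open>0\<close> if the expectation is not finite.
\<close>

definition laguerre_moment :: "real \<Rightarrow> nat \<Rightarrow> int \<Rightarrow> real \<Rightarrow> real" where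
  "laguerre_moment \<beta> N p \<alpha> =
     (\<integral>x. (\<Sum>j=1..N. x j powi p) \<partial>(laguerre_ensemble \<beta> \<alpha> N))"

text \<open>
  The Bessel function of the first kind of real order \<open>\<nu>\<close>, meant for arguments \<open>x > 0\<close>.
\<close>

definition bessel_J :: "real \<Rightarrow> real \<Rightarrow> real" where
  "bessel_J \<nu> x =
     (\<Sum>m. (-1) ^ m / (fact m * Gamma (real m + \<nu> + 1)) * (x / 2) powr (2 * real m + \<nu>))"

text \<open>
  The \<open>n\<close>-th positive zero \<open>j\<^sub>\<nu>\<^sub>,\<^sub>n\<close> in increasing order, for \<open>n \<ge> 1\<close>: the zero up to which
  there are exactly \<open>n\<close> positive zeros. As \<open>n \<ge> 1\<close>, the cardinality condition entails that
  this set of zeros is finite.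
\<close>

definition bessel_zero :: "real \<Rightarrow> nat \<Rightarrow> real" where
  "bessel_zero \<nu> n =
     (THE x. 0 < x \<and> bessel_J \<nu> x = 0 \<and> card {y. 0 < y \<and> y \<le> x \<and> bessel_J \<nu> y = 0} = n)"

text \<open>The series is meant for \<open>Re s > 1\<close>.\<close>

definition bessel_zeta :: "real \<Rightarrow> complex \<Rightarrow> complex" where
  "bessel_zeta \<nu> s = (\<Sum>n. complex_of_real (bessel_zero \<nu> (Suc n)) powr (- s))"

end

(*
  Integrating the total derivatives of x_j^(-m) F(x) w(x), for w the weight and F a product of the
  inverse power sums S_p = sum_j x_j^(-p), gives loop equations between the expectations of products
  of power sums. After scaling S_p by (beta / 8N)^p, all terms that do not factorize carry a factor
  1/N or 1/beta. The equation with m = 0 bounds all moments, and by induction on the largest part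
      every
  product of scaled power sums becomes deterministic, whatever the rate at which beta grows. The
      limits
  sigma_k satisfy Rayleigh's recurrence
    (nu + n) sigma_n = sum_(l < n) sigma_l sigma_(n - l),   sigma_1 = 1 / (4 (nu + 1)).

  That sigma_k = zeta_nu(2k) also comes out of the ensemble. Its typical configurations have power
      sums
  close to sigma_k, so by compactness there are atoms a_j >= 0 with sum_j a_j^k = sigma_k for k >=
      2 and
  sum_j a_j <= sigma_1. With f(z) the entire function such that J_nu(x) is x^nu f(x^2) up to a
      constant,
  the recurrence is the Riccati form of Bessel's equation, so -f'/f = c + sum_j a_j / (1 - a_j z).
      The
  behaviour on the negative axis excludes c > 0 and finitely many atoms, and the poles show that the
  zeros of f, which are simple, are exactly the 1 / a_j.
*)

theory Submission
  imports Defs "HOL-Complex_Analysis.Complex_Analysis"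
begin

section \<open>The weight and its singularities\<close>

text \<open>The loop equation for one power sum contains products of two, so the equations for
  single moments do not close. Carrying an arbitrary product F along closes them, and it also
  supplies the second moments from which concentration follows. The number 8 is fixed by S_0 = N: in
  the equation divided by beta / 2, the scaled S_0 contributes (2 / beta) (beta / 8N) N = 1 / 4.
  This is the constant in sigma_1 and in z f'' + (nu + 1) f' + f / 4 = 0, Bessel's equation in z =
  x^2. Integration by parts meets two singularities: the walls x_j = 0, tamed because alpha grows
  with beta, and the collisions x_i = x_j, where 1 / (x_j - x_i) costs one power of a Vandermonde
  factor, harmless once beta >= 1. Taking the atoms from the ensemble replaces a product expansion
  of J_nu: they carry the power sums by construction, and they only have to be matched with the
  positive zeros. For k = 1 just an inequality survives the limit, because decreasing atoms of
  bounded total mass are controlled by a multiple of 1 / j, whose k-th powers are summable only for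
  k >= 2. This is the origin of the constant c.\<close>

definition inv_pow_sum :: "nat \<Rightarrow> nat \<Rightarrow> (nat \<Rightarrow> real) \<Rightarrow> real" where
  "inv_pow_sum N p x = (\<Sum>j=1..N. inverse (x j) ^ p)"

definition inv_prod :: "nat \<Rightarrow> nat list \<Rightarrow> (nat \<Rightarrow> real) \<Rightarrow> real" where
  "inv_prod N ps x = (\<Prod>p\<leftarrow>ps. inv_pow_sum N p x)"

lemma inv_prod_Nil [simp]: "inv_prod N [] x = 1"
  and inv_prod_Cons [simp]: "inv_prod N (p # ps) x = inv_pow_sum N p x * inv_prod N ps x"
  by (simp_all add: inv_prod_def)

text \<open>The Leibniz rule along the list, for the derivative of \<open>inv_prod N ps\<close> in
  the j-th variable (see \<open>has_real_derivative_inv_prod\<close>).\<close>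

fun inv_prod_partial :: "nat \<Rightarrow> nat list \<Rightarrow> nat \<Rightarrow> (nat \<Rightarrow> real) \<Rightarrow> real" where
  "inv_prod_partial N [] j x = 0"
| "inv_prod_partial N (p # ps) j x =
     - real p * inverse (x j) ^ Suc p * inv_prod N ps x + inv_pow_sum N p x * inv_prod_partial N
         ps j x"

text \<open>An arbitrary index set is allowed so that a single particle can be split off and its
  coordinate treated as the variable of integration.\<close>

definition vandermonde_on :: "real \<Rightarrow> nat set \<Rightarrow> (nat \<Rightarrow> real) \<Rightarrow> real" where
  "vandermonde_on \<beta> A x = (\<Prod>j\<in>A. \<Prod>i\<in>{i\<in>A. i < j}. \<bar>x j - x i\<bar> powr \<beta>)"

text \<open>The new index is the larger one in some pairs and the smaller one in the others. The
  absolute value does not see the difference, so both kinds merge into one product over all of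
  A.\<close>

lemma vandermonde_on_insert:
  assumes "finite A" "j \<notin> A"
  shows "vandermonde_on \<beta> (insert j A) x = vandermonde_on \<beta> A x * (\<Prod>i\<in>A. \<bar>x j - x i\<bar> powr \<beta>)"
proof -
  let ?d = "\<lambda>a b. \<bar>x a - x b\<bar> powr \<beta>"
  have 1: "(\<Prod>i\<in>{i\<in>insert j A. i < a}. ?d a i) =
        (if j < a then ?d a j else 1) * (\<Prod>i\<in>{i\<in>A. i < a}. ?d a i)" for a
  proof (cases "j < a")
    case True
    then have "{i\<in>insert j A. i < a} = insert j {i\<in>A. i < a}" by auto
    then show ?thesis using True assms by simp
  next
    case False
    then have "{i\<in>insert j A. i < a} = {i\<in>A. i < a}" by auto
    then show ?thesis using False by simp
  qed
  have "vandermonde_on \<beta> (insert j A) x =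
     (\<Prod>i\<in>{i\<in>A. i < j}. ?d j i) * (\<Prod>a\<in>A. (if j < a then ?d a j else 1) * (\<Prod>i\<in>{i\<in>A. i < a}. ?d a i))"
    unfolding vandermonde_on_def 1 using assms by simp
  also have "\<dots> = vandermonde_on \<beta> A x *
      ((\<Prod>i\<in>A. if i < j then ?d j i else 1) * (\<Prod>a\<in>A. if j < a then ?d a j else 1))"
    using assms(1) by (simp add: vandermonde_on_def prod.distrib prod.inter_filter)
  also have "(\<Prod>i\<in>A. if i < j then ?d j i else 1) * (\<Prod>a\<in>A. if j < a then ?d a j else 1) =
      (\<Prod>i\<in>A. ?d j i)"
    unfolding prod.distrib[symmetric] using assms
    by (intro prod.cong refl) (auto simp: abs_minus_commute not_less_iff_gr_or_eq)
  finally show ?thesis .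
qed

lemma vandermonde_on_cong:
  "(\<And>i. i \<in> A \<Longrightarrow> x i = y i) \<Longrightarrow> vandermonde_on \<beta> A x = vandermonde_on \<beta> A y"
  unfolding vandermonde_on_def by (intro prod.cong) auto

text \<open>Since \<open>0 powr \<alpha> = 0\<close>, the closed half-line may be exchanged for the
  open one pointwise, not just almost everywhere. Every later estimate then concerns positive
  coordinates only.\<close>

lemma laguerre_weight_alt:
  "laguerre_weight \<beta> \<alpha> N x =
     (\<Prod>j=1..N. indicator {0<..} (x j) * (x j powr \<alpha> * exp (- x j))) * vandermonde_on \<beta> {1..N} x"
proof -
  have "indicator {0..} t * (t powr \<alpha> * exp (- t)) = indicator {0<..} t * (t powr \<alpha> * exp (- t))"
      for t :: real
    by (cases "t = 0") (auto simp: indicator_def)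
  then have "(\<Prod>j=1..N. indicator {0..} (x j) * (x j powr \<alpha> * exp (- x j))) =
      (\<Prod>j=1..N. indicator {0<..} (x j) * (x j powr \<alpha> * exp (- x j)))"
    by (intro prod.cong refl)
  moreover have "{1..<j} = {i\<in>{1..N}. i < j}" if "j \<in> {1..N}" for j
    using that by auto
  ultimately show ?thesis
    unfolding laguerre_weight_def vandermonde_on_def by (auto intro!: prod.cong)
qed

lemma laguerre_weight_nonneg: "laguerre_weight \<beta> \<alpha> N x \<ge> 0"
  unfolding laguerre_weight_def by (intro mult_nonneg_nonneg prod_nonneg) auto

lemma laguerre_weight_eq_0:
  assumes "j \<in> {1..N}" "x j \<le> 0"
  shows "laguerre_weight \<beta> \<alpha> N x = 0"
proof -
  have "(\<Prod>j=1..N. indicator {0<..} (x j) * (x j powr \<alpha> * exp (- x j))) = 0"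
    using assms by (intro prod_zero bexI[of _ j]) auto
  then show ?thesis by (simp add: laguerre_weight_alt)
qed

text \<open>Makes the configurations harmless at which 1 / (x j - x i) has the default value 0 of a
  division by zero.\<close>

lemma laguerre_weight_coincide:
  assumes "j \<in> {1..N}" "i \<in> {1..N}" "i \<noteq> j" "x i = x j"
  shows "laguerre_weight \<beta> \<alpha> N x = 0"
proof -
  have "insert j ({1..N} - {j}) = {1..N}" using assms by auto
  then have "vandermonde_on \<beta> {1..N} x =
      vandermonde_on \<beta> ({1..N} - {j}) x * (\<Prod>i\<in>{1..N}-{j}. \<bar>x j - x i\<bar> powr \<beta>)"
    using vandermonde_on_insert[of "{1..N} - {j}" j \<beta> x] by simp
  moreover have "(\<Prod>i\<in>{1..N}-{j}. \<bar>x j - x i\<bar> powr \<beta>) = 0"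
    using assms by (intro prod_zero bexI[of _ i]) auto
  ultimately show ?thesis by (simp add: laguerre_weight_alt)
qed

lemma laguerre_weight_split:
  assumes "j \<in> {1..N}"
  shows "laguerre_weight \<beta> \<alpha> N (x(j := t)) =
    (\<Prod>i\<in>{1..N}-{j}. indicator {0<..} (x i) * (x i powr \<alpha> * exp (- x i))) * vandermonde_on \<beta>
        ({1..N} - {j}) x *
    (indicator {0<..} t * (t powr \<alpha> * exp (- t)) * (\<Prod>i\<in>{1..N}-{j}. \<bar>t - x i\<bar> powr \<beta>))"
proof -
  let ?y = "x(j := t)"
  have ins: "insert j ({1..N} - {j}) = {1..N}" using assms by auto
  have "vandermonde_on \<beta> {1..N} ?y =
      vandermonde_on \<beta> ({1..N} - {j}) ?y * (\<Prod>i\<in>{1..N}-{j}. \<bar>?y j - ?y i\<bar> powr \<beta>)"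
    using vandermonde_on_insert[of "{1..N} - {j}" j \<beta> ?y] ins by simp
  also have "vandermonde_on \<beta> ({1..N} - {j}) ?y = vandermonde_on \<beta> ({1..N} - {j}) x"
    by (rule vandermonde_on_cong) auto
  also have "(\<Prod>i\<in>{1..N}-{j}. \<bar>?y j - ?y i\<bar> powr \<beta>) = (\<Prod>i\<in>{1..N}-{j}. \<bar>t - x i\<bar> powr \<beta>)"
    by (rule prod.cong) auto
  finally have 1: "vandermonde_on \<beta> {1..N} ?y = vandermonde_on \<beta> ({1..N} - {j}) x *
      (\<Prod>i\<in>{1..N}-{j}. \<bar>t - x i\<bar> powr \<beta>)" .
  have "(\<Prod>i=1..N. indicator {0<..} (?y i) * (?y i powr \<alpha> * exp (- ?y i))) =
     (indicator {0<..} t * (t powr \<alpha> * exp (- t))) *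
     (\<Prod>i\<in>{1..N}-{j}. indicator {0<..} (x i) * (x i powr \<alpha> * exp (- x i)))"
    by (subst prod.remove[OF _ assms]) (auto intro!: prod.cong)
  then show ?thesis unfolding laguerre_weight_alt 1 by (simp add: mult_ac)
qed

text \<open>Polynomially bounded at the walls \<open>x j = 0\<close>, which a large enough \<open>\<alpha>\<close> compensates.\<close>

definition wall_bounded :: "nat \<Rightarrow> nat \<Rightarrow> ((nat \<Rightarrow> real) \<Rightarrow> real) \<Rightarrow> bool" where
  "wall_bounded N n f \<longleftrightarrow> (\<exists>C\<ge>0. \<forall>x. (\<forall>i\<in>{1..N}. x i > 0) \<longrightarrow>
     \<bar>f x\<bar> \<le> C * (\<Prod>i=1..N. 1 + inverse (x i)) ^ n)"

lemma one_le_prod_inverse: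
  fixes x :: "nat \<Rightarrow> real"
  shows "(\<And>i. i \<in> A \<Longrightarrow> x i > 0) \<Longrightarrow> 1 \<le> (\<Prod>i\<in>A. 1 + inverse (x i))"
  by (intro prod_ge_1) (auto simp: less_imp_le)

lemma inverse_le_prod:
  fixes x :: "nat \<Rightarrow> real"
  assumes "j \<in> A" "finite A" "\<And>i. i \<in> A \<Longrightarrow> x i > 0"
  shows "inverse (x j) \<le> (\<Prod>i\<in>A. 1 + inverse (x i))"
proof -
  have "inverse (x j) \<le> (1 + inverse (x j)) * 1" by simp
  also have "\<dots> \<le> (1 + inverse (x j)) * (\<Prod>i\<in>A-{j}. 1 + inverse (x i))"
    using assms by (intro mult_left_mono one_le_prod_inverse) (auto simp: add_nonneg_nonneg
        less_imp_le)
  also have "\<dots> = (\<Prod>i\<in>A. 1 + inverse (x i))"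
    using assms by (simp add: prod.remove)
  finally show ?thesis .
qed

lemma wall_bounded_mono:
  assumes "wall_bounded N n f" "n \<le> m"
  shows "wall_bounded N m f"
proof -
  from assms(1) obtain C where C: "C \<ge> 0" "\<And>x. (\<forall>i\<in>{1..N}. x i > 0) \<Longrightarrow>
     \<bar>f x\<bar> \<le> C * (\<Prod>i=1..N. 1 + inverse (x i)) ^ n"
    unfolding wall_bounded_def by blast
  have "\<bar>f x\<bar> \<le> C * (\<Prod>i=1..N. 1 + inverse (x i)) ^ m" if "\<forall>i\<in>{1..N}. x i > 0" for x
  proof -
    have "(\<Prod>i=1..N. 1 + inverse (x i)) ^ n \<le> (\<Prod>i=1..N. 1 + inverse (x i)) ^ m"
      using that assms(2) by (intro power_increasing one_le_prod_inverse) auto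
    then show ?thesis using C(2)[OF that] C(1) by (meson mult_left_mono order_trans)
  qed
  then show ?thesis using C(1) unfolding wall_bounded_def by blast
qed

lemma wall_bounded_const: "wall_bounded N 0 (\<lambda>_. c)"
  unfolding wall_bounded_def by (rule exI[of _ "\<bar>c\<bar>"]) auto

lemma wall_bounded_mult:
  assumes "wall_bounded N n f" "wall_bounded N m g"
  shows "wall_bounded N (n + m) (\<lambda>x. f x * g x)"
proof -
  from assms(1) obtain C where C: "C \<ge> 0" "\<And>x. (\<forall>i\<in>{1..N}. x i > 0) \<Longrightarrow>
     \<bar>f x\<bar> \<le> C * (\<Prod>i=1..N. 1 + inverse (x i)) ^ n"
    unfolding wall_bounded_def by blast
  from assms(2) obtain D where D: "D \<ge> 0" "\<And>x. (\<forall>i\<in>{1..N}. x i > 0) \<Longrightarrow>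
     \<bar>g x\<bar> \<le> D * (\<Prod>i=1..N. 1 + inverse (x i)) ^ m"
    unfolding wall_bounded_def by blast
  have "\<bar>f x * g x\<bar> \<le> (C * D) * (\<Prod>i=1..N. 1 + inverse (x i)) ^ (n + m)" if x: "\<forall>i\<in>{1..N}. x i > 0"
      for x
  proof -
    have "\<bar>f x * g x\<bar> \<le> (C * (\<Prod>i=1..N. 1 + inverse (x i)) ^ n) * (D * (\<Prod>i=1..N. 1 + inverse (x i))
        ^ m)"
      unfolding abs_mult using C D x by (intro mult_mono) (auto intro: order_trans[OF abs_ge_zero])
    then show ?thesis by (simp add: power_add mult_ac)
  qed
  moreover have "0 \<le> C * D" using C D by simp
  ultimately show ?thesis unfolding wall_bounded_def by blast
qed

lemma wall_bounded_add:
  assumes "wall_bounded N n f" "wall_bounded N n g"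
  shows "wall_bounded N n (\<lambda>x. f x + g x)"
proof -
  from assms(1) obtain C where C: "C \<ge> 0" "\<And>x. (\<forall>i\<in>{1..N}. x i > 0) \<Longrightarrow>
     \<bar>f x\<bar> \<le> C * (\<Prod>i=1..N. 1 + inverse (x i)) ^ n"
    unfolding wall_bounded_def by blast
  from assms(2) obtain D where D: "D \<ge> 0" "\<And>x. (\<forall>i\<in>{1..N}. x i > 0) \<Longrightarrow>
     \<bar>g x\<bar> \<le> D * (\<Prod>i=1..N. 1 + inverse (x i)) ^ n"
    unfolding wall_bounded_def by blast
  have "\<bar>f x + g x\<bar> \<le> (C + D) * (\<Prod>i=1..N. 1 + inverse (x i)) ^ n" if x: "\<forall>i\<in>{1..N}. x i > 0" for x
    using C(2)[OF x] D(2)[OF x] abs_triangle_ineq[of "f x" "g x"] by (simp add: distrib_right)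
  moreover have "0 \<le> C + D" using C D by simp
  ultimately show ?thesis unfolding wall_bounded_def by blast
qed

lemma wall_bounded_sum:
  assumes "\<And>i. i \<in> A \<Longrightarrow> wall_bounded N n (f i)"
  shows "wall_bounded N n (\<lambda>x. \<Sum>i\<in>A. f i x)"
  using assms
proof (induction A rule: infinite_finite_induct)
  case (insert i A)
  then show ?case by (simp add: wall_bounded_add)
qed (auto intro: wall_bounded_mono[OF wall_bounded_const])

lemma wall_bounded_inverse_power:
  assumes "j \<in> {1..N}"
  shows "wall_bounded N p (\<lambda>x. inverse (x j) ^ p)"
  unfolding wall_bounded_def
proof (intro exI[of _ 1] conjI allI impI)
  fix x :: "nat \<Rightarrow> real" assume x: "\<forall>i\<in>{1..N}. x i > 0"
  have "inverse (x j) ^ p \<le> (\<Prod>i=1..N. 1 + inverse (x i)) ^ p"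
    using x assms by (intro power_mono inverse_le_prod) (auto simp: less_imp_le)
  moreover have "inverse (x j) ^ p \<ge> 0" using x assms by (auto simp: less_imp_le)
  ultimately show "\<bar>inverse (x j) ^ p\<bar> \<le> 1 * (\<Prod>i=1..N. 1 + inverse (x i)) ^ p" by simp
qed simp

lemma wall_bounded_inv_pow_sum: "wall_bounded N p (inv_pow_sum N p)"
  unfolding inv_pow_sum_def by (intro wall_bounded_sum wall_bounded_inverse_power)

lemma wall_bounded_inv_prod: "wall_bounded N (sum_list ps) (inv_prod N ps)"
  by (induction ps) (auto intro!: wall_bounded_const wall_bounded_mult wall_bounded_inv_pow_sum)

lemma wall_bounded_inv_prod_partial:
  assumes "j \<in> {1..N}"
  shows "wall_bounded N (Suc (sum_list ps)) (inv_prod_partial N ps j)"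
proof (induction ps)
  case Nil
  then show ?case by (auto intro: wall_bounded_mono[OF wall_bounded_const])
next
  case (Cons p ps)
  let ?f = "\<lambda>x. - real p * inverse (x j) ^ Suc p * inv_prod N ps x"
  let ?g = "\<lambda>x. inv_pow_sum N p x * inv_prod_partial N ps j x"
  have "wall_bounded N (0 + Suc p + sum_list ps) ?f"
    by (intro wall_bounded_mult wall_bounded_const wall_bounded_inverse_power
        wall_bounded_inv_prod assms)
  then have "wall_bounded N (Suc (sum_list (p # ps))) ?f"
    by (rule wall_bounded_mono) simp
  moreover have "wall_bounded N (p + Suc (sum_list ps)) ?g"
    by (intro wall_bounded_mult wall_bounded_inv_pow_sum Cons.IH)
  then have "wall_bounded N (Suc (sum_list (p # ps))) ?g"
    by (rule wall_bounded_mono) simp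
  ultimately have "wall_bounded N (Suc (sum_list (p # ps))) (\<lambda>x. ?f x + ?g x)"
    by (rule wall_bounded_add)
  moreover have "inv_prod_partial N (p # ps) j = (\<lambda>x. ?f x + ?g x)"
    by (rule ext) simp
  ultimately show ?case by (simp only:)
qed

section \<open>Integrability\<close>

text \<open>The wall factor combines with the power to
  \<open>(1 + t) ^ n * t powr (\<alpha> - n)\<close>, which is polynomially bounded because n <=
  \<alpha>. Half of the exponential then absorbs the polynomial.\<close>

lemma exp_dominates:
  fixes \<alpha> :: real
  assumes "real n \<le> \<alpha>"
  shows "\<exists>C\<ge>0. \<forall>t>0. (1 + inverse t) ^ n * (1 + t) ^ K * (t powr \<alpha> * exp (- t)) \<le> C * exp (- t / 2)"
proof -
  \<comment> \<open>The total degree of the polynomial bound; the extra 1 keeps the divisor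
    \<open>2 * real L\<close> positive.\<close>
  define L where "L = n + K + nat \<lceil>\<alpha> - real n\<rceil> + 1"
  have L: "L \<ge> 1" by (simp add: L_def)
  have "(1 + inverse t) ^ n * (1 + t) ^ K * (t powr \<alpha> * exp (- t)) \<le> (2 * real L) ^ L * exp (- t /
      2)"
    if t: "t > 0" for t :: real
  proof -
    have "(1 + inverse t) ^ n * t powr \<alpha> = (1 + t) ^ n * t powr (\<alpha> - real n)"
    proof -
      have "1 + inverse t = (1 + t) / t" using t by (simp add: field_simps)
      then show ?thesis using t by (simp add: power_divide powr_diff powr_realpow)
    qed
    also have "\<dots> \<le> (1 + t) ^ n * (1 + t) powr (\<alpha> - real n)"
      using t assms by (intro mult_left_mono powr_mono2) auto
    also have "\<dots> \<le> (1 + t) ^ n * (1 + t) powr real (nat \<lceil>\<alpha> - real n\<rceil>)"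
      using t by (intro mult_left_mono powr_mono) (auto intro!: zero_le_power simp:
          real_nat_ceiling_ge)
    also have "\<dots> = (1 + t) ^ (n + nat \<lceil>\<alpha> - real n\<rceil>)"
      using t by (simp add: powr_realpow power_add)
    finally have 1: "(1 + inverse t) ^ n * t powr \<alpha> \<le> (1 + t) ^ (n + nat \<lceil>\<alpha> - real n\<rceil>)" .
    have "(1 + inverse t) ^ n * (1 + t) ^ K * (t powr \<alpha> * exp (- t)) =
       ((1 + inverse t) ^ n * t powr \<alpha>) * ((1 + t) ^ K * exp (- t))" by (simp add: mult_ac)
    also have "\<dots> \<le> (1 + t) ^ (n + nat \<lceil>\<alpha> - real n\<rceil>) * ((1 + t) ^ K * exp (- t))"
      using 1 t by (intro mult_right_mono) auto
    also have "\<dots> = (1 + t) ^ (n + nat \<lceil>\<alpha> - real n\<rceil> + K) * exp (- t)"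
      by (simp add: power_add)
    also have "\<dots> \<le> (1 + t) ^ L * exp (- t)"
      using t unfolding L_def by (intro mult_right_mono power_increasing) auto
    \<comment> \<open>Each of the L factors 1 + t costs exp (t / (2 L)), so that together they use
      up exactly exp (t / 2).\<close>
    also have "\<dots> \<le> (2 * real L * exp (t / (2 * real L))) ^ L * exp (- t)"
    proof (intro mult_right_mono power_mono)
      have "1 + t \<le> 2 * real L * (1 + t / (2 * real L))" using L t by (simp add: field_simps)
      also have "\<dots> \<le> 2 * real L * exp (t / (2 * real L))"
        by (intro mult_left_mono exp_ge_add_one_self) simp
      finally show "1 + t \<le> 2 * real L * exp (t / (2 * real L))" .
    qed (use t in auto)
    also have "\<dots> = (2 * real L) ^ L * (exp (real L * (t / (2 * real L))) * exp (- t))"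
      by (simp only: power_mult_distrib exp_of_nat_mult mult.assoc)
    also have "real L * (t / (2 * real L)) = t / 2" using L by simp
    also have "exp (t / 2) * exp (- t) = exp (- t / 2)" by (simp add: exp_add[symmetric])
    finally show ?thesis .
  qed
  then show ?thesis by (intro exI[of _ "(2 * real L) ^ L"]) auto
qed

text \<open>A pointwise bound instead of integrability: it restricts to every line parallel to a
  coordinate axis, which is where the integration by parts takes place, and its dominating function
  is a product over the coordinates.\<close>

definition exp_dominated :: "nat \<Rightarrow> ((nat \<Rightarrow> real) \<Rightarrow> real) \<Rightarrow> bool" where
  "exp_dominated N g \<longleftrightarrow> (\<forall>x. (\<exists>i\<in>{1..N}. x i \<le> 0) \<longrightarrow> g x = 0) \<and>
     (\<exists>C\<ge>0. \<forall>x. (\<forall>i\<in>{1..N}. x i > 0) \<longrightarrow> \<bar>g x\<bar> \<le> C * (\<Prod>i=1..N. exp (- x i / 2)))"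

lemma exp_dominated_add:
  assumes "exp_dominated N f" "exp_dominated N g"
  shows "exp_dominated N (\<lambda>x. f x + g x)"
proof -
  from assms(1) obtain C where C: "C \<ge> 0" "\<And>x. (\<forall>i\<in>{1..N}. x i > 0) \<Longrightarrow>
     \<bar>f x\<bar> \<le> C * (\<Prod>i=1..N. exp (- x i / 2))"
    unfolding exp_dominated_def by blast
  from assms(2) obtain D where D: "D \<ge> 0" "\<And>x. (\<forall>i\<in>{1..N}. x i > 0) \<Longrightarrow>
     \<bar>g x\<bar> \<le> D * (\<Prod>i=1..N. exp (- x i / 2))"
    unfolding exp_dominated_def by blast
  have "\<bar>f x + g x\<bar> \<le> (C + D) * (\<Prod>i=1..N. exp (- x i / 2))" if x: "\<forall>i\<in>{1..N}. x i > 0" for x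
    using C(2)[OF x] D(2)[OF x] abs_triangle_ineq[of "f x" "g x"] by (simp add: distrib_right)
  moreover have "0 \<le> C + D" using C D by simp
  moreover have "f x + g x = 0" if "\<exists>i\<in>{1..N}. x i \<le> 0" for x
    using that assms unfolding exp_dominated_def by simp
  ultimately show ?thesis unfolding exp_dominated_def by blast
qed

lemma exp_dominated_zero: "exp_dominated N (\<lambda>x. 0)"
  unfolding exp_dominated_def by (auto intro: exI[of _ 0])

lemma exp_dominated_sum:
  assumes "\<And>i. i \<in> A \<Longrightarrow> exp_dominated N (f i)"
  shows "exp_dominated N (\<lambda>x. \<Sum>i\<in>A. f i x)"
  using assms
  by (induction A rule: infinite_finite_induct) (auto intro!: exp_dominated_add exp_dominated_zero)

text \<open>The assumed bound is a product over the coordinates once the powers are distributed, so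
  the one-variable estimate \<open>exp_dominates\<close> applies to each factor.\<close>

lemma exp_dominatedI:
  assumes "\<And>x. (\<exists>i\<in>{1..N}. x i \<le> 0) \<Longrightarrow> g x = 0"
    and "real n \<le> \<alpha>" and "C \<ge> 0"
    and "\<And>x. (\<forall>i\<in>{1..N}. x i > 0) \<Longrightarrow>
      \<bar>g x\<bar> \<le> C * (\<Prod>i=1..N. 1 + inverse (x i)) ^ n * (\<Prod>i=1..N. 1 + x i) ^ K *
        (\<Prod>i=1..N. x i powr \<alpha> * exp (- x i))"
  shows "exp_dominated N g"
proof -
  obtain D where D: "D \<ge> 0" "\<And>t. t > 0 \<Longrightarrow>
      (1 + inverse t) ^ n * (1 + t) ^ K * (t powr \<alpha> * exp (- t)) \<le> D * exp (- t / 2)"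
    using exp_dominates[OF assms(2)] by blast
  have "\<bar>g x\<bar> \<le> (C * D ^ N) * (\<Prod>i=1..N. exp (- x i / 2))" if x: "\<forall>i\<in>{1..N}. x i > 0" for x
  proof -
    have "\<bar>g x\<bar> \<le> C * ((\<Prod>i=1..N. 1 + inverse (x i)) ^ n * (\<Prod>i=1..N. 1 + x i) ^ K *
        (\<Prod>i=1..N. x i powr \<alpha> * exp (- x i)))" using assms(4)[OF x] by (simp add: mult.assoc)
    also have "\<dots> = C * (\<Prod>i=1..N. (1 + inverse (x i)) ^ n * (1 + x i) ^ K * (x i powr \<alpha> * exp (- x
        i)))"
      by (simp only: prod.distrib prod_power_distrib)
    also have "\<dots> \<le> C * (\<Prod>i=1..N. D * exp (- x i / 2))"
      using x D assms(3) by (intro mult_left_mono prod_mono) (auto intro!: mult_nonneg_nonneg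
          add_nonneg_nonneg zero_le_power simp: less_imp_le)
    also have "\<dots> = (C * D ^ N) * (\<Prod>i=1..N. exp (- x i / 2))" by (simp add: prod.distrib)
    finally show ?thesis .
  qed
  moreover have "C * D ^ N \<ge> 0" using assms(3) D by simp
  ultimately show ?thesis unfolding exp_dominated_def using assms(1) by blast
qed

lemma integrable_exp_half: "integrable lborel (\<lambda>t::real. indicator {0<..} t * exp (- t / 2))"
proof -
  interpret prob_space "density lborel (exponential_density (1 / 2))"
    by (rule prob_space_exponential_density) simp
  have "integrable lborel (exponential_density (1 / 2))"
  proof -
    have "integrable (density lborel (exponential_density (1 / 2))) (\<lambda>_. 1 :: real)" by simp
    then show ?thesis
      by (subst (asm) integrable_density) (auto simp: exponential_density_nonneg)
  qed
  then have "integrable lborel (\<lambda>t. 2 * exponential_density (1 / 2) t)" by simp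
  then show ?thesis
    by (rule Bochner_Integration.integrable_bound)
       (auto simp: exponential_density_def indicator_def)
qed

interpretation lborel_prod: product_sigma_finite "\<lambda>_::nat. lborel :: real measure" ..

lemma exp_dominated_integrable:
  assumes "g \<in> borel_measurable (\<Pi>\<^sub>M j\<in>{1..N}. lborel)" "exp_dominated N g"
  shows "integrable (\<Pi>\<^sub>M j\<in>{1..N}. lborel) g"
proof -
  let ?e = "\<lambda>t::real. indicator {0<..} t * exp (- t / 2)"
  obtain C where C: "C \<ge> 0" "\<And>x. (\<forall>i\<in>{1..N}. x i > 0) \<Longrightarrow> \<bar>g x\<bar> \<le> C * (\<Prod>i=1..N. exp (- x i / 2))"
    and 0: "\<And>x. (\<exists>i\<in>{1..N}. x i \<le> 0) \<Longrightarrow> g x = 0"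
    using assms(2) unfolding exp_dominated_def by blast
  have "integrable (\<Pi>\<^sub>M j\<in>{1..N}. lborel) (\<lambda>x. C * (\<Prod>i=1..N. ?e (x i)))"
    by (intro integrable_mult_right lborel_prod.product_integrable_prod integrable_exp_half) auto
  then show ?thesis
  proof (rule Bochner_Integration.integrable_bound)
    show "AE x in (\<Pi>\<^sub>M j\<in>{1..N}. lborel). norm (g x) \<le> norm (C * (\<Prod>i=1..N. ?e (x i)))"
    proof (intro AE_I2)
      fix x
      show "norm (g x) \<le> norm (C * (\<Prod>i=1..N. ?e (x i)))"
      proof (cases "\<forall>i\<in>{1..N}. x i > 0")
        case True
        then have "(\<Prod>i=1..N. ?e (x i)) = (\<Prod>i=1..N. exp (- x i / 2))"
          by (intro prod.cong) auto
        moreover have "0 \<le> (\<Prod>i=1..N. exp (- x i / 2))" by (intro prod_nonneg) auto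
        ultimately show ?thesis using C(2)[OF True] C(1) by (simp only: real_norm_def abs_mult
            abs_of_nonneg)
      next
        case False
        then show ?thesis using 0[of x] by (auto simp: not_less)
      qed
    qed
  qed fact
qed

lemma abs_diff_le_prod:
  fixes x :: "nat \<Rightarrow> real"
  assumes "finite A" "\<And>i. i \<in> A \<Longrightarrow> x i > 0" "i \<in> A" "j \<in> A"
  shows "\<bar>x j - x i\<bar> \<le> (\<Prod>i\<in>A. 1 + x i)"
proof -
  have *: "x k \<le> (\<Prod>i\<in>A. 1 + x i)" if "k \<in> A" for k
  proof -
    have "x k \<le> (1 + x k) * 1" by simp
    also have "\<dots> \<le> (1 + x k) * (\<Prod>i\<in>A-{k}. 1 + x i)"
      using that assms(2) by (intro mult_left_mono prod_ge_1) (auto simp: less_imp_le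
          add_nonneg_nonneg)
    also have "\<dots> = (\<Prod>i\<in>A. 1 + x i)" using that assms(1) by (simp add: prod.remove)
    finally show ?thesis .
  qed
  show ?thesis using *[OF assms(3)] *[OF assms(4)] assms(2)[OF assms(3)] assms(2)[OF assms(4)] by
      linarith
qed

lemma powr_le_power:
  fixes d T b :: real
  assumes "0 \<le> d" "d \<le> T" "1 \<le> T" "0 \<le> b" "b \<le> real B"
  shows "d powr b \<le> T ^ B"
proof -
  have "d powr b \<le> T powr b" using assms by (intro powr_mono2) auto
  also have "\<dots> \<le> T powr real B" using assms by (intro powr_mono) auto
  finally show ?thesis using assms by (simp add: powr_realpow)
qed

lemma one_le_prod_plus:
  fixes x :: "nat \<Rightarrow> real"
  shows "(\<And>i. i \<in> A \<Longrightarrow> x i > 0) \<Longrightarrow> 1 \<le> (\<Prod>i\<in>A. 1 + x i)"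
  by (intro prod_ge_1) (auto simp: less_imp_le)

lemma vandermonde_on_nonneg: "vandermonde_on \<beta> A x \<ge> 0"
  unfolding vandermonde_on_def by (intro prod_nonneg) auto

text \<open>A crude count: at most N * N pairs, each contributing at most the B-th power of the
  product. Sharpness is irrelevant, since the exponential absorbs any power.\<close>

lemma vandermonde_on_le:
  assumes "A \<subseteq> {1..N}" "\<And>i. i \<in> {1..N} \<Longrightarrow> x i > 0" "0 \<le> \<beta>" "\<beta> \<le> real B"
  shows "vandermonde_on \<beta> A x \<le> (\<Prod>i=1..N. 1 + x i) ^ (B * N * N)"
proof -
  let ?T = "\<Prod>i=1..N. 1 + x i"
  have T: "1 \<le> ?T" using assms by (intro one_le_prod_plus) auto
  have fin: "finite A" using assms(1) finite_subset by blast
  have cA: "card A \<le> N" using card_mono[OF _ assms(1)] by simp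
  have c: "card {i\<in>A. i < j} \<le> N" for j
    by (rule order_trans[OF card_mono cA]) (use fin in auto)
  have "vandermonde_on \<beta> A x \<le> ((?T ^ B) ^ N) ^ N"
    unfolding vandermonde_on_def
  proof (rule prod_le_power)
    fix j assume j: "j \<in> A"
    have "(\<Prod>i\<in>{i\<in>A. i < j}. \<bar>x j - x i\<bar> powr \<beta>) \<le> (?T ^ B) ^ N"
    proof (rule prod_le_power[OF _ c])
      fix i assume "i \<in> {i\<in>A. i < j}"
      then have ij: "i \<in> {1..N}" "j \<in> {1..N}" using j assms(1) by auto
      have "\<bar>x j - x i\<bar> \<le> ?T"
        by (intro abs_diff_le_prod assms(2)) (use ij in auto)
      then show "0 \<le> \<bar>x j - x i\<bar> powr \<beta> \<and> \<bar>x j - x i\<bar> powr \<beta> \<le> ?T ^ B"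
        using T assms by (auto intro: powr_le_power)
    qed (use T in auto)
    moreover have "0 \<le> (\<Prod>i\<in>{i\<in>A. i < j}. \<bar>x j - x i\<bar> powr \<beta>)" by (intro prod_nonneg) auto
    ultimately show "0 \<le> (\<Prod>i\<in>{i\<in>A. i < j}. \<bar>x j - x i\<bar> powr \<beta>) \<and>
       (\<Prod>i\<in>{i\<in>A. i < j}. \<bar>x j - x i\<bar> powr \<beta>) \<le> (?T ^ B) ^ N" by blast
  qed (use T cA in auto)
  then show ?thesis by (simp add: power_mult)
qed

lemma exp_dominated_weight:
  assumes "wall_bounded N n f" "real n \<le> \<alpha>" "0 \<le> \<beta>"
  shows "exp_dominated N (\<lambda>x. laguerre_weight \<beta> \<alpha> N x * f x)"
proof -
  obtain C where C: "C \<ge> 0" "\<And>x. (\<forall>i\<in>{1..N}. x i > 0) \<Longrightarrow>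
     \<bar>f x\<bar> \<le> C * (\<Prod>i=1..N. 1 + inverse (x i)) ^ n"
    using assms(1) unfolding wall_bounded_def by blast
  define B where "B = nat \<lceil>\<beta>\<rceil>"
  have B: "\<beta> \<le> real B" unfolding B_def by linarith
  show ?thesis
  proof (rule exp_dominatedI[OF _ assms(2) C(1)])
    fix x :: "nat \<Rightarrow> real" assume x: "\<forall>i\<in>{1..N}. x i > 0"
    let ?w = "\<Prod>i=1..N. x i powr \<alpha> * exp (- x i)"
    have w: "(\<Prod>i=1..N. indicator {0<..} (x i) * (x i powr \<alpha> * exp (- x i))) = ?w"
      using x by (intro prod.cong) auto
    have "\<bar>laguerre_weight \<beta> \<alpha> N x * f x\<bar> = (?w * vandermonde_on \<beta> {1..N} x) * \<bar>f x\<bar>"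
      unfolding abs_mult laguerre_weight_alt w
      by (simp add: abs_prod vandermonde_on_nonneg)
    also have "\<dots> \<le> (?w * (\<Prod>i=1..N. 1 + x i) ^ (B * N * N)) * (C * (\<Prod>i=1..N. 1 + inverse (x i)) ^ n)"
      using x C(2)[OF x] B assms(3)
      by (intro mult_mono vandermonde_on_le)
         (auto intro!: mult_nonneg_nonneg prod_nonneg zero_le_power vandermonde_on_nonneg
             add_nonneg_nonneg simp: less_imp_le)
    finally show "\<bar>laguerre_weight \<beta> \<alpha> N x * f x\<bar> \<le> C * (\<Prod>i=1..N. 1 + inverse (x i)) ^ n *
       (\<Prod>i=1..N. 1 + x i) ^ (B * N * N) * ?w" by (simp add: mult_ac)
  qed (auto simp: laguerre_weight_eq_0)
qed

text \<open>The singularity \<open>1 / (x j - x i)\<close> only lowers one exponent \<open>\<beta>\<close> of the Vandermonde factor by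
    \<open>1\<close>.\<close>

lemma exp_dominated_weight_div:
  assumes "wall_bounded N n f" "real n \<le> \<alpha>" "1 \<le> \<beta>" "i \<in> {1..N}" "j \<in> {1..N}" "i \<noteq> j"
  shows "exp_dominated N (\<lambda>x. laguerre_weight \<beta> \<alpha> N x * (f x / (x j - x i)))"
proof -
  obtain C where C: "C \<ge> 0" "\<And>x. (\<forall>i\<in>{1..N}. x i > 0) \<Longrightarrow>
     \<bar>f x\<bar> \<le> C * (\<Prod>i=1..N. 1 + inverse (x i)) ^ n"
    using assms(1) unfolding wall_bounded_def by blast
  define B where "B = nat \<lceil>\<beta>\<rceil>"
  have B: "\<beta> \<le> real B" unfolding B_def by linarith
  show ?thesis
  proof (rule exp_dominatedI[OF _ assms(2) C(1)])
    fix x :: "nat \<Rightarrow> real" assume x: "\<forall>i\<in>{1..N}. x i > 0"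
    let ?w = "\<Prod>i=1..N. x i powr \<alpha> * exp (- x i)"
    let ?T = "\<Prod>i=1..N. 1 + x i"
    let ?A = "{1..N} - {j}"
    have T: "1 \<le> ?T" using x by (intro one_le_prod_plus) auto
    have w: "(\<Prod>i=1..N. indicator {0<..} (x i) * (x i powr \<alpha> * exp (- x i))) = ?w"
      using x by (intro prod.cong) auto
    have w0: "?w \<ge> 0" by (intro prod_nonneg) auto
    have ins: "insert j ?A = {1..N}" using assms by auto
    have V: "vandermonde_on \<beta> {1..N} x = vandermonde_on \<beta> ?A x * (\<Prod>i\<in>?A. \<bar>x j - x i\<bar> powr \<beta>)"
      using vandermonde_on_insert[of ?A j \<beta> x] ins by simp
    let ?P = "\<Prod>k\<in>?A. if k = i then \<bar>x j - x i\<bar> powr (\<beta> - 1) else \<bar>x j - x k\<bar> powr \<beta>"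
    have "(\<Prod>k\<in>?A. \<bar>x j - x k\<bar> powr \<beta>) / \<bar>x j - x i\<bar> = ?P"
    proof -
      have i: "i \<in> ?A" using assms by auto
      have "(\<Prod>k\<in>?A. \<bar>x j - x k\<bar> powr \<beta>) = \<bar>x j - x i\<bar> powr \<beta> * (\<Prod>k\<in>?A-{i}. \<bar>x j - x k\<bar> powr \<beta>)"
        by (rule prod.remove[OF _ i]) simp
      moreover have "?P = \<bar>x j - x i\<bar> powr (\<beta> - 1) * (\<Prod>k\<in>?A-{i}. \<bar>x j - x k\<bar> powr \<beta>)"
        by (subst prod.remove[OF _ i]) (auto intro!: prod.cong)
      \<comment> \<open>At a collision both sides are 0, by the conventions for
        \<open>0 powr\<close> and for division by 0.\<close>
      moreover have "\<bar>x j - x i\<bar> powr \<beta> / \<bar>x j - x i\<bar> = \<bar>x j - x i\<bar> powr (\<beta> - 1)"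
        using powr_diff[of "\<bar>x j - x i\<bar>" \<beta> 1] by (cases "x j = x i") auto
      ultimately show ?thesis by (simp only: times_divide_eq_left[symmetric])
    qed
    moreover have "?P \<le> (?T ^ B) ^ N"
    proof (rule prod_le_power)
      fix k assume k: "k \<in> ?A"
      have "\<bar>x j - x k\<bar> \<le> ?T" "\<bar>x j - x i\<bar> \<le> ?T"
        by (intro abs_diff_le_prod; use x k assms in auto)+
      then show "0 \<le> (if k = i then \<bar>x j - x i\<bar> powr (\<beta> - 1) else \<bar>x j - x k\<bar> powr \<beta>) \<and>
          (if k = i then \<bar>x j - x i\<bar> powr (\<beta> - 1) else \<bar>x j - x k\<bar> powr \<beta>) \<le> ?T ^ B"
        using T assms B by (auto intro!: powr_le_power)
    next
      show "card ?A \<le> N" by (rule order_trans[OF card_mono[of "{1..N}"]]) auto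
    qed (use T in auto)
    ultimately have P: "(\<Prod>k\<in>?A. \<bar>x j - x k\<bar> powr \<beta>) / \<bar>x j - x i\<bar> \<le> ?T ^ (B * N)"
      by (simp add: power_mult)
    have "\<bar>laguerre_weight \<beta> \<alpha> N x * (f x / (x j - x i))\<bar> =
        ?w * vandermonde_on \<beta> ?A x * ((\<Prod>k\<in>?A. \<bar>x j - x k\<bar> powr \<beta>) / \<bar>x j - x i\<bar>) * \<bar>f x\<bar>"
      unfolding abs_mult abs_divide laguerre_weight_alt w V
      using w0 vandermonde_on_nonneg[of \<beta> ?A x] by (simp add: abs_prod mult_ac)
    also have "\<dots> \<le> ?w * ?T ^ (B * N * N) * ?T ^ (B * N) * (C * (\<Prod>i=1..N. 1 + inverse (x i)) ^ n)"
      using x C(2)[OF x] B assms T w0 P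
      by (intro mult_mono vandermonde_on_le)
         (auto intro!: mult_nonneg_nonneg prod_nonneg zero_le_power vandermonde_on_nonneg
             divide_nonneg_nonneg)
    finally show "\<bar>laguerre_weight \<beta> \<alpha> N x * (f x / (x j - x i))\<bar> \<le> C * (\<Prod>i=1..N. 1 + inverse (x
        i)) ^ n *
       ?T ^ (B * N * N + B * N) * ?w" by (simp add: mult_ac power_add)
  qed (auto simp: laguerre_weight_eq_0)
qed

section \<open>Integration by parts\<close>

lemma tendsto_t_exp: "((\<lambda>t::real. t * exp (- t / 2)) \<longlongrightarrow> 0) at_top"
  by real_asymp

text \<open>The derivative is only required off a finite set: the Vandermonde factor has a corner at every
  other particle.\<close>

lemma integral_derivative_zero:
  fixes \<phi> A :: "real \<Rightarrow> real"
  assumes "finite S" and neg: "\<And>t. t \<le> 0 \<Longrightarrow> \<phi> t = 0" "\<And>t. t \<le> 0 \<Longrightarrow> A t = 0"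
    and bd: "\<And>t. t > 0 \<Longrightarrow> \<bar>\<phi> t\<bar> \<le> C * (t * exp (- t / 2))"
    and cont: "continuous_on {0<..} \<phi>"
    and der: "\<And>t. t > 0 \<Longrightarrow> t \<notin> S \<Longrightarrow> (\<phi> has_real_derivative A t) (at t)"
    and int: "integrable lborel A"
  shows "(\<integral>t. A t \<partial>lborel) = 0"
proof -
  have "((\<lambda>t. C * (t * exp (- t / 2))) \<longlongrightarrow> C * (0 * exp (- 0 / 2))) (at_right 0)"
    by (intro tendsto_intros) auto
  moreover have "\<forall>\<^sub>F t in at_right 0. norm (\<phi> t) \<le> C * (t * exp (- t / 2))"
    using eventually_at_right_less[of 0] by eventually_elim (simp only: real_norm_def bd)
  ultimately have "(\<phi> \<longlongrightarrow> 0) (at_right 0)"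
    using Lim_null_comparison[of \<phi> "\<lambda>t. C * (t * exp (- t / 2))"] by simp
  then have c0: "continuous (at 0 within {0..b}) \<phi>" for b
    unfolding continuous_within using neg
    by (auto intro: tendsto_within_subset[where S="{0..}"] simp: at_within_Ici_at_right)
  have contb: "continuous_on {0..b} \<phi>" for b
    unfolding continuous_on_eq_continuous_within
  proof
    fix t assume t: "t \<in> {0..b}"
    show "continuous (at t within {0..b}) \<phi>"
    proof (cases "t = 0")
      case False
      then have "t \<in> {0<..}" using t by auto
      then have "isCont \<phi> t" using cont by (simp add: continuous_on_eq_continuous_at)
      then show ?thesis by (rule continuous_at_imp_continuous_at_within)
    qed (use c0 in simp)
  qed
  \<comment> \<open>The fundamental theorem leaves only the boundary term at b, since \<phi>
    vanishes at 0. As b grows this term decays, while the truncated integral tends to the full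
    one.\<close>
  have eq: "(\<integral>t. indicator {..b} t *\<^sub>R A t \<partial>lborel) = \<phi> b" if b: "b > 0" for b
  proof -
    have "(A has_integral (\<phi> b - \<phi> 0)) {0..b}"
      using b by (intro fundamental_theorem_of_calculus_interior_strong[OF assms(1)] contb)
        (auto simp: has_real_derivative_iff_has_vector_derivative[symmetric] intro: der)
    then have 1: "integral {0..b} A = \<phi> b" using neg(1)[of 0] by (simp add: integral_unique)
    have si: "set_integrable lborel {0..b} A"
      unfolding set_integrable_def by (intro integrable_mult_indicator int) auto
    have "(\<integral>t. indicator {..b} t *\<^sub>R A t \<partial>lborel) = (LINT t:{0..b}|lborel. A t)"
      unfolding set_lebesgue_integral_def
      by (intro Bochner_Integration.integral_cong) (auto simp: indicator_def neg)
    also have "\<dots> = integral {0..b} A" by (rule set_borel_integral_eq_integral(2)[OF si])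
    finally show ?thesis using 1 by simp
  qed
  have "((\<lambda>b. \<integral>t. indicator {..b} t *\<^sub>R A t \<partial>lborel) \<longlongrightarrow> (\<integral>t. A t \<partial>lborel)) at_top"
    by (rule tendsto_integral_at_top[OF _ int]) simp
  moreover have "((\<lambda>b. \<integral>t. indicator {..b} t *\<^sub>R A t \<partial>lborel) \<longlongrightarrow> 0) at_top"
  proof (rule Lim_null_comparison)
    show "((\<lambda>t. C * (t * exp (- t / 2))) \<longlongrightarrow> 0) at_top"
      using tendsto_mult_right_zero[OF tendsto_t_exp] by simp
    show "\<forall>\<^sub>F t in at_top. norm (\<integral>s. indicator {..t} s *\<^sub>R A s \<partial>lborel) \<le> C * (t * exp (- t / 2))"
      using eventually_gt_at_top[of 0] by eventually_elim (simp only: eq bd real_norm_def)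
  qed
  ultimately show ?thesis by (rule tendsto_unique[rotated]) simp
qed

text \<open>The product rule in terms of logarithmic derivatives g. Writing the derivative of each
  factor as \<open>f i t * g i\<close> avoids both a division and the omission of one factor from
  the product.\<close>

lemma has_real_derivative_prod_log:
  fixes f :: "'a \<Rightarrow> real \<Rightarrow> real"
  assumes "\<And>i. i \<in> A \<Longrightarrow> (f i has_real_derivative f i t * g i) (at t)"
  shows "((\<lambda>t. \<Prod>i\<in>A. f i t) has_real_derivative (\<Prod>i\<in>A. f i t) * (\<Sum>i\<in>A. g i)) (at t)"
  using assms
proof (induction A rule: infinite_finite_induct)
  case (insert i A)
  then have "((\<lambda>t. f i t * (\<Prod>i\<in>A. f i t)) has_real_derivative
     (f i t * g i) * (\<Prod>i\<in>A. f i t) + ((\<Prod>i\<in>A. f i t) * (\<Sum>i\<in>A. g i)) * f i t) (at t)"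
    by (intro DERIV_mult) auto
  with insert.hyps show ?case by (simp add: algebra_simps)
qed auto

lemma has_real_derivative_abs_powr:
  assumes "t \<noteq> (a::real)"
  shows "((\<lambda>t. \<bar>t - a\<bar> powr b) has_real_derivative \<bar>t - a\<bar> powr b * (b / (t - a))) (at t)"
proof (cases "t > a")
  case True
  have "((\<lambda>t. (t - a) powr b) has_real_derivative \<bar>t - a\<bar> powr b * (b / (t - a))) (at t)"
    using True by (auto intro!: derivative_eq_intros simp: powr_diff)
  then show ?thesis
    by (rule has_field_derivative_transform_within_open[of _ _ _ "{a<..}"]) (use True in auto)
next
  case False
  then have ta: "t < a" using assms by simp
  have "((\<lambda>t. (a - t) powr b) has_real_derivative \<bar>t - a\<bar> powr b * (b / (t - a))) (at t)"
    using ta by (auto intro!: derivative_eq_intros simp: powr_diff field_simps)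
  then show ?thesis
    by (rule has_field_derivative_transform_within_open[of _ _ _ "{..<a}"]) (use ta in auto)
qed

lemma inv_pow_sum_upd:
  assumes "j \<in> {1..N}"
  shows "inv_pow_sum N p (x(j := t)) = inverse t ^ p + (\<Sum>i\<in>{1..N}-{j}. inverse (x i) ^ p)"
  unfolding inv_pow_sum_def by (subst sum.remove[OF _ assms]) (auto intro!: sum.cong)

lemma has_real_derivative_inverse_power:
  assumes "t \<noteq> (0::real)"
  shows "((\<lambda>t. inverse t ^ p) has_real_derivative - real p * inverse t ^ Suc p) (at t)"
proof -
  have "((\<lambda>t. inverse t ^ p) has_real_derivative real p * (- (inverse t ^ Suc (Suc 0)) * inverse t
      ^ (p - Suc 0))) (at t)"
    by (rule DERIV_power[OF DERIV_inverse[OF assms]])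
  also have "real p * (- (inverse t ^ Suc (Suc 0)) * inverse t ^ (p - Suc 0)) = - real p * inverse
      t ^ Suc p"
    by (cases p) (simp_all add: algebra_simps)
  finally show ?thesis .
qed

lemma has_real_derivative_inv_pow_sum:
  assumes "j \<in> {1..N}" "t \<noteq> 0"
  shows "((\<lambda>t. inv_pow_sum N p (x(j := t))) has_real_derivative - real p * inverse t ^ Suc p) (at
      t)"
proof -
  from DERIV_add[OF has_real_derivative_inverse_power[OF assms(2), of p] DERIV_const[of
      "\<Sum>i\<in>{1..N}-{j}. inverse (x i) ^ p"]]
  have "((\<lambda>t. inverse t ^ p + (\<Sum>i\<in>{1..N}-{j}. inverse (x i) ^ p)) has_real_derivative
      - real p * inverse t ^ Suc p) (at t)" by (simp only: add_0_right)
  then show ?thesis unfolding inv_pow_sum_upd[OF assms(1)] .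
qed

lemma has_real_derivative_inv_prod:
  assumes "j \<in> {1..N}" "t \<noteq> 0"
  shows "((\<lambda>t. inv_prod N ps (x(j := t))) has_real_derivative inv_prod_partial N ps j (x(j := t)))
      (at t)"
proof (induction ps)
  case (Cons p ps)
  show ?case
    unfolding inv_prod_Cons inv_prod_partial.simps
    by (rule DERIV_cong[OF DERIV_mult[OF has_real_derivative_inv_pow_sum[OF assms, of p x]
        Cons.IH]])
       (simp only: fun_upd_same mult.commute[of "inv_prod_partial N ps j (x(j := t))"])
qed simp

section \<open>Measurability, and the total derivatives that are integrated\<close>

lemma laguerre_weight_measurable:
  "laguerre_weight \<beta> \<alpha> N \<in> borel_measurable (\<Pi>\<^sub>M j\<in>{1..N}. lborel)"
proof -
  have "(\<lambda>x. laguerre_weight \<beta> \<alpha> N x) \<in> borel_measurable (\<Pi>\<^sub>M j\<in>{1..N}. lborel)"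
    unfolding laguerre_weight_alt vandermonde_on_def by measurable
  then show ?thesis by simp
qed

lemma inv_pow_sum_measurable [measurable]:
  "(\<lambda>x. inv_pow_sum N p x) \<in> borel_measurable (\<Pi>\<^sub>M j\<in>{1..N}. lborel)"
  unfolding inv_pow_sum_def by measurable

lemma inv_prod_measurable [measurable]:
  "inv_prod N ps \<in> borel_measurable (\<Pi>\<^sub>M j\<in>{1..N}. lborel)"
proof (induction ps)
  case Nil
  have "inv_prod N [] = (\<lambda>_. 1)" by (rule ext) simp
  then show ?case by (simp only: borel_measurable_const)
next
  case (Cons p ps)
  have "inv_prod N (p # ps) = (\<lambda>x. inv_pow_sum N p x * inv_prod N ps x)" by (rule ext) simp
  then show ?case
    using borel_measurable_times[OF inv_pow_sum_measurable Cons.IH] by (simp only:)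
qed

lemma inv_prod_partial_measurable:
  assumes "j \<in> {1..N}"
  shows "inv_prod_partial N ps j \<in> borel_measurable (\<Pi>\<^sub>M j\<in>{1..N}. lborel)"
proof (induction ps)
  case Nil
  have "inv_prod_partial N [] j = (\<lambda>_. 0)" by (rule ext) simp
  then show ?case by (simp only: borel_measurable_const)
next
  case (Cons p ps)
  have "(\<lambda>x. - real p * inverse (x j) ^ Suc p * inv_prod N ps x + inv_pow_sum N p x *
      inv_prod_partial N ps j x)
      \<in> borel_measurable (\<Pi>\<^sub>M j\<in>{1..N}. lborel)"
    using assms
    by (intro borel_measurable_add borel_measurable_times inv_prod_measurable
        inv_pow_sum_measurable Cons.IH
        borel_measurable_power borel_measurable_inverse borel_measurable_const) auto
  moreover have "inv_prod_partial N (p # ps) j =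
      (\<lambda>x. - real p * inverse (x j) ^ Suc p * inv_prod N ps x + inv_pow_sum N p x *
          inv_prod_partial N ps j x)"
    by (rule ext) simp
  ultimately show ?case by (simp only:)
qed

text \<open>The derivative of x_j^(-m) F w in x_j, divided by the weight w. The bracket is the
  logarithmic derivative of x_j^(-m) w; the last summand differentiates F =
  \<open>inv_prod N ps\<close>.\<close>

definition loop_density :: "real \<Rightarrow> real \<Rightarrow> nat \<Rightarrow> nat \<Rightarrow> nat list \<Rightarrow> nat \<Rightarrow> (nat \<Rightarrow> real) \<Rightarrow> real" where
  "loop_density \<beta> \<alpha> N m ps j x =
     inverse (x j) ^ m * inv_prod N ps x *
       ((\<alpha> - real m) * inverse (x j) - 1 + (\<Sum>i\<in>{1..N}-{j}. \<beta> / (x j - x i))) +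
     inverse (x j) ^ m * inv_prod_partial N ps j x"

text \<open>Differentiating x_j^(-m) w or F costs at most one further power of the inverse
  coordinates, whence the \<open>+ 1\<close>. The interaction terms leave the wall exponent alone
  and use \<beta> >= 1 instead.\<close>

lemma loop_density_dominated:
  assumes "j \<in> {1..N}" "1 \<le> \<beta>" "real (m + sum_list ps + 1) \<le> \<alpha>"
  shows "exp_dominated N (\<lambda>x. laguerre_weight \<beta> \<alpha> N x * loop_density \<beta> \<alpha> N m ps j x)"
proof -
  let ?W = "laguerre_weight \<beta> \<alpha> N" and ?F = "\<lambda>x. inverse (x j) ^ m * inv_prod N ps x"
  have wF: "wall_bounded N (m + sum_list ps) ?F"
    by (intro wall_bounded_mult wall_bounded_inverse_power wall_bounded_inv_prod assms)
  have w1: "wall_bounded N (m + sum_list ps + (0 + 1)) (\<lambda>x. ?F x * ((\<alpha> - real m) * inverse (x j) ^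
      1))"
    by (intro wall_bounded_mult[OF wF] wall_bounded_mult wall_bounded_const
        wall_bounded_inverse_power assms)
  have w2: "wall_bounded N (m + sum_list ps + 0) (\<lambda>x. ?F x * (- 1))"
    by (intro wall_bounded_mult[OF wF] wall_bounded_const)
  have w3: "wall_bounded N (m + Suc (sum_list ps)) (\<lambda>x. inverse (x j) ^ m * inv_prod_partial N ps
      j x)"
    by (intro wall_bounded_mult wall_bounded_inverse_power wall_bounded_inv_prod_partial assms)
  have w4: "wall_bounded N (m + sum_list ps + 0) (\<lambda>x. ?F x * \<beta>)"
    by (intro wall_bounded_mult[OF wF] wall_bounded_const)
  have "exp_dominated N (\<lambda>x. ((?W x * (?F x * ((\<alpha> - real m) * inverse (x j) ^ 1))) + (?W x * (?F x
      * (- 1)))) +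
     (?W x * (inverse (x j) ^ m * inv_prod_partial N ps j x) +
      (\<Sum>i\<in>{1..N}-{j}. ?W x * (?F x * \<beta> / (x j - x i)))))"
    by (intro exp_dominated_add exp_dominated_sum exp_dominated_weight[OF w1]
        exp_dominated_weight[OF w2]
        exp_dominated_weight[OF w3] exp_dominated_weight_div[OF w4])
       (use assms in auto)
  moreover have "(\<lambda>x. ((?W x * (?F x * ((\<alpha> - real m) * inverse (x j) ^ 1))) + (?W x * (?F x * (-
      1)))) +
     (?W x * (inverse (x j) ^ m * inv_prod_partial N ps j x) +
      (\<Sum>i\<in>{1..N}-{j}. ?W x * (?F x * \<beta> / (x j - x i))))) =
     (\<lambda>x. ?W x * loop_density \<beta> \<alpha> N m ps j x)"
    by (rule ext) (simp add: loop_density_def ring_distribs sum_distrib_left mult_ac)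
  ultimately show ?thesis by (simp only:)
qed

lemma loop_density_measurable:
  assumes "j \<in> {1..N}"
  shows "(\<lambda>x. laguerre_weight \<beta> \<alpha> N x * loop_density \<beta> \<alpha> N m ps j x) \<in> borel_measurable (\<Pi>\<^sub>M
      j\<in>{1..N}. lborel)"
  using assms unfolding loop_density_def
  by (intro borel_measurable_times borel_measurable_add borel_measurable_diff borel_measurable_sum
      borel_measurable_power borel_measurable_inverse borel_measurable_divide inv_prod_measurable
      laguerre_weight_measurable inv_prod_partial_measurable borel_measurable_const) auto

text \<open>By Fubini the j-th coordinate is integrated first, and the inner integral is that of a
  derivative whose primitive vanishes at both ends.\<close>

lemma loop_density_integral_zero:
  assumes j: "j \<in> {1..N}" and \<beta>: "1 \<le> \<beta>" and \<alpha>: "real (m + sum_list ps + 1) \<le> \<alpha>"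
  shows "(\<integral>x. laguerre_weight \<beta> \<alpha> N x * loop_density \<beta> \<alpha> N m ps j x \<partial>(\<Pi>\<^sub>M j\<in>{1..N}. lborel)) = 0"
proof -
  let ?W = "laguerre_weight \<beta> \<alpha> N" and ?I = "{1..N} - {j}"
  let ?A = "\<lambda>x. ?W x * loop_density \<beta> \<alpha> N m ps j x"
  have ins: "insert j ?I = {1..N}" using j by auto
  have dom: "exp_dominated N ?A" by (rule loop_density_dominated[OF assms])
  have meas: "?A \<in> borel_measurable (\<Pi>\<^sub>M j\<in>{1..N}. lborel)" by (rule loop_density_measurable[OF j])
  obtain C where C: "C \<ge> 0" "\<And>x. (\<forall>i\<in>{1..N}. x i > 0) \<Longrightarrow> \<bar>?A x\<bar> \<le> C * (\<Prod>i=1..N. exp (- x i / 2))"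
    and A0: "\<And>x. (\<exists>i\<in>{1..N}. x i \<le> 0) \<Longrightarrow> ?A x = 0"
    using dom unfolding exp_dominated_def by blast
  \<comment> \<open>One inverse power more than the primitive has: the primitive is t times this
    dominated function, which gives the factor t that makes it vanish at the wall.\<close>
  have "wall_bounded N (Suc m + sum_list ps) (\<lambda>x. inverse (x j) ^ Suc m * inv_prod N ps x)"
    by (intro wall_bounded_mult wall_bounded_inverse_power wall_bounded_inv_prod j)
  then have "exp_dominated N (\<lambda>x. ?W x * (inverse (x j) ^ Suc m * inv_prod N ps x))"
    by (rule exp_dominated_weight) (use assms in auto)
  then obtain D where D: "D \<ge> 0" "\<And>x. (\<forall>i\<in>{1..N}. x i > 0) \<Longrightarrow>
      \<bar>?W x * (inverse (x j) ^ Suc m * inv_prod N ps x)\<bar> \<le> D * (\<Prod>i=1..N. exp (- x i / 2))"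
    unfolding exp_dominated_def by blast
  have inner: "(\<integral>t. ?A (x(j := t)) \<partial>lborel) = 0" if xs: "x \<in> space (\<Pi>\<^sub>M i\<in>?I. (lborel :: real
      measure))" for x
  proof (cases "\<forall>i\<in>?I. x i > 0")
    case False
    then obtain i where "i \<in> ?I" "x i \<le> 0" by (meson not_less)
    then have "?A (x(j := t)) = 0" for t by (intro A0 bexI[of _ i]) auto
    then show ?thesis by (simp only:) simp
  next
    case True
    let ?e = "\<Prod>i\<in>?I. exp (- x i / 2)"
    have e: "(\<Prod>i=1..N. exp (- (x(j := t)) i / 2)) = exp (- t / 2) * ?e" for t
      by (subst prod.remove[OF _ j]) (auto intro!: prod.cong)
    have pos: "\<forall>i\<in>{1..N}. (x(j := t)) i > 0" if "t > 0" for t using True that by auto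
    let ?\<phi> = "\<lambda>t. ?W (x(j := t)) * (inverse t ^ m * inv_prod N ps (x(j := t)))"
    define K where "K = (\<Prod>i\<in>?I. indicator {0<..} (x i) * (x i powr \<alpha> * exp (- x i))) *
        vandermonde_on \<beta> ?I x"
    \<comment> \<open>On t > 0 the weight is \<open>K * G t\<close>. Without the indicator the usual
      differentiation rules apply, and the result is transferred back on the open half-line.\<close>
    define G where "G = (\<lambda>t. t powr \<alpha> * exp (- t) * (\<Prod>i\<in>?I. \<bar>t - x i\<bar> powr \<beta>))"
    have W: "?W (x(j := t)) = K * G t" if "t > 0" for t
      unfolding laguerre_weight_split[OF j] K_def G_def using that by simp
    show ?thesis
    proof (rule integral_derivative_zero[where \<phi> = ?\<phi> and S = "x ` ?I" and C = "D * ?e"])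
      fix t :: real assume "t \<le> 0"
      then show "?\<phi> t = 0" "?A (x(j := t)) = 0"
        using laguerre_weight_eq_0[OF j, of "x(j := t)"] by simp_all
    next
      fix t :: real assume t: "t > 0"
      have "?\<phi> t = t * (?W (x(j := t)) * (inverse ((x(j := t)) j) ^ Suc m * inv_prod N ps (x(j :=
          t))))"
        using t by simp
      then have "\<bar>?\<phi> t\<bar> = t * \<bar>?W (x(j := t)) * (inverse ((x(j := t)) j) ^ Suc m * inv_prod N ps
          (x(j := t)))\<bar>"
        using t by (simp only: abs_mult abs_of_pos)
      also have "\<dots> \<le> t * (D * (\<Prod>i=1..N. exp (- (x(j := t)) i / 2)))"
        using t by (intro mult_left_mono D(2) pos) auto
      finally show "\<bar>?\<phi> t\<bar> \<le> D * ?e * (t * exp (- t / 2))" unfolding e by (simp only: mult_ac)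
    next
      have "continuous_on {0<..} (\<lambda>t. inv_prod N ps (x(j := t)))"
        by (rule continuous_at_imp_continuous_on)
           (auto intro!: DERIV_isCont[OF has_real_derivative_inv_prod[OF j]])
      then have "continuous_on {0<..} (\<lambda>t. K * G t * (inverse t ^ m * inv_prod N ps (x(j := t))))"
        unfolding G_def using \<beta>
        by (intro continuous_on_mult continuous_on_const continuous_on_prod continuous_on_powr'
            continuous_on_powr continuous_on_exp continuous_on_power continuous_on_inverse
            continuous_on_minus continuous_on_id continuous_on_rabs continuous_on_diff) auto
      then show "continuous_on {0<..} ?\<phi>"
        by (rule continuous_on_eq) (auto simp: W)
    next
      fix t :: real assume t: "t > 0" and tS: "t \<notin> x ` ?I"
      have d1: "((\<lambda>t. t powr \<alpha> * exp (- t)) has_real_derivative (t powr \<alpha> * exp (- t)) * (\<alpha> *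
          inverse t - 1)) (at t)"
        using t by (auto intro!: derivative_eq_intros simp: powr_diff field_simps)
      have d2: "((\<lambda>t. \<Prod>i\<in>?I. \<bar>t - x i\<bar> powr \<beta>) has_real_derivative
          (\<Prod>i\<in>?I. \<bar>t - x i\<bar> powr \<beta>) * (\<Sum>i\<in>?I. \<beta> / (t - x i))) (at t)"
        using tS by (intro has_real_derivative_prod_log has_real_derivative_abs_powr) auto
      have dG: "(G has_real_derivative G t * (\<alpha> * inverse t - 1 + (\<Sum>i\<in>?I. \<beta> / (t - x i)))) (at t)"
        unfolding G_def by (rule DERIV_cong[OF DERIV_mult[OF d1 d2]]) (simp add: algebra_simps)
      have t0: "t \<noteq> 0" using t by simp
      have "((\<lambda>t. K * G t * (inverse t ^ m * inv_prod N ps (x(j := t)))) has_real_derivative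
         ?A (x(j := t))) (at t)"
        by (rule DERIV_cong[OF DERIV_mult[OF DERIV_cmult[OF dG] DERIV_mult[OF
              has_real_derivative_inverse_power[OF t0] has_real_derivative_inv_prod[OF j t0]]]])
           (simp add: W[OF t] loop_density_def algebra_simps)
      then show "(?\<phi> has_real_derivative ?A (x(j := t))) (at t)"
        by (rule has_field_derivative_transform_within_open[of _ _ _ "{0<..}"]) (use t W in auto)
    next
      have "integrable lborel (\<lambda>t::real. C * ?e * (indicator {0<..} t * exp (- t / 2)))"
        by (intro integrable_mult_right integrable_exp_half)
      then show "integrable lborel (\<lambda>t. ?A (x(j := t)))"
      proof (rule Bochner_Integration.integrable_bound)
        have "(\<lambda>t. x(j := t)) \<in> measurable lborel (\<Pi>\<^sub>M i\<in>insert j ?I. lborel)"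
          by (rule measurable_component_update[OF xs]) simp
        then show "(\<lambda>t. ?A (x(j := t))) \<in> borel_measurable lborel"
          unfolding ins by (rule measurable_compose[OF _ meas])
        show "AE t in lborel. norm (?A (x(j := t))) \<le> norm (C * ?e * (indicator {0<..} t * exp (-
            t / 2)))"
        proof (rule AE_I2)
          fix t :: real
          show "norm (?A (x(j := t))) \<le> norm (C * ?e * (indicator {0<..} t * exp (- t / 2)))"
          proof (cases "t > 0")
            case True
            have "norm (?A (x(j := t))) \<le> C * (exp (- t / 2) * ?e)"
              using C(2)[OF pos[OF True]] unfolding e real_norm_def .
            also have "\<dots> = norm (C * ?e * (indicator {0<..} t * exp (- t / 2)))"
              using True C(1) by (simp add: abs_mult prod_nonneg abs_prod)
            finally show ?thesis .
          next
            case False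
            then have "?A (x(j := t)) = 0" using j by (intro A0) auto
            then show ?thesis by (simp only: norm_zero norm_ge_zero)
          qed
        qed
      qed
    qed simp
  qed
  have "(\<integral>x. ?A x \<partial>(\<Pi>\<^sub>M j\<in>insert j ?I. lborel)) =
      (\<integral>x. (\<integral>t. ?A (x(j := t)) \<partial>lborel) \<partial>(\<Pi>\<^sub>M j\<in>?I. lborel))"
    by (rule lborel_prod.product_integral_insert)
       (use exp_dominated_integrable[OF meas dom] ins in simp_all)
  also have "\<dots> = (\<integral>x. 0 \<partial>(\<Pi>\<^sub>M j\<in>?I. (lborel :: real measure)))"
    by (rule Bochner_Integration.integral_cong[OF refl inner])
  finally show ?thesis unfolding ins by simp
qed

section \<open>Loop equations\<close>

text \<open>Minus the sum over j of x_j^(-m) times the j-th partial derivative of F: each part p in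
  turn becomes m + p + 1, with coefficient p.\<close>

fun loop_drift :: "nat \<Rightarrow> nat \<Rightarrow> nat list \<Rightarrow> (nat \<Rightarrow> real) \<Rightarrow> real" where
  "loop_drift N m [] x = 0"
| "loop_drift N m (p # ps) x =
     real p * inv_pow_sum N (Suc (m + p)) x * inv_prod N ps x + inv_pow_sum N p x * loop_drift N m
         ps x"

lemma sum_inv_prod_partial:
  "(\<Sum>j=1..N. inverse (x j) ^ m * inv_prod_partial N ps j x) = - loop_drift N m ps x"
proof (induction ps)
  case (Cons p ps)
  have "(\<Sum>j=1..N. inverse (x j) ^ m * inv_prod_partial N (p # ps) j x) =
      (\<Sum>j=1..N. - real p * inv_prod N ps x * inverse (x j) ^ Suc (m + p)) +
      (\<Sum>j=1..N. inv_pow_sum N p x * (inverse (x j) ^ m * inv_prod_partial N ps j x))"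
    unfolding sum.distrib[symmetric] by (intro sum.cong refl) (simp add: power_add algebra_simps)
  also have "\<dots> = - real p * inv_prod N ps x * inv_pow_sum N (Suc (m + p)) x + inv_pow_sum N p x *
      (- loop_drift N m ps x)"
    unfolding sum_distrib_left[symmetric] Cons.IH inv_pow_sum_def ..
  finally show ?case by simp
qed simp

text \<open>Symmetrise in i and j. With a = 1 / x_j and b = 1 / x_i the two terms of a pair add up
  to - a b (a^m - b^m) / (a - b), a polynomial in a and b. This is why the interaction can be
  expressed by power sums alone.\<close>

lemma sum_inverse_difference:
  fixes x :: "nat \<Rightarrow> real"
  assumes fin: "finite I" and nz: "\<And>i. i \<in> I \<Longrightarrow> x i \<noteq> 0" and inj: "inj_on x I"
  shows "2 * (\<Sum>j\<in>I. \<Sum>i\<in>I-{j}. inverse (x j) ^ m / (x j - x i)) =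
     real m * (\<Sum>j\<in>I. inverse (x j) ^ Suc m) -
     (\<Sum>l<m. (\<Sum>j\<in>I. inverse (x j) ^ Suc l) * (\<Sum>i\<in>I. inverse (x i) ^ (m - l)))"
proof -
  define g where "g = (\<lambda>j i. if i = j then 0 else inverse (x j) ^ m / (x j - x i))"
  have "(\<Sum>i\<in>I-{j}. inverse (x j) ^ m / (x j - x i)) = (\<Sum>i\<in>I. g j i)" for j
    unfolding g_def by (rule sum.mono_neutral_cong_left) (use fin in auto)
  then have "2 * (\<Sum>j\<in>I. \<Sum>i\<in>I-{j}. inverse (x j) ^ m / (x j - x i)) = (\<Sum>j\<in>I. \<Sum>i\<in>I. g j i) + (\<Sum>j\<in>I.
      \<Sum>i\<in>I. g j i)"
    by simp
  also have "\<dots> = (\<Sum>j\<in>I. \<Sum>i\<in>I. g j i) + (\<Sum>j\<in>I. \<Sum>i\<in>I. g i j)"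
    by (subst (2) sum.swap) simp
  also have "\<dots> = (\<Sum>j\<in>I. \<Sum>i\<in>I. g j i + g i j)"
    by (simp add: sum.distrib)
  \<comment> \<open>The sum over l extends to the diagonal, where it consists of m equal terms; the
    conditional term cancels them.\<close>
  also have "\<dots> = (\<Sum>j\<in>I. \<Sum>i\<in>I. (if i = j then real m * inverse (x j) ^ Suc m else 0) -
       (\<Sum>l<m. inverse (x j) ^ Suc l * inverse (x i) ^ (m - l)))"
  proof (intro sum.cong refl)
    fix i j assume ij: "i \<in> I" "j \<in> I"
    define a where "a = inverse (x j)"
    define b where "b = inverse (x i)"
    show "g j i + g i j = (if i = j then real m * inverse (x j) ^ Suc m else 0) -
       (\<Sum>l<m. inverse (x j) ^ Suc l * inverse (x i) ^ (m - l))"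
    proof (cases "i = j")
      case True
      have "(\<Sum>l<m. inverse (x j) ^ Suc l * inverse (x i) ^ (m - l)) = (\<Sum>l<m. inverse (x j) ^ Suc m)"
        using True by (intro sum.cong refl) (simp add: power_add[symmetric])
      then show ?thesis using True by (simp add: g_def)
    next
      case False
      have ne: "x j \<noteq> x i" using False ij inj by (auto simp: inj_on_def)
      have nz': "x i \<noteq> 0" "x j \<noteq> 0" using nz ij by auto
      have xa: "x j = 1 / a" "x i = 1 / b" "a \<noteq> 0" "b \<noteq> 0" "a \<noteq> b"
        using ne nz' by (auto simp: a_def b_def field_simps)
      have "(\<Sum>l<m. a ^ Suc l * b ^ (m - l)) = a * b * (\<Sum>l<m. b ^ (m - Suc l) * a ^ l)"
        unfolding sum_distrib_left
      proof (intro sum.cong refl)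
        fix l assume "l \<in> {..<m}"
        then have "m - l = Suc (m - Suc l)" by auto
        then show "a ^ Suc l * b ^ (m - l) = a * b * (b ^ (m - Suc l) * a ^ l)" by (simp only:
            power_Suc mult_ac)
      qed
      then have "(a - b) * (\<Sum>l<m. a ^ Suc l * b ^ (m - l)) = a * b * (a ^ m - b ^ m)"
        unfolding power_diff_sumr2[of a m b] by (simp only: mult_ac)
      then have "(\<Sum>l<m. a ^ Suc l * b ^ (m - l)) = a * b * (a ^ m - b ^ m) / (a - b)"
        using xa by (simp add: eq_divide_eq mult.commute)
      moreover have "a ^ m / (x j - x i) + b ^ m / (x i - x j) = - (a * b * (a ^ m - b ^ m) / (a -
          b))"
      proof -
        have "x j - x i = (b - a) / (a * b)" "x i - x j = (a - b) / (a * b)"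
          unfolding xa(1,2) using xa(3,4) by (simp_all add: field_simps)
        then have "a ^ m / (x j - x i) + b ^ m / (x i - x j) = a ^ m * (a * b) / (b - a) + b ^ m *
            (a * b) / (a - b)"
          by simp
        also have "a ^ m * (a * b) / (b - a) = - (a ^ m * (a * b) / (a - b))"
          using xa(5) by (simp add: field_simps)
        also have "- (a ^ m * (a * b) / (a - b)) + b ^ m * (a * b) / (a - b) =
            - ((a ^ m * (a * b) - b ^ m * (a * b)) / (a - b))"
          by (simp only: diff_divide_distrib)
        also have "a ^ m * (a * b) - b ^ m * (a * b) = a * b * (a ^ m - b ^ m)"
          by (simp add: algebra_simps)
        finally show ?thesis .
      qed
      ultimately show ?thesis using False by (simp add: g_def a_def b_def)
    qed
  qed
  also have "\<dots> = (\<Sum>j\<in>I. real m * inverse (x j) ^ Suc m) -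
       (\<Sum>j\<in>I. \<Sum>i\<in>I. \<Sum>l<m. inverse (x j) ^ Suc l * inverse (x i) ^ (m - l))"
    using fin by (simp add: sum_subtractf)
  also have "(\<Sum>j\<in>I. \<Sum>i\<in>I. \<Sum>l<m. inverse (x j) ^ Suc l * inverse (x i) ^ (m - l)) =
      (\<Sum>l<m. \<Sum>j\<in>I. \<Sum>i\<in>I. inverse (x j) ^ Suc l * inverse (x i) ^ (m - l))"
    by (subst sum.swap[of _ "{..<m}"], subst sum.swap[of _ "{..<m}"]) simp
  finally show ?thesis by (simp only: sum_distrib_left[symmetric] sum_product)
qed

text \<open>The factor \<open>laguerre_weight\<close> is kept on both sides because the algebra
  needs distinct positive coordinates; elsewhere both sides are 0.\<close>

lemma sum_loop_density:
  "laguerre_weight \<beta> \<alpha> N x * (\<Sum>j=1..N. loop_density \<beta> \<alpha> N m ps j x) =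
   laguerre_weight \<beta> \<alpha> N x *
     ((\<alpha> - real m + \<beta> * real m / 2) * inv_prod N (Suc m # ps) x - inv_prod N (m # ps) x
      - \<beta> / 2 * (\<Sum>l<m. inv_prod N (Suc l # (m - l) # ps) x) - loop_drift N m ps x)"
proof (cases "(\<forall>i\<in>{1..N}. x i > 0) \<and> inj_on x {1..N}")
  case False
  then have "laguerre_weight \<beta> \<alpha> N x = 0"
    using laguerre_weight_eq_0[of _ N x] laguerre_weight_coincide[of _ N _ x]
    by (auto simp: inj_on_def not_less)
  then show ?thesis by simp
next
  case True
  let ?F = "inv_prod N ps x"
  let ?D = "\<Sum>j=1..N. \<Sum>i\<in>{1..N}-{j}. inverse (x j) ^ m / (x j - x i)"
  have D: "2 * ?D = real m * inv_pow_sum N (Suc m) x -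
     (\<Sum>l<m. inv_pow_sum N (Suc l) x * inv_pow_sum N (m - l) x)"
    unfolding inv_pow_sum_def by (rule sum_inverse_difference) (use True in force)+
  have "(\<Sum>j=1..N. loop_density \<beta> \<alpha> N m ps j x) =
     (\<Sum>j=1..N. ?F * (\<alpha> - real m) * inverse (x j) ^ Suc m) - (\<Sum>j=1..N. ?F * inverse (x j) ^ m) +
     (\<Sum>j=1..N. ?F * \<beta> * (\<Sum>i\<in>{1..N}-{j}. inverse (x j) ^ m / (x j - x i))) +
     (\<Sum>j=1..N. inverse (x j) ^ m * inv_prod_partial N ps j x)"
    unfolding sum_subtractf[symmetric] sum.distrib[symmetric] loop_density_def
    by (intro sum.cong refl) (simp add: algebra_simps sum_distrib_left
        sum_divide_distrib[symmetric])
  also have "\<dots> = ?F * (\<alpha> - real m) * inv_pow_sum N (Suc m) x - ?F * inv_pow_sum N m x + ?F * \<beta> / 2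
      * (2 * ?D) - loop_drift N m ps x"
    unfolding sum_distrib_left[symmetric] sum_inv_prod_partial inv_pow_sum_def by simp
  also have "\<dots> = (\<alpha> - real m + \<beta> * real m / 2) * inv_prod N (Suc m # ps) x - inv_prod N (m # ps) x
      - \<beta> / 2 * (\<Sum>l<m. inv_prod N (Suc l # (m - l) # ps) x) - loop_drift N m ps x"
    unfolding D by (simp add: algebra_simps sum_distrib_left sum_distrib_right)
  finally show ?thesis by simp
qed

section \<open>The expectation as a linear monotone functional\<close>

definition laguerre_mass :: "real \<Rightarrow> real \<Rightarrow> nat \<Rightarrow> real" where
  "laguerre_mass \<beta> \<alpha> N = (\<integral>x. laguerre_weight \<beta> \<alpha> N x \<partial>(\<Pi>\<^sub>M j\<in>{1..N}. lborel))"

text \<open>A quotient of integrals against Lebesgue measure, the form in which integration by parts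
  delivers its identities. Agreement with the ensemble is
  \<open>integral_laguerre_ensemble\<close>.\<close>

definition laguerre_expect :: "real \<Rightarrow> real \<Rightarrow> nat \<Rightarrow> ((nat \<Rightarrow> real) \<Rightarrow> real) \<Rightarrow> real" where
  "laguerre_expect \<beta> \<alpha> N f =
     (\<integral>x. laguerre_weight \<beta> \<alpha> N x * f x \<partial>(\<Pi>\<^sub>M j\<in>{1..N}. lborel)) / laguerre_mass \<beta> \<alpha> N"

definition laguerre_integrable :: "real \<Rightarrow> real \<Rightarrow> nat \<Rightarrow> ((nat \<Rightarrow> real) \<Rightarrow> real) \<Rightarrow> bool" where
  "laguerre_integrable \<beta> \<alpha> N f \<longleftrightarrow> f \<in> borel_measurable (\<Pi>\<^sub>M j\<in>{1..N}. lborel) \<and>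
     integrable (\<Pi>\<^sub>M j\<in>{1..N}. lborel) (\<lambda>x. laguerre_weight \<beta> \<alpha> N x * f x)"

lemma laguerre_integrableI:
  assumes "f \<in> borel_measurable (\<Pi>\<^sub>M j\<in>{1..N}. lborel)" "wall_bounded N n f" "real n \<le> \<alpha>" "0 \<le> \<beta>"
  shows "laguerre_integrable \<beta> \<alpha> N f"
proof -
  have "exp_dominated N (\<lambda>x. laguerre_weight \<beta> \<alpha> N x * f x)"
    by (rule exp_dominated_weight[OF assms(2-4)])
  moreover have "(\<lambda>x. laguerre_weight \<beta> \<alpha> N x * f x) \<in> borel_measurable (\<Pi>\<^sub>M j\<in>{1..N}. lborel)"
    by (intro borel_measurable_times laguerre_weight_measurable assms(1))
  ultimately show ?thesis
    unfolding laguerre_integrable_def using assms(1) exp_dominated_integrable by blast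
qed

lemma laguerre_integrable_inv_prod:
  "real (sum_list ps) \<le> \<alpha> \<Longrightarrow> 0 \<le> \<beta> \<Longrightarrow> laguerre_integrable \<beta> \<alpha> N (inv_prod N ps)"
  by (rule laguerre_integrableI[OF inv_prod_measurable wall_bounded_inv_prod])

lemma laguerre_integrable_add:
  "laguerre_integrable \<beta> \<alpha> N f \<Longrightarrow> laguerre_integrable \<beta> \<alpha> N g \<Longrightarrow> laguerre_integrable \<beta> \<alpha> N (\<lambda>x. f x
      + g x)"
  unfolding laguerre_integrable_def by (auto simp: distrib_left)

lemma laguerre_integrable_cmult:
  "laguerre_integrable \<beta> \<alpha> N f \<Longrightarrow> laguerre_integrable \<beta> \<alpha> N (\<lambda>x. c * f x)"
  unfolding laguerre_integrable_def by (auto simp: mult.left_commute)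

lemma laguerre_expect_add:
  "laguerre_integrable \<beta> \<alpha> N f \<Longrightarrow> laguerre_integrable \<beta> \<alpha> N g \<Longrightarrow>
   laguerre_expect \<beta> \<alpha> N (\<lambda>x. f x + g x) = laguerre_expect \<beta> \<alpha> N f + laguerre_expect \<beta> \<alpha> N g"
  unfolding laguerre_expect_def laguerre_integrable_def by (simp add: distrib_left
      add_divide_distrib)

lemma laguerre_expect_cmult:
  "laguerre_expect \<beta> \<alpha> N (\<lambda>x. c * f x) = c * laguerre_expect \<beta> \<alpha> N f"
  unfolding laguerre_expect_def by (simp add: mult.left_commute)

lemma laguerre_expect_sum:
  "(\<And>i. i \<in> A \<Longrightarrow> laguerre_integrable \<beta> \<alpha> N (f i)) \<Longrightarrow>
   laguerre_expect \<beta> \<alpha> N (\<lambda>x. \<Sum>i\<in>A. f i x) = (\<Sum>i\<in>A. laguerre_expect \<beta> \<alpha> N (f i))"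
  unfolding laguerre_expect_def laguerre_integrable_def by (simp add: sum_distrib_left
      sum_divide_distrib)

lemma laguerre_integrable_sum:
  "(\<And>i. i \<in> A \<Longrightarrow> laguerre_integrable \<beta> \<alpha> N (f i)) \<Longrightarrow> laguerre_integrable \<beta> \<alpha> N (\<lambda>x. \<Sum>i\<in>A. f i x)"
  unfolding laguerre_integrable_def by (auto simp: sum_distrib_left intro!: borel_measurable_sum)

lemma laguerre_mass_nonneg: "laguerre_mass \<beta> \<alpha> N \<ge> 0"
  unfolding laguerre_mass_def by (intro Bochner_Integration.integral_nonneg laguerre_weight_nonneg)

lemma laguerre_expect_mono:
  assumes "laguerre_integrable \<beta> \<alpha> N f" "laguerre_integrable \<beta> \<alpha> N g"
    and "\<And>x. (\<forall>i\<in>{1..N}. x i > 0) \<Longrightarrow> f x \<le> g x"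
  shows "laguerre_expect \<beta> \<alpha> N f \<le> laguerre_expect \<beta> \<alpha> N g"
proof -
  have "laguerre_weight \<beta> \<alpha> N x * f x \<le> laguerre_weight \<beta> \<alpha> N x * g x" for x
  proof (cases "\<forall>i\<in>{1..N}. x i > 0")
    case True
    then show ?thesis using assms(3) laguerre_weight_nonneg by (intro mult_left_mono) auto
  next
    case False
    then show ?thesis using laguerre_weight_eq_0[of _ N x] by (auto simp: not_less)
  qed
  then show ?thesis
    using assms laguerre_mass_nonneg unfolding laguerre_expect_def laguerre_integrable_def
    by (intro divide_right_mono integral_mono) auto
qed

lemma loop_drift_measurable:
  "loop_drift N m ps \<in> borel_measurable (\<Pi>\<^sub>M j\<in>{1..N}. lborel)"
proof (induction ps)
  case Nil
  have "loop_drift N m [] = (\<lambda>_. 0)" by (rule ext) simp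
  then show ?case by (simp only: borel_measurable_const)
next
  case (Cons p ps)
  have "(\<lambda>x. real p * inv_pow_sum N (Suc (m + p)) x * inv_prod N ps x + inv_pow_sum N p x *
      loop_drift N m ps x)
      \<in> borel_measurable (\<Pi>\<^sub>M j\<in>{1..N}. lborel)"
    by (intro borel_measurable_add borel_measurable_times inv_prod_measurable
        inv_pow_sum_measurable Cons.IH
        borel_measurable_const)
  moreover have "loop_drift N m (p # ps) =
      (\<lambda>x. real p * inv_pow_sum N (Suc (m + p)) x * inv_prod N ps x + inv_pow_sum N p x *
          loop_drift N m ps x)"
    by (rule ext) simp
  ultimately show ?case by (simp only:)
qed

lemma wall_bounded_loop_drift: "wall_bounded N (m + sum_list ps + 1) (loop_drift N m ps)"
proof (induction ps)
  case Nil
  have "loop_drift N m [] = (\<lambda>_. 0)" by (rule ext) simp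
  then show ?case using wall_bounded_mono[OF wall_bounded_const] by simp
next
  case (Cons p ps)
  let ?f = "\<lambda>x. real p * inv_pow_sum N (Suc (m + p)) x * inv_prod N ps x"
  let ?g = "\<lambda>x. inv_pow_sum N p x * loop_drift N m ps x"
  have "wall_bounded N (0 + Suc (m + p) + sum_list ps) ?f"
    by (intro wall_bounded_mult wall_bounded_const wall_bounded_inv_pow_sum wall_bounded_inv_prod)
  then have "wall_bounded N (m + sum_list (p # ps) + 1) ?f"
    by (rule wall_bounded_mono) simp
  moreover have "wall_bounded N (p + (m + sum_list ps + 1)) ?g"
    by (intro wall_bounded_mult wall_bounded_inv_pow_sum Cons.IH)
  then have "wall_bounded N (m + sum_list (p # ps) + 1) ?g"
    by (rule wall_bounded_mono) simp
  ultimately have "wall_bounded N (m + sum_list (p # ps) + 1) (\<lambda>x. ?f x + ?g x)"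
    by (rule wall_bounded_add)
  moreover have "loop_drift N m (p # ps) = (\<lambda>x. ?f x + ?g x)"
    by (rule ext) simp
  ultimately show ?case by (simp only:)
qed

lemma laguerre_integrable_loop_drift:
  "real (m + sum_list ps + 1) \<le> \<alpha> \<Longrightarrow> 0 \<le> \<beta> \<Longrightarrow> laguerre_integrable \<beta> \<alpha> N (loop_drift N m ps)"
  by (rule laguerre_integrableI[OF loop_drift_measurable wall_bounded_loop_drift])

text \<open>The vanishing integrals are added over j. In the coefficient on the left, \<alpha> - m
  comes from the wall and \<beta> m / 2 from the diagonal of the symmetrised interaction.\<close>

theorem laguerre_loop_equation:
  assumes \<beta>: "1 \<le> \<beta>" and \<alpha>: "real (m + sum_list ps + 1) \<le> \<alpha>"
  shows "(\<alpha> - real m + \<beta> * real m / 2) * laguerre_expect \<beta> \<alpha> N (inv_prod N (Suc m # ps)) =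
    laguerre_expect \<beta> \<alpha> N (inv_prod N (m # ps)) +
    \<beta> / 2 * (\<Sum>l<m. laguerre_expect \<beta> \<alpha> N (inv_prod N (Suc l # (m - l) # ps))) +
    laguerre_expect \<beta> \<alpha> N (loop_drift N m ps)"
proof -
  let ?E = "laguerre_expect \<beta> \<alpha> N" and ?M = "\<Pi>\<^sub>M j\<in>{1..N}. (lborel :: real measure)"
  let ?W = "laguerre_weight \<beta> \<alpha> N"
  let ?c = "\<alpha> - real m + \<beta> * real m / 2"
  let ?R = "\<lambda>x. ?c * inv_prod N (Suc m # ps) x + ((- 1) * inv_prod N (m # ps) x +
      ((- \<beta> / 2) * (\<Sum>l<m. inv_prod N (Suc l # (m - l) # ps) x) + (- 1) * loop_drift N m ps x))"
  have int: "integrable ?M (\<lambda>x. ?W x * loop_density \<beta> \<alpha> N m ps j x)" if "j \<in> {1..N}" for j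
    using that assms by (intro exp_dominated_integrable loop_density_measurable
        loop_density_dominated)
  have "(\<integral>x. ?W x * ?R x \<partial>?M) = (\<integral>x. (\<Sum>j=1..N. ?W x * loop_density \<beta> \<alpha> N m ps j x) \<partial>?M)"
    by (intro Bochner_Integration.integral_cong refl)
       (simp only: sum_distrib_left[symmetric] sum_loop_density, simp add: algebra_simps)
  also have "\<dots> = (\<Sum>j=1..N. \<integral>x. ?W x * loop_density \<beta> \<alpha> N m ps j x \<partial>?M)"
    using int by (intro Bochner_Integration.integral_sum) auto
  also have "\<dots> = 0"
    using assms by (intro sum.neutral ballI loop_density_integral_zero)
  finally have "?E ?R = 0" by (simp add: laguerre_expect_def)
  moreover have i1: "laguerre_integrable \<beta> \<alpha> N (inv_prod N (Suc m # ps))"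
      "laguerre_integrable \<beta> \<alpha> N (inv_prod N (m # ps))"
    using assms by (auto intro!: laguerre_integrable_inv_prod)
  have i2: "laguerre_integrable \<beta> \<alpha> N (inv_prod N (Suc l # (m - l) # ps))" if "l \<in> {..<m}" for l
    using assms that by (intro laguerre_integrable_inv_prod) auto
  have i3: "laguerre_integrable \<beta> \<alpha> N (loop_drift N m ps)"
    using assms by (intro laguerre_integrable_loop_drift) auto
  have "?E ?R = ?c * ?E (inv_prod N (Suc m # ps)) + ((- 1) * ?E (inv_prod N (m # ps)) +
      ((- \<beta> / 2) * (\<Sum>l<m. ?E (inv_prod N (Suc l # (m - l) # ps))) + (- 1) * ?E (loop_drift N m
          ps)))"
    by (simp only: laguerre_expect_add laguerre_expect_cmult laguerre_expect_sum
        laguerre_integrable_add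
        laguerre_integrable_cmult laguerre_integrable_sum i1 i2 i3)
  ultimately show ?thesis by simp
qed

section \<open>The partition function and the scaled expectations\<close>

lemma laguerre_integrable_1: "0 \<le> \<alpha> \<Longrightarrow> 0 \<le> \<beta> \<Longrightarrow> laguerre_integrable \<beta> \<alpha> N (\<lambda>_. 1)"
  by (rule laguerre_integrableI[OF _ wall_bounded_const]) auto

lemma laguerre_mass_pos:
  assumes "0 \<le> \<alpha>" "0 \<le> \<beta>"
  shows "laguerre_mass \<beta> \<alpha> N > 0"
proof (rule ccontr)
  let ?M = "\<Pi>\<^sub>M j\<in>{1..N}. (lborel :: real measure)" and ?W = "laguerre_weight \<beta> \<alpha> N"
  \<comment> \<open>A box of positive volume whose i-th side lies in (i, i + 1/2): all coordinates
    are positive and distinct there, so the weight does not vanish.\<close>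
  define B where "B = (\<Pi>\<^sub>E i\<in>{1..N}. {real i<..<real i + 1 / 2})"
  assume "\<not> laguerre_mass \<beta> \<alpha> N > 0"
  then have "(\<integral>x. ?W x \<partial>?M) = 0" using laguerre_mass_nonneg[of \<beta> \<alpha> N] by (simp add:
      laguerre_mass_def)
  moreover have "integrable ?M ?W" using laguerre_integrable_1[OF assms, of N] by (simp add:
      laguerre_integrable_def)
  ultimately have "AE x in ?M. ?W x = 0"
    using integral_nonneg_eq_0_iff_AE[of ?M ?W] by (simp add: laguerre_weight_nonneg)
  moreover have "?W x \<noteq> 0" if "x \<in> B" for x
  proof -
    have x: "real i < x i" "x i < real i + 1 / 2" if "i \<in> {1..N}" for i
      using that \<open>x \<in> B\<close> by (auto simp: B_def PiE_iff)
    have "indicator {0<..} (x i) * (x i powr \<alpha> * exp (- x i)) > 0" if "i \<in> {1..N}" for i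
      using x[OF that] by simp
    then have "(\<Prod>j=1..N. indicator {0<..} (x j) * (x j powr \<alpha> * exp (- x j))) > 0"
      by (intro prod_pos) auto
    moreover have "vandermonde_on \<beta> {1..N} x > 0"
      unfolding vandermonde_on_def
    proof (intro prod_pos ballI)
      fix j i assume "j \<in> {1..N}" "i \<in> {i \<in> {1..N}. i < j}"
      then have "x i < real i + 1 / 2" "real i + 1 \<le> real j" "real j < x j"
        using x[of i] x[of j] by auto
      then show "0 < \<bar>x j - x i\<bar> powr \<beta>" by simp
    qed
    ultimately show ?thesis unfolding laguerre_weight_alt by (metis mult_pos_pos less_irrefl)
  qed
  ultimately have "AE x in ?M. x \<notin> B" by (auto elim: eventually_mono)
  moreover have "B \<in> sets ?M" unfolding B_def by (rule sets_PiM_I_finite) auto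
  ultimately have "emeasure ?M B = 0" by (subst (asm) AE_iff_null) (auto simp: null_sets_def
      Int_absorb1 sets.sets_into_space Collect_conj_eq Int_def[symmetric] elim: back_subst[of "\<lambda>A.
          emeasure _ A = 0"])
  moreover have "emeasure ?M B = (\<Prod>i\<in>{1..N}. emeasure lborel {real i<..<real i + 1 / 2})"
    unfolding B_def by (rule lborel_prod.emeasure_PiM) auto
  ultimately show False by (simp add: prod_zero_iff)
qed

lemma laguerre_ensemble_eq:
  assumes "0 \<le> \<alpha>" "0 \<le> \<beta>"
  shows "laguerre_ensemble \<beta> \<alpha> N =
    density (\<Pi>\<^sub>M j\<in>{1..N}. lborel) (\<lambda>x. ennreal (laguerre_weight \<beta> \<alpha> N x / laguerre_mass \<beta> \<alpha> N))"
proof -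
  have "laguerre_partition \<beta> \<alpha> N = ennreal (laguerre_mass \<beta> \<alpha> N)"
    unfolding laguerre_partition_def laguerre_mass_def
    using laguerre_integrable_1[OF assms, of N]
    by (intro nn_integral_eq_integral) (simp_all add: laguerre_integrable_def
        laguerre_weight_nonneg)
  then show ?thesis
    unfolding laguerre_ensemble_def using laguerre_mass_pos[OF assms, of N]
    by (simp add: divide_ennreal laguerre_weight_nonneg)
qed

lemma integral_laguerre_ensemble:
  assumes "0 \<le> \<alpha>" "0 \<le> \<beta>" "f \<in> borel_measurable (\<Pi>\<^sub>M j\<in>{1..N}. lborel)"
  shows "(\<integral>x. f x \<partial>laguerre_ensemble \<beta> \<alpha> N) = laguerre_expect \<beta> \<alpha> N f"
proof -
  have "(\<integral>x. f x \<partial>laguerre_ensemble \<beta> \<alpha> N) =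
     (\<integral>x. (laguerre_weight \<beta> \<alpha> N x / laguerre_mass \<beta> \<alpha> N) *\<^sub>R f x \<partial>(\<Pi>\<^sub>M j\<in>{1..N}. lborel))"
    unfolding laguerre_ensemble_eq[OF assms(1,2)]
    by (intro integral_density assms(3) borel_measurable_divide laguerre_weight_measurable
        borel_measurable_const)
       (auto intro!: divide_nonneg_nonneg laguerre_weight_nonneg laguerre_mass_nonneg)
  then show ?thesis unfolding laguerre_expect_def by simp
qed

lemma laguerre_moment_eq:
  assumes "0 \<le> \<alpha>" "0 \<le> \<beta>"
  shows "laguerre_moment \<beta> N (- int k) \<alpha> = laguerre_expect \<beta> \<alpha> N (inv_prod N [k])"
proof -
  have "(\<lambda>x. \<Sum>j=1..N. x j powi (- int k)) = inv_prod N [k]"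
    by (rule ext) (simp add: inv_pow_sum_def power_int_minus power_inverse)
  then show ?thesis
    unfolding laguerre_moment_def using integral_laguerre_ensemble[OF assms inv_prod_measurable]
        by simp
qed

lemma laguerre_expect_1:
  assumes "0 \<le> \<alpha>" "0 \<le> \<beta>"
  shows "laguerre_expect \<beta> \<alpha> N (\<lambda>_. 1) = 1"
  using laguerre_mass_pos[OF assms, of N] by (simp add: laguerre_expect_def laguerre_mass_def)

section \<open>Bounds by powers of the first inverse power sum\<close>

lemma inv_prod_Nil_eq: "inv_prod N [] = (\<lambda>_. 1)"
  by (rule ext) simp

lemma inv_pow_sum_nonneg: "(\<And>i. i \<in> {1..N} \<Longrightarrow> x i > 0) \<Longrightarrow> inv_pow_sum N p x \<ge> 0"
  unfolding inv_pow_sum_def by (intro sum_nonneg zero_le_power) (auto simp: less_imp_le)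

text \<open>All terms are positive, so each one is at most the whole sum; p - 1 factors of every
  term are estimated in this way.\<close>

lemma inv_pow_sum_le:
  assumes "\<And>i. i \<in> {1..N} \<Longrightarrow> x i > 0" "p \<ge> 1"
  shows "inv_pow_sum N p x \<le> inv_pow_sum N 1 x ^ p"
proof -
  let ?S = "inv_pow_sum N 1 x"
  have S: "inverse (x j) \<le> ?S" if "j \<in> {1..N}" for j
    unfolding inv_pow_sum_def using assms(1) that
    by (simp, intro member_le_sum) (auto simp: less_imp_le)
  have "inv_pow_sum N p x = (\<Sum>j=1..N. inverse (x j) * inverse (x j) ^ (p - 1))"
    unfolding inv_pow_sum_def using assms(2) by (intro sum.cong refl) (simp add: power_eq_if)
  also have "\<dots> \<le> (\<Sum>j=1..N. inverse (x j) * ?S ^ (p - 1))"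
    using assms(1) S by (intro sum_mono mult_left_mono power_mono) (auto simp: less_imp_le)
  also have "\<dots> = ?S * ?S ^ (p - 1)"
    by (simp add: inv_pow_sum_def sum_distrib_right)
  also have "\<dots> = ?S ^ p" using assms(2) by (simp add: power_eq_if)
  finally show ?thesis .
qed

lemma inv_prod_nonneg: "(\<And>i. i \<in> {1..N} \<Longrightarrow> x i > 0) \<Longrightarrow> inv_prod N ps x \<ge> 0"
  by (induction ps) (auto intro!: mult_nonneg_nonneg inv_pow_sum_nonneg)

lemma inv_prod_replicate_1: "inv_prod N (replicate n 1) x = inv_pow_sum N 1 x ^ n"
  by (induction n) auto

text \<open>Reduces the boundedness of all products to that of the moments of S_1, with the same
  degree and hence the same scaling. A part 0 has to be excluded because S_0 = N is not bounded by
  S_1^0 = 1.\<close>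

lemma inv_prod_le:
  assumes x: "\<And>i. i \<in> {1..N} \<Longrightarrow> x i > 0" and "0 \<notin> set ps"
  shows "inv_prod N ps x \<le> inv_prod N (replicate (sum_list ps) 1) x"
  using assms(2) unfolding inv_prod_replicate_1
proof (induction ps)
  case (Cons p ps)
  then have "inv_pow_sum N p x * inv_prod N ps x \<le> inv_pow_sum N 1 x ^ p * inv_pow_sum N 1 x ^
      sum_list ps"
    using x by (intro mult_mono inv_pow_sum_le inv_prod_nonneg zero_le_power inv_pow_sum_nonneg)
        auto
  then show ?case by (simp add: power_add)
qed simp

lemma loop_drift_nonneg: "(\<And>i. i \<in> {1..N} \<Longrightarrow> x i > 0) \<Longrightarrow> loop_drift N m ps x \<ge> 0"
  by (induction ps) (auto intro!: mult_nonneg_nonneg add_nonneg_nonneg inv_pow_sum_nonneg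
      inv_prod_nonneg)

text \<open>Each of the summands has total degree m + 1 + \<open>sum_list ps\<close>, and their
  coefficients are the parts, which add up to \<open>sum_list ps\<close>.\<close>

lemma loop_drift_le:
  assumes x: "\<And>i. i \<in> {1..N} \<Longrightarrow> x i > 0" and "0 \<notin> set ps"
  shows "loop_drift N m ps x \<le> real (sum_list ps) * inv_prod N (replicate (m + 1 + sum_list ps) 1)
      x"
  using assms(2) unfolding inv_prod_replicate_1
proof (induction ps)
  case (Cons p ps)
  let ?S = "inv_pow_sum N 1 x"
  have S: "?S \<ge> 0" using x by (rule inv_pow_sum_nonneg)
  have "inv_pow_sum N (Suc (m + p)) x * inv_prod N ps x \<le> ?S ^ (Suc (m + p)) * ?S ^ sum_list ps"
    using Cons.prems inv_prod_le[OF x, where ps = ps] x S unfolding inv_prod_replicate_1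
    by (intro mult_mono inv_pow_sum_le inv_prod_nonneg zero_le_power) auto
  also have "\<dots> = ?S ^ (m + 1 + sum_list (p # ps))" by (simp add: power_add)
  finally have "real p * (inv_pow_sum N (Suc (m + p)) x * inv_prod N ps x) \<le> real p * ?S ^ (m + 1
      + sum_list (p # ps))"
    by (intro mult_left_mono) auto
  moreover have "inv_pow_sum N p x * loop_drift N m ps x \<le> ?S ^ p * (real (sum_list ps) * ?S ^ (m
      + 1 + sum_list ps))"
    using Cons x S by (intro mult_mono inv_pow_sum_le loop_drift_nonneg zero_le_power) auto
  moreover have "?S ^ p * (real (sum_list ps) * ?S ^ (m + 1 + sum_list ps)) = real (sum_list ps) *
      ?S ^ (m + 1 + sum_list (p # ps))"
    by (simp add: power_add mult_ac)
  ultimately have "real p * (inv_pow_sum N (Suc (m + p)) x * inv_prod N ps x) + inv_pow_sum N p x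
      * loop_drift N m ps x \<le>
      real p * ?S ^ (m + 1 + sum_list (p # ps)) + real (sum_list ps) * ?S ^ (m + 1 + sum_list (p #
          ps))"
    by linarith
  then show ?case by (simp add: distrib_right mult.assoc)
qed simp

definition scaled_expect :: "real \<Rightarrow> real \<Rightarrow> nat \<Rightarrow> nat list \<Rightarrow> real" where
  "scaled_expect \<nu> \<beta> N ps =
     (\<beta> / (8 * real N)) ^ sum_list ps * laguerre_expect \<beta> (\<beta> / 2 * (\<nu> + 1)) N (inv_prod N ps)"

definition scaled_drift :: "real \<Rightarrow> real \<Rightarrow> nat \<Rightarrow> nat \<Rightarrow> nat list \<Rightarrow> real" where
  "scaled_drift \<nu> \<beta> N m ps =
     (\<beta> / (8 * real N)) ^ (m + 1 + sum_list ps) * laguerre_expect \<beta> (\<beta> / 2 * (\<nu> + 1)) N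
         (loop_drift N m ps)"

text \<open>The loop equation times 2 / \<beta> and the scaling factor of its degree. The last line
  collects the corrections of order 1 / \<beta>: the drift and the m from differentiating x_j^(-m).
  The term with 1 / (4 N) is small for m >= 1, but for m = 0 the factor S_0 = N makes it of order
  1.\<close>

lemma scaled_loop_equation:
  assumes N: "N \<ge> 1" and \<beta>: "\<beta> \<ge> 1" and \<alpha>: "real (m + sum_list ps + 1) \<le> \<beta> / 2 * (\<nu> + 1)"
  shows "(\<nu> + 1 + real m) * scaled_expect \<nu> \<beta> N (Suc m # ps) =
    1 / (4 * real N) * scaled_expect \<nu> \<beta> N (m # ps) +
    (\<Sum>l<m. scaled_expect \<nu> \<beta> N (Suc l # (m - l) # ps)) +
    2 / \<beta> * (scaled_drift \<nu> \<beta> N m ps + real m * scaled_expect \<nu> \<beta> N (Suc m # ps))"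
proof -
  let ?r = "\<beta> / (8 * real N)" and ?n = "m + 1 + sum_list ps"
  let ?E = "laguerre_expect \<beta> (\<beta> / 2 * (\<nu> + 1)) N"
  have eq: "(\<beta> / 2 * (\<nu> + 1) - real m + \<beta> * real m / 2) = \<beta> / 2 * (\<nu> + 1 + real m - 2 / \<beta> * real m)"
    using \<beta> by (simp add: field_simps)
  have *: "\<beta> / 2 * (\<nu> + 1 + real m - 2 / \<beta> * real m) * ?E (inv_prod N (Suc m # ps)) =
    ?E (inv_prod N (m # ps)) + \<beta> / 2 * (\<Sum>l<m. ?E (inv_prod N (Suc l # (m - l) # ps))) + ?E
        (loop_drift N m ps)"
    using laguerre_loop_equation[OF \<beta> \<alpha>, of N] unfolding eq .
  have "(\<nu> + 1 + real m - 2 / \<beta> * real m) * scaled_expect \<nu> \<beta> N (Suc m # ps) =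
     ?r ^ ?n * (2 / \<beta>) * (\<beta> / 2 * (\<nu> + 1 + real m - 2 / \<beta> * real m) * ?E (inv_prod N (Suc m # ps)))"
    using \<beta> by (simp add: scaled_expect_def)
  also have "\<dots> = (2 / \<beta> * ?r) * (?r ^ (m + sum_list ps) * ?E (inv_prod N (m # ps))) +
     (\<Sum>l<m. ?r ^ ?n * ?E (inv_prod N (Suc l # (m - l) # ps))) +
     2 / \<beta> * (?r ^ ?n * ?E (loop_drift N m ps))"
    unfolding * using \<beta> by (simp add: distrib_left sum_distrib_left mult_ac)
  also have "2 / \<beta> * ?r = 1 / (4 * real N)" using \<beta> by simp
  also have "?r ^ (m + sum_list ps) * ?E (inv_prod N (m # ps)) = scaled_expect \<nu> \<beta> N (m # ps)"
    by (simp add: scaled_expect_def)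
  also have "(\<Sum>l<m. ?r ^ ?n * ?E (inv_prod N (Suc l # (m - l) # ps))) =
      (\<Sum>l<m. scaled_expect \<nu> \<beta> N (Suc l # (m - l) # ps))"
    by (intro sum.cong refl) (simp add: scaled_expect_def)
  finally show ?thesis by (simp add: scaled_drift_def algebra_simps)
qed

lemma scaled_expect_bounds:
  assumes "\<beta> \<ge> 0" "real (sum_list ps) \<le> \<beta> / 2 * (\<nu> + 1)" "0 \<notin> set ps"
  shows "0 \<le> scaled_expect \<nu> \<beta> N ps"
    and "scaled_expect \<nu> \<beta> N ps \<le> scaled_expect \<nu> \<beta> N (replicate (sum_list ps) 1)"
proof -
  let ?E = "laguerre_expect \<beta> (\<beta> / 2 * (\<nu> + 1)) N"
  have i: "laguerre_integrable \<beta> (\<beta> / 2 * (\<nu> + 1)) N (inv_prod N ps)"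
    "laguerre_integrable \<beta> (\<beta> / 2 * (\<nu> + 1)) N (inv_prod N (replicate (sum_list ps) 1))"
    using assms by (auto intro!: laguerre_integrable_inv_prod simp: sum_list_replicate)
  have "?E (\<lambda>x. 0 * inv_prod N ps x) \<le> ?E (inv_prod N ps)"
    by (rule laguerre_expect_mono[OF laguerre_integrable_cmult]) (use i in \<open>auto intro!:
        inv_prod_nonneg\<close>)
  then show "0 \<le> scaled_expect \<nu> \<beta> N ps"
    unfolding scaled_expect_def laguerre_expect_cmult using assms(1) by simp
  have "?E (inv_prod N ps) \<le> ?E (inv_prod N (replicate (sum_list ps) 1))"
    by (rule laguerre_expect_mono[OF i]) (use assms(3) in \<open>auto intro!: inv_prod_le[unfolded
        One_nat_def]\<close>)
  then show "scaled_expect \<nu> \<beta> N ps \<le> scaled_expect \<nu> \<beta> N (replicate (sum_list ps) 1)"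
    unfolding scaled_expect_def using assms(1) by (simp add: sum_list_replicate mult_left_mono)
qed

lemma scaled_drift_bounds:
  assumes "\<beta> \<ge> 0" "real (m + 1 + sum_list ps) \<le> \<beta> / 2 * (\<nu> + 1)" "0 \<notin> set ps"
  shows "0 \<le> scaled_drift \<nu> \<beta> N m ps"
    and "scaled_drift \<nu> \<beta> N m ps \<le> real (sum_list ps) * scaled_expect \<nu> \<beta> N (replicate (m + 1 +
        sum_list ps) 1)"
proof -
  let ?E = "laguerre_expect \<beta> (\<beta> / 2 * (\<nu> + 1)) N" and ?n = "m + 1 + sum_list ps"
  have i: "laguerre_integrable \<beta> (\<beta> / 2 * (\<nu> + 1)) N (loop_drift N m ps)"
    "laguerre_integrable \<beta> (\<beta> / 2 * (\<nu> + 1)) N (\<lambda>x. real (sum_list ps) * inv_prod N (replicate ?n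
        1) x)"
    using assms by (auto intro!: laguerre_integrable_loop_drift laguerre_integrable_cmult
        laguerre_integrable_inv_prod
        simp: sum_list_replicate simp del: replicate_Suc)
  have "?E (\<lambda>x. 0 * loop_drift N m ps x) \<le> ?E (loop_drift N m ps)"
    by (rule laguerre_expect_mono[OF laguerre_integrable_cmult]) (use i in \<open>auto intro!:
        loop_drift_nonneg\<close>)
  then show "0 \<le> scaled_drift \<nu> \<beta> N m ps"
    unfolding scaled_drift_def laguerre_expect_cmult using assms(1) by simp
  have "?E (loop_drift N m ps) \<le> ?E (\<lambda>x. real (sum_list ps) * inv_prod N (replicate ?n 1) x)"
    by (rule laguerre_expect_mono[OF i]) (use assms(3) in \<open>blast intro: loop_drift_le\<close>)
  then have "?E (loop_drift N m ps) \<le> real (sum_list ps) * ?E (inv_prod N (replicate ?n 1))"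
    unfolding laguerre_expect_cmult .
  moreover have "0 \<le> (\<beta> / (8 * real N)) ^ ?n"
    using assms(1) by (intro zero_le_power divide_nonneg_nonneg) auto
  ultimately have "(\<beta> / (8 * real N)) ^ ?n * ?E (loop_drift N m ps) \<le>
      (\<beta> / (8 * real N)) ^ ?n * (real (sum_list ps) * ?E (inv_prod N (replicate ?n 1)))"
    by (rule mult_left_mono)
  then show "scaled_drift \<nu> \<beta> N m ps \<le> real (sum_list ps) * scaled_expect \<nu> \<beta> N (replicate ?n 1)"
    unfolding scaled_drift_def scaled_expect_def by (simp add: sum_list_replicate mult_ac del:
        replicate_Suc)
qed

section \<open>Convergence to the Rayleigh sums\<close>

fun rayleigh :: "real \<Rightarrow> nat \<Rightarrow> real" where
  "rayleigh \<nu> 0 = 0"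
| "rayleigh \<nu> (Suc m) =
     (if m = 0 then 1 / (4 * (\<nu> + 1))
      else (\<Sum>l\<in>{..<m}. rayleigh \<nu> (Suc l) * rayleigh \<nu> (m - l)) / (\<nu> + 1 + real m))"

declare rayleigh.simps(2) [simp del]

lemma rayleigh_rec:
  assumes "\<nu> > -1"
  shows "(\<nu> + 1 + real m) * rayleigh \<nu> (Suc m) =
    (if m = 0 then 1 / 4 else 0) + (\<Sum>l<m. rayleigh \<nu> (Suc l) * rayleigh \<nu> (m - l))"
proof -
  have "\<nu> + 1 + real m \<noteq> 0" using assms by linarith
  then show ?thesis using assms by (simp add: rayleigh.simps)
qed

lemma null_mult_bounded:
  fixes f g :: "nat \<Rightarrow> real"
  assumes "f \<longlonglongrightarrow> 0" "\<forall>\<^sub>F n in sequentially. \<bar>g n\<bar> \<le> C"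
  shows "(\<lambda>n. f n * g n) \<longlonglongrightarrow> 0"
proof (rule Lim_null_comparison)
  show "\<forall>\<^sub>F n in sequentially. norm (f n * g n) \<le> \<bar>f n\<bar> * C"
    using assms(2) by eventually_elim (simp add: abs_mult mult_left_mono)
  show "(\<lambda>n. \<bar>f n\<bar> * C) \<longlonglongrightarrow> 0"
    using tendsto_mult_left_zero[OF tendsto_rabs_zero[OF assms(1)]] .
qed

text \<open>Instantiated twice: with the given sequence for the limit of the moments, and with
  \<beta> N = N to produce configurations for the Bessel zeros.\<close>

locale growing_beta =
  fixes \<nu> :: real and \<beta> :: "nat \<Rightarrow> real"
  assumes nu: "\<nu> > -1" and beta: "filterlim \<beta> at_top sequentially"
begin

abbreviation X :: "nat list \<Rightarrow> nat \<Rightarrow> real" where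
  "X ps N \<equiv> scaled_expect \<nu> (\<beta> N) N ps"

text \<open>The exponent \<alpha> = \<beta> (\<nu> + 1) / 2 tends to infinity with \<beta>, so for
  large N the inverse moments of any fixed degree n exist.\<close>

lemma eventually_large:
  "\<forall>\<^sub>F N in sequentially. N \<ge> 1 \<and> \<beta> N \<ge> 1 \<and> real n \<le> \<beta> N / 2 * (\<nu> + 1)"
proof -
  have "\<forall>\<^sub>F N in sequentially. \<beta> N \<ge> max 1 (2 * real n / (\<nu> + 1))"
    using beta unfolding filterlim_at_top by blast
  then show ?thesis
    using eventually_ge_at_top[of 1]
    by eventually_elim (use nu in \<open>simp add: field_simps\<close>)
qed

lemma two_over_beta: "(\<lambda>N. 2 / \<beta> N) \<longlonglongrightarrow> 0"
  by (intro tendsto_divide_0[OF tendsto_const] filterlim_at_top_imp_at_infinity beta)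

lemma X_Nil: "\<forall>\<^sub>F N in sequentially. X [] N = 1"
  using eventually_large[of 0]
  by eventually_elim (simp add: scaled_expect_def inv_prod_Nil_eq laguerre_expect_1)

text \<open>In the equation with m = 0 the drift has the degree of the left-hand side, but carries 2
  / \<beta>. For large \<beta> it is absorbed there, and the n-th moment controls the next
  one.\<close>

lemma X_replicate_bounded: "\<exists>C\<ge>0. \<forall>\<^sub>F N in sequentially. X (replicate n 1) N \<le> C"
proof (induction n)
  case 0
  have "\<forall>\<^sub>F N in sequentially. X (replicate 0 1) N \<le> 1"
    using X_Nil by eventually_elim simp
  then show ?case by (intro exI[of _ 1]) auto
next
  case (Suc n)
  then obtain C where C: "C \<ge> 0" "\<forall>\<^sub>F N in sequentially. X (replicate n 1) N \<le> C" by blast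
  have "(\<lambda>N. 2 / \<beta> N * real n) \<longlonglongrightarrow> 0"
    using tendsto_mult_left_zero[OF two_over_beta] .
  then have "\<forall>\<^sub>F N in sequentially. 2 / \<beta> N * real n < (\<nu> + 1) / 2"
    using nu by (intro order_tendstoD) auto
  \<comment> \<open>At most half of the coefficient \<nu> + 1 is spent on the drift, so the other
    half times the moment is at most C / 4.\<close>
  then have "\<forall>\<^sub>F N in sequentially. X (replicate (Suc n) 1) N \<le> C / (2 * (\<nu> + 1))"
    using eventually_large[of "Suc n"] C(2)
  proof eventually_elim
    case (elim N)
    let ?Y = "X (replicate (Suc n) 1) N"
    have Y0: "0 \<le> ?Y" by (rule scaled_expect_bounds) (use elim in \<open>auto simp: sum_list_replicate\<close>)
    have "X (0 # replicate n 1) N = real N * X (replicate n 1) N"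
    proof -
      have "inv_prod N (0 # replicate n 1) = (\<lambda>x. real N * inv_prod N (replicate n 1) x)"
        by (rule ext) (simp add: inv_pow_sum_def)
      then show ?thesis by (simp add: scaled_expect_def laguerre_expect_cmult)
    qed
    then have "(\<nu> + 1) * ?Y = 1 / 4 * X (replicate n 1) N + 2 / \<beta> N * scaled_drift \<nu> (\<beta> N) N 0
        (replicate n 1)"
      using scaled_loop_equation[of N "\<beta> N" 0 "replicate n 1" \<nu>] elim by (simp add:
          sum_list_replicate)
    also have "\<dots> \<le> 1 / 4 * C + 2 / \<beta> N * (real n * ?Y)"
    proof (intro add_mono mult_left_mono)
      show "scaled_drift \<nu> (\<beta> N) N 0 (replicate n 1) \<le> real n * ?Y"
        using scaled_drift_bounds(2)[of "\<beta> N" 0 "replicate n 1" \<nu> N] elim by (simp add: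
            sum_list_replicate)
    qed (use elim in auto)
    also have "2 / \<beta> N * (real n * ?Y) \<le> (\<nu> + 1) / 2 * ?Y"
      using mult_right_mono[OF less_imp_le[OF elim(1)] Y0] by (simp add: mult.assoc)
    finally have "(\<nu> + 1) / 2 * ?Y \<le> C / 4" by (simp add: field_simps)
    then show ?case using nu by (simp add: field_simps)
  qed
  moreover have "C / (2 * (\<nu> + 1)) \<ge> 0" using C nu by simp
  ultimately show ?case by blast
qed

lemma X_bounded:
  assumes "0 \<notin> set ps"
  shows "\<exists>C\<ge>0. \<forall>\<^sub>F N in sequentially. \<bar>X ps N\<bar> \<le> C"
proof -
  obtain C where C: "C \<ge> 0" "\<forall>\<^sub>F N in sequentially. X (replicate (sum_list ps) 1) N \<le> C"
    using X_replicate_bounded by blast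
  have "\<forall>\<^sub>F N in sequentially. \<bar>X ps N\<bar> \<le> C"
    using eventually_large[of "sum_list ps"] C(2)
  proof eventually_elim
    case (elim N)
    then show ?case using scaled_expect_bounds[of "\<beta> N" ps \<nu> N] assms by auto
  qed
  then show ?thesis using C(1) by blast
qed

lemma drift_bounded:
  assumes "0 \<notin> set ps"
  shows "\<exists>C\<ge>0. \<forall>\<^sub>F N in sequentially. \<bar>scaled_drift \<nu> (\<beta> N) N m ps\<bar> \<le> C"
proof -
  obtain C where C: "C \<ge> 0" "\<forall>\<^sub>F N in sequentially. X (replicate (m + 1 + sum_list ps) 1) N \<le> C"
    using X_replicate_bounded by blast
  have "\<forall>\<^sub>F N in sequentially. \<bar>scaled_drift \<nu> (\<beta> N) N m ps\<bar> \<le> real (sum_list ps) * C"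
    using eventually_large[of "m + 1 + sum_list ps"] C(2)
  proof eventually_elim
    case (elim N)
    then have b: "0 \<le> \<beta> N" "real (m + 1 + sum_list ps) \<le> \<beta> N / 2 * (\<nu> + 1)" by auto
    show ?case
      using scaled_drift_bounds[OF b assms, of N] mult_left_mono[OF elim(2), of "real (sum_list
          ps)"]
      by simp
  qed
  then show ?thesis using C(1) by (intro exI[of _ "real (sum_list ps) * C"]) auto
qed

text \<open>Arbitrary remaining factors ps are essential to the induction: in a product of S_(l+1),
  S_(m-l) and F the first factor is split off while the second one belongs to the remainder.\<close>

lemma X_factorization:
  "0 \<notin> set ps \<Longrightarrow> (\<lambda>N. X (Suc m # ps) N - rayleigh \<nu> (Suc m) * X ps N) \<longlonglongrightarrow> 0"
proof (induction m arbitrary: ps rule: less_induct)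
  case (less m)
  let ?c = "\<nu> + 1 + real m"
  let ?\<sigma> = "rayleigh \<nu>"
  have c: "?c > 0" using nu by linarith
  \<comment> \<open>For m = 0 this term is no error: S_0 = N turns it into 1 / 4 times
    \<open>X ps N\<close>, the inhomogeneity of the recurrence.\<close>
  let ?A = "\<lambda>N. if m = 0 then 0 else 1 / (4 * real N) * X (m # ps) N"
  let ?B = "\<lambda>N. \<Sum>l<m. X (Suc l # (m - l) # ps) N - ?\<sigma> (Suc l) * ?\<sigma> (m - l) * X ps N"
  let ?D = "\<lambda>N. 2 / \<beta> N * (scaled_drift \<nu> (\<beta> N) N m ps + real m * X (Suc m # ps) N)"
  have A: "?A \<longlonglongrightarrow> 0"
  proof (cases "m = 0")
    case False
    then obtain C where "\<forall>\<^sub>F N in sequentially. \<bar>X (m # ps) N\<bar> \<le> C"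
      using X_bounded[of "m # ps"] less.prems by auto
    moreover have "(\<lambda>N. 1 / (4 * real N)) \<longlonglongrightarrow> 0" by real_asymp
    ultimately have "(\<lambda>N. 1 / (4 * real N) * X (m # ps) N) \<longlonglongrightarrow> 0" by (intro null_mult_bounded)
    then show ?thesis using False by simp
  qed simp
  have B: "?B \<longlonglongrightarrow> 0"
  proof (intro tendsto_null_sum)
    fix l assume l: "l \<in> {..<m}"
    then have "m - l - 1 < m" "l < m" and ml: "m - l = Suc (m - l - 1)" by auto
    \<comment> \<open>Two uses of the induction hypothesis: S_(l+1) is split off with S_(m-l) in the
      remainder, then S_(m-l) itself. Both parts are at most m, hence smaller than Suc m.\<close>
    have "(\<lambda>N. (X (Suc l # (m - l) # ps) N - ?\<sigma> (Suc l) * X ((m - l) # ps) N) +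
        ?\<sigma> (Suc l) * (X ((m - l) # ps) N - ?\<sigma> (m - l) * X ps N)) \<longlonglongrightarrow> 0 + ?\<sigma> (Suc l) * 0"
      using less.IH[OF \<open>l < m\<close>, of "(m - l) # ps"] less.IH[OF \<open>m - l - 1 < m\<close>, of ps] less.prems
          ml l
      by (intro tendsto_intros) auto
    then show "(\<lambda>N. X (Suc l # (m - l) # ps) N - ?\<sigma> (Suc l) * ?\<sigma> (m - l) * X ps N) \<longlonglongrightarrow> 0"
      by (simp add: algebra_simps)
  qed
  have D: "?D \<longlonglongrightarrow> 0"
  proof -
    obtain C1 where C1: "\<forall>\<^sub>F N in sequentially. \<bar>scaled_drift \<nu> (\<beta> N) N m ps\<bar> \<le> C1"
      using drift_bounded[OF less.prems] by blast
    obtain C2 where C2: "\<forall>\<^sub>F N in sequentially. \<bar>X (Suc m # ps) N\<bar> \<le> C2"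
      using X_bounded[of "Suc m # ps"] less.prems by auto
    have "\<forall>\<^sub>F N in sequentially. \<bar>scaled_drift \<nu> (\<beta> N) N m ps + real m * X (Suc m # ps) N\<bar> \<le> C1 +
        real m * C2"
      using C1 C2
    proof eventually_elim
      case (elim N)
      have "\<bar>real m * X (Suc m # ps) N\<bar> \<le> real m * C2"
        unfolding abs_mult using elim(2) by (simp add: mult_left_mono)
      then show ?case using elim(1) by linarith
    qed
    then show ?thesis by (rule null_mult_bounded[OF two_over_beta])
  qed
  have ev: "\<forall>\<^sub>F N in sequentially. X (Suc m # ps) N - ?\<sigma> (Suc m) * X ps N = (?A N + ?B N + ?D N) /
      ?c"
    using eventually_large[of "m + sum_list ps + 1"]
  proof eventually_elim
    case (elim N)
    have x0: "X (0 # ps) N = real N * X ps N"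
    proof -
      have "inv_prod N (0 # ps) = (\<lambda>x. real N * inv_prod N ps x)"
        by (rule ext) (simp add: inv_pow_sum_def)
      then show ?thesis by (simp add: scaled_expect_def laguerre_expect_cmult)
    qed
    have "1 / (4 * real N) * X (m # ps) N = ?A N + (if m = 0 then 1 / 4 else 0) * X ps N"
      using elim x0 by auto
    then have "?c * X (Suc m # ps) N = ?A N + (if m = 0 then 1 / 4 else 0) * X ps N +
        (\<Sum>l<m. X (Suc l # (m - l) # ps) N) + ?D N"
      using scaled_loop_equation[of N "\<beta> N" m ps \<nu>] elim by simp
    moreover have "?c * ?\<sigma> (Suc m) * X ps N = (if m = 0 then 1 / 4 else 0) * X ps N +
        (\<Sum>l<m. ?\<sigma> (Suc l) * ?\<sigma> (m - l) * X ps N)"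
      unfolding rayleigh_rec[OF nu] by (simp add: distrib_right sum_distrib_right)
    ultimately have "?c * (X (Suc m # ps) N - ?\<sigma> (Suc m) * X ps N) = ?A N + ?B N + ?D N"
      by (simp add: right_diff_distrib sum_subtractf mult.assoc)
    then show ?case using c by (simp add: eq_divide_eq mult.commute)
  qed
  have "(\<lambda>N. (?A N + ?B N + ?D N) / ?c) \<longlonglongrightarrow> (0 + 0 + 0) / ?c"
    by (intro tendsto_divide tendsto_add A B D tendsto_const) (use c in simp)
  then show ?case by (subst tendsto_cong[OF ev]) simp
qed

lemma X_Nil_tendsto: "X [] \<longlonglongrightarrow> 1"
  by (rule tendsto_eventually[OF X_Nil])

lemma X_Cons_tendsto:
  assumes "k \<ge> 1" "0 \<notin> set ps" "X ps \<longlonglongrightarrow> L"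
  shows "X (k # ps) \<longlonglongrightarrow> rayleigh \<nu> k * L"
proof -
  obtain m where k: "k = Suc m" using assms(1) by (cases k) auto
  have "(\<lambda>N. (X (Suc m # ps) N - rayleigh \<nu> (Suc m) * X ps N) + rayleigh \<nu> (Suc m) * X ps N)
      \<longlonglongrightarrow> 0 + rayleigh \<nu> (Suc m) * L"
    by (intro tendsto_intros X_factorization assms)
  then show ?thesis by (simp add: k)
qed

lemma scaled_moment_tendsto:
  assumes "k \<ge> 1"
  shows "(\<lambda>N. (\<beta> N / (8 * real N)) ^ k * laguerre_moment (\<beta> N) N (- int k) (\<beta> N / 2 * (\<nu> + 1)))
    \<longlonglongrightarrow> rayleigh \<nu> k"
proof -
  have ev: "\<forall>\<^sub>F N in sequentially. X [k] N =
      (\<beta> N / (8 * real N)) ^ k * laguerre_moment (\<beta> N) N (- int k) (\<beta> N / 2 * (\<nu> + 1))"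
    using eventually_large[of k]
  proof eventually_elim
    case (elim N)
    then show ?case using laguerre_moment_eq[of "\<beta> N / 2 * (\<nu> + 1)" "\<beta> N" N k] by (simp add:
        scaled_expect_def)
  qed
  have "X [k] \<longlonglongrightarrow> rayleigh \<nu> k * 1"
    using assms by (intro X_Cons_tendsto X_Nil_tendsto) auto
  then show ?thesis by (subst tendsto_cong[OF ev, symmetric]) simp
qed

end

text \<open>Since the variances vanish in the limit, some configuration of the ensemble has power sums
  close to the limits.\<close>

lemma exists_configuration:
  assumes "\<nu> > -1" "\<epsilon> > 0"
  shows "\<exists>N (a :: nat \<Rightarrow> real). (\<forall>i\<in>{1..N}. a i > 0) \<and>
    (\<forall>k\<in>{1..n}. \<bar>(\<Sum>i=1..N. a i ^ k) - rayleigh \<nu> k\<bar> < \<epsilon>)"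
proof -
  let ?\<sigma> = "rayleigh \<nu>"
  \<comment> \<open>Any sequence tending to infinity would do, as the limits do not depend on it;
    here \<beta> N = N.\<close>
  interpret growing_beta \<nu> real
    by standard (use assms in \<open>auto simp: filterlim_real_sequentially\<close>)
  \<comment> \<open>The expanded mean square deviation of the scaled power sums from their limits,
    added over k.\<close>
  have "(\<lambda>N. \<Sum>k\<in>{1..n}. X [k, k] N + (- 2 * ?\<sigma> k * X [k] N + ?\<sigma> k ^ 2 * X [] N))
      \<longlonglongrightarrow> (\<Sum>k\<in>{1..n}. ?\<sigma> k * (?\<sigma> k * 1) + (- 2 * ?\<sigma> k * (?\<sigma> k * 1) + ?\<sigma> k ^ 2 * 1))"
    by (intro tendsto_intros X_Cons_tendsto X_Nil_tendsto) auto
  also have "(\<Sum>k\<in>{1..n}. ?\<sigma> k * (?\<sigma> k * 1) + (- 2 * ?\<sigma> k * (?\<sigma> k * 1) + ?\<sigma> k ^ 2 * 1)) = 0"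
    by (intro sum.neutral) (auto simp: power2_eq_square)
  finally have "\<forall>\<^sub>F N in sequentially.
      (\<Sum>k\<in>{1..n}. X [k, k] N + (- 2 * ?\<sigma> k * X [k] N + ?\<sigma> k ^ 2 * X [] N)) < \<epsilon> ^ 2"
    by (rule order_tendstoD) (use assms in auto)
  then have "\<forall>\<^sub>F N in sequentially.
      (\<Sum>k\<in>{1..n}. X [k, k] N + (- 2 * ?\<sigma> k * X [k] N + ?\<sigma> k ^ 2 * X [] N)) < \<epsilon> ^ 2 \<and>
      N \<ge> 1 \<and> real N \<ge> 1 \<and> real (2 * n) \<le> real N / 2 * (\<nu> + 1)"
    using eventually_large[of "2 * n"] by eventually_elim simp
  from eventually_happens'[OF sequentially_bot this]
  obtain N where less: "(\<Sum>k\<in>{1..n}. X [k, k] N + (- 2 * ?\<sigma> k * X [k] N + ?\<sigma> k ^ 2 * X [] N)) < \<epsilon> ^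
      2"
    and N: "N \<ge> 1" and \<alpha>: "real (2 * n) \<le> real N / 2 * (\<nu> + 1)"
    by blast
  \<comment> \<open>The scaling factor \<beta> / (8 N) for \<beta> = N, left unreduced to match
    \<open>scaled_expect\<close>.\<close>
  define r where "r = real N / (8 * real N)"
  let ?\<alpha> = "real N / 2 * (\<nu> + 1)"
  let ?E = "laguerre_expect (real N) ?\<alpha> N" and ?I = "laguerre_integrable (real N) ?\<alpha> N"
  define g where "g = (\<lambda>k x. r ^ (2 * k) * inv_prod N [k, k] x +
     ((- 2 * ?\<sigma> k * r ^ k) * inv_prod N [k] x + ?\<sigma> k ^ 2 * inv_prod N [] x))"
  have sq: "g k x = (r ^ k * inv_pow_sum N k x - ?\<sigma> k) ^ 2" for k x
    by (simp add: g_def power2_eq_square power_mult algebra_simps)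
  have \<alpha>0: "0 \<le> ?\<alpha>" by (rule order_trans[OF _ \<alpha>]) simp
  have I: "?I (inv_prod N [k, k])" "?I (inv_prod N [k])" "?I (inv_prod N [])" if "k \<in> {1..n}" for k
  proof -
    have "real (sum_list [k, k]) \<le> ?\<alpha>" "real (sum_list [k]) \<le> ?\<alpha>"
      by (rule order_trans[OF _ \<alpha>], use that in simp)+
    then show "?I (inv_prod N [k, k])" "?I (inv_prod N [k])" "?I (inv_prod N [])"
      using \<alpha>0 by (auto intro!: laguerre_integrable_inv_prod simp del: times_divide_eq_left)
  qed
  have Ig: "?I (g k)" if "k \<in> {1..n}" for k
    unfolding g_def using I[OF that] by (intro laguerre_integrable_add laguerre_integrable_cmult)
  have Eg: "?E (g k) = X [k, k] N + (- 2 * ?\<sigma> k * X [k] N + ?\<sigma> k ^ 2 * X [] N)" if "k \<in> {1..n}"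
      for k
    unfolding g_def using I[OF that]
    by (simp only: laguerre_expect_add laguerre_expect_cmult laguerre_integrable_add
        laguerre_integrable_cmult)
       (simp add: scaled_expect_def r_def[symmetric] inv_prod_Nil_eq del: inv_prod_Cons
           inv_prod_Nil flip: mult_2)
  have "?E (\<lambda>x. \<Sum>k\<in>{1..n}. g k x) = (\<Sum>k\<in>{1..n}. ?E (g k))"
    using Ig by (rule laguerre_expect_sum)
  also have "\<dots> = (\<Sum>k\<in>{1..n}. X [k, k] N + (- 2 * ?\<sigma> k * X [k] N + ?\<sigma> k ^ 2 * X [] N))"
    by (intro sum.cong refl Eg)
  finally have E: "?E (\<lambda>x. \<Sum>k\<in>{1..n}. g k x) < \<epsilon> ^ 2" using less by (simp only:)
  \<comment> \<open>A quantity whose expectation is below \<epsilon>^2 takes a value below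
    \<epsilon>^2 at some positive configuration.\<close>
  have "\<exists>x. (\<forall>i\<in>{1..N}. x i > 0) \<and> (\<Sum>k\<in>{1..n}. g k x) < \<epsilon> ^ 2"
  proof (rule ccontr)
    assume "\<not> ?thesis"
    then have ge: "\<epsilon> ^ 2 * 1 \<le> (\<Sum>k\<in>{1..n}. g k x)" if "\<forall>i\<in>{1..N}. x i > 0" for x
      using that unfolding mult_1_right by (meson not_less)
    have "?E (\<lambda>x. \<epsilon> ^ 2 * 1) \<le> ?E (\<lambda>x. \<Sum>k\<in>{1..n}. g k x)"
      using ge by (intro laguerre_expect_mono laguerre_integrable_cmult laguerre_integrable_1
          laguerre_integrable_sum Ig \<alpha>0) auto
    then show False using E \<alpha>0 by (simp only: laguerre_expect_cmult laguerre_expect_1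
        of_nat_0_le_iff)
  qed
  then obtain x where x: "\<forall>i\<in>{1..N}. x i > 0" "(\<Sum>k\<in>{1..n}. g k x) < \<epsilon> ^ 2" by blast
  have "\<bar>(\<Sum>i=1..N. (r * inverse (x i)) ^ k) - ?\<sigma> k\<bar> < \<epsilon>" if k: "k \<in> {1..n}" for k
  proof -
    have "g k x \<le> (\<Sum>k\<in>{1..n}. g k x)" by (rule member_le_sum[OF k]) (auto simp: sq)
    then have "\<bar>r ^ k * inv_pow_sum N k x - ?\<sigma> k\<bar> ^ 2 < \<epsilon> ^ 2" using x(2) by (simp add: sq)
    then have "\<bar>r ^ k * inv_pow_sum N k x - ?\<sigma> k\<bar> < \<epsilon>" using assms(2) by (rule
        power2_less_imp_less[OF _ less_imp_le])
    then show ?thesis by (simp add: inv_pow_sum_def power_mult_distrib sum_distrib_left)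
  qed
  moreover have "r * inverse (x i) > 0" if "i \<in> {1..N}" for i using x(1) that N by (simp add: r_def)
  ultimately show ?thesis by (intro exI[of _ N] exI[of _ "\<lambda>i. r * inverse (x i)"]) auto
qed

section \<open>The limiting atoms\<close>

text \<open>Sorting and padding with zeros leaves the power sums with k >= 1 unchanged, and turns
  configurations of different sizes into sequences that can converge coordinatewise.\<close>

lemma exists_decreasing_configuration:
  assumes "\<nu> > -1" "\<epsilon> > 0"
  shows "\<exists>N (b :: nat \<Rightarrow> real). decseq b \<and> (\<forall>j. 0 \<le> b j) \<and> (\<forall>j\<ge>N. b j = 0) \<and>
    (\<forall>k\<in>{1..n}. \<bar>(\<Sum>j<N. b j ^ k) - rayleigh \<nu> k\<bar> < \<epsilon>)"
proof -
  obtain N and a :: "nat \<Rightarrow> real" where a: "\<forall>i\<in>{1..N}. a i > 0"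
    and le: "\<forall>k\<in>{1..n}. \<bar>(\<Sum>i=1..N. a i ^ k) - rayleigh \<nu> k\<bar> < \<epsilon>"
    using exists_configuration[OF assms] by blast
  define xs where "xs = rev (sort (map a [1..<Suc N]))"
  have len: "length xs = N" by (simp add: xs_def)
  have ms: "mset xs = mset (map a [1..<Suc N])" by (simp add: xs_def)
  have pos: "xs ! j > 0" if "j < N" for j
  proof -
    have "xs ! j \<in> set xs" using that len by (intro nth_mem) simp
    also have "set xs = set (map a [1..<Suc N])" using ms by (rule mset_eq_setD)
    also have "\<dots> = a ` {1..<Suc N}" by (simp only: set_map set_upt)
    finally show ?thesis using a by auto
  qed
  have mono: "xs ! j \<le> xs ! i" if "i \<le> j" "j < N" for i j
  proof -
    have "sorted (rev xs)" by (simp add: xs_def)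
    then have "sorted_wrt (\<ge>) xs" by (simp add: sorted_wrt_rev)
    then show ?thesis using that len by (cases "i = j") (auto simp: sorted_wrt_iff_nth_less)
  qed
  define b where "b = (\<lambda>j. if j < N then xs ! j else 0)"
  have "(\<Sum>j<N. b j ^ k) = (\<Sum>i=1..N. a i ^ k)" for k
  proof -
    have "(\<Sum>j<N. b j ^ k) = (\<Sum>j=0..<length xs. map (\<lambda>t. t ^ k) xs ! j)"
      by (intro sum.cong) (auto simp: b_def len)
    also have "\<dots> = sum_list (map (\<lambda>t. t ^ k) xs)" by (simp add: sum_list_sum_nth)
    also have "\<dots> = sum_mset (image_mset (\<lambda>t. t ^ k) (mset xs))"
      by (metis mset_map sum_mset_sum_list)
    also have "\<dots> = sum_list (map (\<lambda>t. t ^ k) (map a [1..<Suc N]))"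
      unfolding ms by (metis mset_map sum_mset_sum_list)
    also have "\<dots> = (\<Sum>i\<in>{1..<Suc N}. a i ^ k)"
      by (simp add: sum_list_distinct_conv_sum_set comp_def del: upt_Suc)
    finally show ?thesis by (simp add: atLeastLessThanSuc_atLeastAtMost)
  qed
  moreover have "decseq b"
    unfolding decseq_def
  proof (intro allI impI)
    fix i j :: nat assume "i \<le> j"
    then show "b j \<le> b i" using mono[of i j] pos[of i] by (auto simp: b_def less_imp_le)
  qed
  moreover have "0 \<le> b j" for j using pos[of j] by (auto simp: b_def less_imp_le)
  ultimately show ?thesis using le by (intro exI[of _ N] exI[of _ b]) (auto simp: b_def)
qed

text \<open>Dominated convergence for series. It serves three limits of different kinds: along a
  subsequence of configurations, in the length of a partial sum, and in a real parameter approaching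
  a pole.\<close>

lemma tannery:
  fixes f :: "nat \<Rightarrow> 'a \<Rightarrow> 'b :: {real_normed_algebra, banach}"
  assumes "\<And>k. (f k \<longlongrightarrow> g k) F"
    and "\<forall>\<^sub>F k in sequentially. \<forall>n. P n \<longrightarrow> norm (f k n) \<le> M k"
    and "eventually P F" "summable M" "F \<noteq> bot"
  shows "summable g" and "((\<lambda>n. \<Sum>k. f k n) \<longlongrightarrow> (\<Sum>k. g k)) F"
proof -
  have "\<forall>\<^sub>F (k, n) in sequentially \<times>\<^sub>F F. norm (f k n) \<le> M k"
    unfolding eventually_prod_filter using assms(2,3)
    by (intro exI[of _ "\<lambda>k. \<forall>n. P n \<longrightarrow> norm (f k n) \<le> M k"] exI[of _ P]) auto
  from tannerys_theorem[OF assms(1) this assms(4,5)]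
  show "summable g" "((\<lambda>n. \<Sum>k. f k n) \<longlongrightarrow> (\<Sum>k. g k)) F"
    by (auto dest: summable_norm_cancel)
qed

text \<open>Tychonoff's theorem in place of a diagonal argument: the countable product of the
  intervals is compact, hence sequentially compact.\<close>

lemma compact_box_sequence:
  fixes b :: "nat \<Rightarrow> nat \<Rightarrow> real"
  assumes "\<And>n j. 0 \<le> b n j \<and> b n j \<le> c j"
  shows "\<exists>r a. strict_mono (r :: nat \<Rightarrow> nat) \<and> (\<forall>j. (\<lambda>n. b (r n) j) \<longlonglongrightarrow> a j)"
proof -
  have "compact (PiE UNIV (\<lambda>j. {0..c j}) :: (nat \<Rightarrow> real) set)"
    using compactin_PiE[of "\<lambda>_. euclidean" UNIV "\<lambda>j. {0..c j}"]
    by (simp add: euclidean_product_topology)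
  then have "seq_compact (PiE UNIV (\<lambda>j. {0..c j}) :: (nat \<Rightarrow> real) set)"
    by (rule compact_imp_seq_compact)
  moreover have "\<forall>n. b n \<in> PiE UNIV (\<lambda>j. {0..c j})" using assms by auto
  ultimately obtain a and r :: "nat \<Rightarrow> nat" where r: "strict_mono r" "(b \<circ> r) \<longlonglongrightarrow> a"
    by (rule seq_compactE)
  have "(\<lambda>n. b (r n) j) \<longlonglongrightarrow> a j" for j
  proof -
    have "isCont (\<lambda>x :: nat \<Rightarrow> real. x j) a"
      using continuous_on_product_coordinates[of j, where 'b = real]
      unfolding continuous_on_eq_continuous_at[OF open_UNIV] by blast
    from isCont_tendsto_compose[OF this r(2)] show ?thesis by (simp add: o_def)
  qed
  then show ?thesis using r(1) by blast
qed

text \<open>A coordinatewise limit of sorted configurations. For k >= 2 a summable bound allows the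
  limit inside the sum; for k = 1 only partial sums pass to the limit, which gives an
  inequality.\<close>

lemma rayleigh_atoms:
  assumes nu: "\<nu> > -1"
  shows "\<exists>a :: nat \<Rightarrow> real. decseq a \<and> (\<forall>j. 0 \<le> a j) \<and> summable a \<and> suminf a \<le> rayleigh \<nu> 1 \<and>
     (\<forall>k\<ge>2. (\<lambda>j. a j ^ k) sums rayleigh \<nu> k)"
proof -
  let ?\<sigma> = "rayleigh \<nu>"
  have "\<forall>n. \<exists>N b. decseq b \<and> (\<forall>j. 0 \<le> b j) \<and> (\<forall>j\<ge>N. b j = 0) \<and>
      (\<forall>k\<in>{1..Suc n}. \<bar>(\<Sum>j<N. b j ^ k) - ?\<sigma> k\<bar> < 1 / real (Suc n))"
    using exists_decreasing_configuration[OF nu] by auto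
  then obtain N b where b: "\<And>n. decseq (b n)" "\<And>n j. 0 \<le> b n j" "\<And>n j. j \<ge> N n \<Longrightarrow> b n j = 0"
    and approx: "\<And>n k. k \<in> {1..Suc n} \<Longrightarrow> \<bar>(\<Sum>j<N n. b n j ^ k) - ?\<sigma> k\<bar> < 1 / real (Suc n)"
    by metis
  define p where "p = (\<lambda>n k. \<Sum>j<N n. b n j ^ k)"
  have p_lim: "(\<lambda>n. p n k) \<longlonglongrightarrow> ?\<sigma> k" if "k \<ge> 1" for k
  proof (rule LIM_zero_cancel, rule Lim_null_comparison)
    show "\<forall>\<^sub>F n in sequentially. norm (p n k - ?\<sigma> k) \<le> 1 / real (Suc n)"
      using eventually_ge_at_top[of k]
    proof eventually_elim
      case (elim n)
      then show ?case using approx[of k n] that by (simp add: p_def)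
    qed
  qed real_asymp
  define C where "C = ?\<sigma> 1 + 1"
  have p1: "p n 1 \<le> C" for n
  proof -
    have "\<bar>p n 1 - ?\<sigma> 1\<bar> < 1 / real (Suc n)" using approx[of 1 n] by (simp add: p_def)
    moreover have "1 / real (Suc n) \<le> 1" by simp
    ultimately show ?thesis unfolding C_def by linarith
  qed
  have partial: "(\<Sum>j<J. b n j) \<le> p n 1" for n J
  proof -
    have "(\<Sum>j<J. b n j) \<le> (\<Sum>j<max J (N n). b n j)" by (rule sum_mono2) (use b in auto)
    also have "\<dots> = (\<Sum>j<N n. b n j)" by (rule sum.mono_neutral_right) (use b in auto)
    finally show ?thesis by (simp add: p_def)
  qed
  \<comment> \<open>In a decreasing sequence the first j + 1 terms are all at least b_j, and their
    sum is at most C.\<close>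
  have bC: "b n j \<le> C / real (Suc j)" for n j
  proof -
    have "real (Suc j) * b n j = (\<Sum>i<Suc j. b n j)" by simp
    also have "\<dots> \<le> (\<Sum>i<Suc j. b n i)"
      using b(1) by (intro sum_mono) (auto simp: decseq_def)
    also have "\<dots> \<le> C" using partial p1 order_trans by blast
    finally show ?thesis by (simp add: field_simps)
  qed
  obtain r a where r: "strict_mono (r :: nat \<Rightarrow> nat)" and lim: "\<And>j. (\<lambda>n. b (r n) j) \<longlonglongrightarrow> a j"
    using compact_box_sequence[of b "\<lambda>j. C / real (Suc j)"] b(2) bC by blast
  have p_lim': "(\<lambda>n. p (r n) k) \<longlonglongrightarrow> ?\<sigma> k" if "k \<ge> 1" for k
    using LIMSEQ_subseq_LIMSEQ[OF p_lim[OF that] r] by (simp add: o_def)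
  have a0: "0 \<le> a j" for j by (rule LIMSEQ_le_const[OF lim]) (use b in auto)
  have dec: "decseq a"
    unfolding decseq_def
  proof (intro allI impI)
    fix i j :: nat assume "i \<le> j"
    then show "a j \<le> a i" using b(1) by (intro LIMSEQ_le[OF lim lim]) (auto simp: decseq_def)
  qed
  have part: "(\<Sum>j<J. a j) \<le> ?\<sigma> 1" for J
    by (rule LIMSEQ_le[OF tendsto_sum[OF lim] p_lim'[of 1]]) (use partial in auto)
  have summ: "summable a" by (rule summableI_nonneg_bounded[OF a0 part])
  have sums: "(\<lambda>j. a j ^ k) sums ?\<sigma> k" if k: "k \<ge> 2" for k
  proof -
    have C0: "C \<ge> 0" using bC[of 0 0] b(2)[of 0 0] by simp
    have sM: "summable (\<lambda>j. (C / real (Suc j)) ^ k)"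
    proof -
      have "summable (\<lambda>j. inverse (real j ^ k))" using k by (intro inverse_power_summable) auto
      then have "summable (\<lambda>j. C ^ k * inverse (real (Suc j) ^ k))"
        by (subst (asm) summable_Suc_iff[symmetric]) (rule summable_mult)
      moreover have "(C / real (Suc j)) ^ k = C ^ k * inverse (real (Suc j) ^ k)" for j
        by (simp only: power_divide divide_inverse power_mult_distrib power_inverse)
      ultimately show ?thesis by (simp only:)
    qed
    have "norm (b (r n) j ^ k) \<le> (C / real (Suc j)) ^ k" for n j
      using bC[of "r n" j] b(2)[of "r n" j] by (simp add: power_mono)
    then have bd: "\<forall>\<^sub>F j in sequentially. \<forall>n. True \<longrightarrow> norm (b (r n) j ^ k) \<le> (C / real (Suc j)) ^ k"
      by simp
    have "(\<lambda>n. b (r n) j ^ k) \<longlonglongrightarrow> a j ^ k" for j by (intro tendsto_power lim)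
    note tan = tannery[of "\<lambda>j n. b (r n) j ^ k", OF this bd _ sM]
    have "(\<lambda>n. \<Sum>j. b (r n) j ^ k) \<longlonglongrightarrow> (\<Sum>j. a j ^ k)" by (rule tan(2)) auto
    moreover have "(\<Sum>j. b (r n) j ^ k) = p (r n) k" for n
      unfolding p_def by (rule suminf_finite) (use b k in auto)
    ultimately have "?\<sigma> k = (\<Sum>j. a j ^ k)"
      using p_lim'[of k] k LIMSEQ_unique by fastforce
    moreover have "summable (\<lambda>j. a j ^ k)" by (rule tan(1)) auto
    ultimately show ?thesis by (simp add: sums_iff)
  qed
  have "suminf a \<le> ?\<sigma> 1" using summ part by (intro suminf_le_const) auto
  then show ?thesis using dec a0 summ sums by blast
qed

section \<open>The power series of the Bessel function\<close>

text \<open>Without the sign (-1)^m, since these positive numbers are the coefficients that matter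
  on the negative axis.\<close>

definition bessel_coeff :: "real \<Rightarrow> nat \<Rightarrow> real" where
  "bessel_coeff \<nu> m = 1 / (4 ^ m * fact m * pochhammer (\<nu> + 1) m)"

text \<open>\<open>J\<^sub>\<nu>(x)\<close> is \<open>(x / 2) powr \<nu> / Gamma (\<nu> + 1)\<close> times this series at \<open>x\<^sup>2\<close>.\<close>

definition bessel_fps :: "real \<Rightarrow> complex fps" where
  "bessel_fps \<nu> = Abs_fps (\<lambda>m. of_real ((-1) ^ m * bessel_coeff \<nu> m))"

text \<open>Shifted by one so that it becomes the expansion of -f'/f at 0: a zero at 1 / a
  contributes the geometric series of a / (1 - a z).\<close>

definition rayleigh_fps :: "real \<Rightarrow> complex fps" where
  "rayleigh_fps \<nu> = Abs_fps (\<lambda>k. of_real (rayleigh \<nu> (Suc k)))"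

lemma bessel_coeff_pos: "\<nu> > -1 \<Longrightarrow> bessel_coeff \<nu> m > 0"
  unfolding bessel_coeff_def by (intro divide_pos_pos mult_pos_pos pochhammer_pos) auto

lemma bessel_coeff_0 [simp]: "bessel_coeff \<nu> 0 = 1"
  by (simp add: bessel_coeff_def)

lemma bessel_coeff_Suc:
  assumes "\<nu> > -1"
  shows "4 * real (Suc m) * (\<nu> + 1 + real m) * bessel_coeff \<nu> (Suc m) = bessel_coeff \<nu> m"
proof -
  have "4 * S * q * (1 / (4 * u * (S * f) * (p * q))) = 1 / (u * f * p)" if "S \<noteq> 0" "q \<noteq> 0"
    for S q u f p :: real
    using that by (simp add: divide_simps)
  moreover have "\<nu> + 1 + real m \<noteq> 0" using assms by linarith
  ultimately show ?thesis
    unfolding bessel_coeff_def pochhammer_Suc fact_Suc power_Suc of_nat_mult of_nat_fact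
    by (simp del: of_nat_Suc)
qed

lemma summable_bessel_coeff:
  fixes z :: "'a :: {real_normed_field, banach}"
  assumes nu: "\<nu> > -1"
  shows "summable (\<lambda>m. of_real (bessel_coeff \<nu> m) * z ^ m)"
proof (rule summable_ratio_test)
  \<comment> \<open>From K on, norm z <= n and \<nu> + 1 + n >= 1. As consecutive coefficients have
    ratio 1 / (4 (n + 1) (\<nu> + 1 + n)), the ratio of the terms is at most 1/2.\<close>
  define K where "K = Suc (nat \<lceil>norm z\<rceil>)"
  show "(1 / 2 :: real) < 1" by simp
  fix n assume n: "K \<le> n"
  have z: "norm z \<le> real n" using n unfolding K_def by linarith
  have h: "bessel_coeff \<nu> n > 0" "bessel_coeff \<nu> (Suc n) > 0" using bessel_coeff_pos[OF nu] by auto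
  have "norm z * bessel_coeff \<nu> (Suc n) \<le> (2 * real (Suc n) * (\<nu> + 1 + real n)) * bessel_coeff \<nu>
      (Suc n)"
  proof (intro mult_right_mono)
    have "real n \<le> 1 * real (Suc n) * 1" by simp
    also have "\<dots> \<le> 2 * real (Suc n) * (\<nu> + 1 + real n)"
      using nu n by (intro mult_mono) (auto simp: K_def)
    finally show "norm z \<le> 2 * real (Suc n) * (\<nu> + 1 + real n)" using z by linarith
  qed (use h in simp)
  also have "\<dots> = 1 / 2 * bessel_coeff \<nu> n" using bessel_coeff_Suc[OF nu, of n] by (simp add:
      algebra_simps)
  finally have "norm z ^ n * (norm z * bessel_coeff \<nu> (Suc n)) \<le> norm z ^ n * (1 / 2 *
      bessel_coeff \<nu> n)"
    by (intro mult_left_mono) auto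
  then show "norm (of_real (bessel_coeff \<nu> (Suc n)) * z ^ Suc n) \<le> 1 / 2 * norm (of_real
      (bessel_coeff \<nu> n) * z ^ n)"
    using h by (simp add: norm_mult norm_power mult_ac)
qed

lemma bessel_fps_conv_radius:
  assumes "\<nu> > -1"
  shows "fps_conv_radius (bessel_fps \<nu>) = \<infinity>"
  unfolding fps_conv_radius_def
proof (rule conv_radius_inftyI'')
  fix z :: complex
  have "(\<lambda>m. of_real (bessel_coeff \<nu> m) * (- z) ^ m) = (\<lambda>n. fps_nth (bessel_fps \<nu>) n * z ^ n)"
    by (rule ext) (simp add: bessel_fps_def power_minus[of z] mult_ac)
  then show "summable (\<lambda>n. fps_nth (bessel_fps \<nu>) n * z ^ n)"
    using summable_bessel_coeff[OF assms, of "- z"] by simp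
qed

lemma bessel_fps_deriv_conv_radius:
  assumes "\<nu> > -1"
  shows "fps_conv_radius ((fps_deriv ^^ n) (bessel_fps \<nu>)) = \<infinity>"
proof (induction n)
  case (Suc n)
  then show ?case using fps_conv_radius_deriv[of "(fps_deriv ^^ n) (bessel_fps \<nu>)"] by simp
qed (simp add: bessel_fps_conv_radius[OF assms])

text \<open>Bessel's equation in the variable z = x^2, freed of the factor x^\<nu>; its coefficients
  give \<open>bessel_coeff_Suc\<close>.\<close>

lemma bessel_fps_ode:
  assumes nu: "\<nu> > -1"
  shows "fps_X * fps_deriv (fps_deriv (bessel_fps \<nu>)) + fps_const (of_real (\<nu> + 1)) * fps_deriv
      (bessel_fps \<nu>)
     + fps_const (1 / 4) * bessel_fps \<nu> = 0"
proof (rule fps_ext)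
  fix n
  let ?h = "bessel_coeff \<nu>"
  have "fps_nth (fps_X * fps_deriv (fps_deriv (bessel_fps \<nu>))) n = of_nat n * of_nat (Suc n) *
      fps_nth (bessel_fps \<nu>) (Suc n)"
    by (cases n) (simp_all add: mult_ac)
  then have "fps_nth (fps_X * fps_deriv (fps_deriv (bessel_fps \<nu>)) + fps_const (of_real (\<nu> + 1)) *
      fps_deriv (bessel_fps \<nu>)
     + fps_const (1 / 4) * bessel_fps \<nu>) n =
     of_real ((-1) ^ n * (1 / 4) * (?h n - 4 * real (Suc n) * (\<nu> + 1 + real n) * ?h (Suc n)))"
    by (simp add: bessel_fps_def algebra_simps)
  then show "fps_nth (fps_X * fps_deriv (fps_deriv (bessel_fps \<nu>)) + fps_const (of_real (\<nu> + 1)) *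
      fps_deriv (bessel_fps \<nu>)
     + fps_const (1 / 4) * bessel_fps \<nu>) n = fps_nth 0 n"
    unfolding bessel_coeff_Suc[OF nu] by simp
qed

text \<open>The n-th coefficient is \<open>rayleigh_rec\<close>: the convolution becomes a square,
  and the factor n in \<nu> + 1 + n a derivative.\<close>

lemma rayleigh_fps_riccati:
  assumes nu: "\<nu> > -1"
  shows "fps_X * fps_deriv (rayleigh_fps \<nu>) =
     fps_X * (rayleigh_fps \<nu> * rayleigh_fps \<nu>) - fps_const (of_real (\<nu> + 1)) * rayleigh_fps \<nu> +
         fps_const (1 / 4)"
proof (rule fps_ext)
  fix n
  let ?U = "rayleigh_fps \<nu>" and ?s = "rayleigh \<nu>"
  have 1: "fps_nth (fps_X * fps_deriv ?U) n = of_real (real n * ?s (Suc n))"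
    by (cases n) (simp_all add: rayleigh_fps_def)
  have 2: "fps_nth (fps_X * (?U * ?U)) n = of_real (\<Sum>l<n. ?s (Suc l) * ?s (n - l))"
  proof (cases n)
    case (Suc m)
    have "fps_nth (fps_X * (?U * ?U)) n = fps_nth (?U * ?U) m" by (simp only: Suc fps_X_mult_nth)
        simp
    also have "\<dots> = (\<Sum>i=0..m. of_real (?s (Suc i)) * of_real (?s (Suc (m - i))))"
      by (simp add: fps_mult_nth rayleigh_fps_def)
    also have "\<dots> = (\<Sum>i<n. of_real (?s (Suc i)) * of_real (?s (n - i)))"
      unfolding Suc by (intro sum.cong) (auto simp: Suc_diff_le)
    finally show ?thesis by simp
  qed simp
  have "fps_nth (fps_X * (?U * ?U) - fps_const (of_real (\<nu> + 1)) * ?U + fps_const (1 / 4)) n =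
     of_real ((\<Sum>l<n. ?s (Suc l) * ?s (n - l)) - (\<nu> + 1) * ?s (Suc n) + (if n = 0 then 1 / 4 else
         0))"
    unfolding fps_add_nth fps_sub_nth 2 by (simp add: rayleigh_fps_def)
  also have "(\<Sum>l<n. ?s (Suc l) * ?s (n - l)) - (\<nu> + 1) * ?s (Suc n) + (if n = 0 then 1 / 4 else 0)
      = real n * ?s (Suc n)"
    using rayleigh_rec[OF nu, of n] by (simp add: algebra_simps)
  finally show "fps_nth (fps_X * fps_deriv ?U) n =
     fps_nth (fps_X * (?U * ?U) - fps_const (of_real (\<nu> + 1)) * ?U + fps_const (1 / 4)) n"
    unfolding 1 by simp
qed

text \<open>The linear equation for f and the Riccati equation for U combine into z W' = z W U -
  (\<nu> + 1) W for W = f' + f U. This is singular at 0 and has no nonzero power series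
  solution.\<close>

lemma bessel_fps_log_deriv:
  assumes nu: "\<nu> > -1"
  shows "fps_deriv (bessel_fps \<nu>) + bessel_fps \<nu> * rayleigh_fps \<nu> = 0"
proof -
  define W where "W = fps_deriv (bessel_fps \<nu>) + bessel_fps \<nu> * rayleigh_fps \<nu>"
  define c where "c = fps_const (complex_of_real (\<nu> + 1))"
  let ?F = "bessel_fps \<nu>" and ?U = "rayleigh_fps \<nu>"
  have F2: "fps_X * fps_deriv (fps_deriv ?F) = - c * fps_deriv ?F - fps_const (1 / 4) * ?F"
  proof -
    have "fps_X * fps_deriv (fps_deriv ?F) + c * fps_deriv ?F + fps_const (1 / 4) * ?F = 0"
      unfolding c_def by (rule bessel_fps_ode[OF nu])
    moreover have "fps_X * fps_deriv (fps_deriv ?F) =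
        (fps_X * fps_deriv (fps_deriv ?F) + c * fps_deriv ?F + fps_const (1 / 4) * ?F) - c *
            fps_deriv ?F - fps_const (1 / 4) * ?F"
      by simp
    ultimately show ?thesis by simp
  qed
  have U1: "fps_X * fps_deriv ?U = fps_X * (?U * ?U) - c * ?U + fps_const (1 / 4)"
    using rayleigh_fps_riccati[OF nu] by (simp add: c_def)
  have "fps_X * fps_deriv W = fps_X * fps_deriv (fps_deriv ?F) + fps_X * fps_deriv ?F * ?U + ?F *
      (fps_X * fps_deriv ?U)"
    by (simp add: W_def algebra_simps)
  also have "\<dots> = fps_X * (W * ?U) - c * W"
    unfolding F2 U1 W_def by (simp add: algebra_simps)
  finally have W: "fps_X * fps_deriv W = fps_X * (W * ?U) - c * W" .
  have "fps_nth W n = 0" for n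
  proof (induction n rule: less_induct)
    case (less n)
    have "fps_nth (fps_X * (W * ?U)) n = 0"
    proof (cases n)
      case (Suc m)
      have "fps_nth (fps_X * (W * ?U)) n = fps_nth (W * ?U) m" by (simp only: Suc fps_X_mult_nth)
          simp
      also have "\<dots> = (\<Sum>i=0..m. fps_nth W i * fps_nth ?U (m - i))"
        by (simp only: fps_mult_nth)
      also have "\<dots> = 0" using less Suc by (intro sum.neutral) auto
      finally show ?thesis .
    qed simp
    moreover have "fps_nth (fps_X * fps_deriv W) n = of_nat n * fps_nth W n"
      by (cases n) simp_all
    \<comment> \<open>The term z W U involves only earlier coefficients, which vanish by
      induction.\<close>
    ultimately have "of_nat n * fps_nth W n = - (of_real (\<nu> + 1) * fps_nth W n)"
      using arg_cong[OF W, of "\<lambda>f. fps_nth f n"] by (simp add: c_def)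
    then have "of_real (\<nu> + 1 + real n) * fps_nth W n = 0"
      by (simp add: algebra_simps)
    moreover have "\<nu> + 1 + real n \<noteq> 0" using nu by linarith
    then have "complex_of_real (\<nu> + 1 + real n) \<noteq> 0" by (simp only: of_real_eq_0_iff
        not_False_eq_True)
    ultimately show ?case by (metis mult_eq_0_iff)
  qed
  then show ?thesis unfolding W_def[symmetric] by (intro fps_ext) simp
qed

text \<open>A double zero would, by the differential equation, be a zero of infinite order.\<close>

lemma bessel_zeros_simple:
  assumes nu: "\<nu> > -1" and z: "z \<noteq> 0" and F: "eval_fps (bessel_fps \<nu>) z = 0"
  shows "eval_fps (fps_deriv (bessel_fps \<nu>)) z \<noteq> 0"
proof
  assume F': "eval_fps (fps_deriv (bessel_fps \<nu>)) z = 0"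
  define D where "D = (\<lambda>n. (fps_deriv ^^ n) (bessel_fps \<nu>))"
  have D_Suc: "D (Suc n) = fps_deriv (D n)" for n by (simp add: D_def)
  have rad: "fps_conv_radius (D n) = \<infinity>" for n
    unfolding D_def by (rule bessel_fps_deriv_conv_radius[OF nu])
  \<comment> \<open>Differentiating the equation n times merely replaces \<nu> by \<nu> + n. For z
    different from 0 each derivative is thus determined by the two preceding ones.\<close>
  have ode: "fps_X * D (Suc (Suc n)) + fps_const (of_real (\<nu> + 1 + real n)) * D (Suc n) +
      fps_const (1 / 4) * D n = 0" for n
  proof (induction n)
    case 0
    then show ?case using bessel_fps_ode[OF nu] by (simp add: D_def)
  next
    case (Suc n)
    have c: "fps_const (complex_of_real (\<nu> + 1 + real (Suc n))) = 1 + fps_const (of_real (\<nu> + 1 +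
        real n))"
      by (simp flip: fps_const_add fps_const_1_eq_1)
    from arg_cong[OF Suc, of fps_deriv] show ?case
      unfolding c by (simp add: D_Suc[symmetric] algebra_simps)
  qed
  have "eval_fps (D n) z = 0 \<and> eval_fps (D (Suc n)) z = 0" for n
  proof (induction n)
    case 0
    then show ?case using F F' by (simp add: D_def)
  next
    case (Suc n)
    have "eval_fps (fps_X * D (Suc (Suc n)) + (fps_const (of_real (\<nu> + 1 + real n)) * D (Suc n) +
        fps_const (1 / 4) * D n)) z = 0"
      using ode[of n] by (simp add: add.assoc)
    moreover have "fps_conv_radius (f * D k) = \<infinity>" if "fps_conv_radius f = \<infinity>" for f k
      using fps_conv_radius_mult[of f "D k"] rad that by simp
    moreover have "fps_conv_radius (fps_const c * D k + fps_const d * D l) = \<infinity>" for c d k l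
      using fps_conv_radius_add[of "fps_const c * D k" "fps_const d * D l"] calculation(2) by simp
    ultimately have "z * eval_fps (D (Suc (Suc n))) z = 0"
      using Suc rad by (simp add: eval_fps_add eval_fps_mult)
    then show ?case using Suc z by simp
  qed
  then have 0: "eval_fps (D n) z = 0" for n by blast
  have deriv_D: "(deriv ^^ n) (eval_fps (bessel_fps \<nu>)) = eval_fps (D n)" for n
  proof (induction n)
    case (Suc n)
    have "deriv (eval_fps (D n)) = eval_fps (D (Suc n))"
      unfolding D_Suc by (rule ext) (simp add: eval_fps_deriv rad)
    then show ?case using Suc by simp
  qed (simp add: D_def)
  \<comment> \<open>All derivatives vanish at z, so the entire function is identically 0, whereas
    its constant coefficient is 1.\<close>
  have "eval_fps (bessel_fps \<nu>) 0 = 0"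
  proof (rule holomorphic_fun_eq_0_on_connected[where f = "eval_fps (bessel_fps \<nu>)" and S = UNIV
      and z = z])
    show "eval_fps (bessel_fps \<nu>) holomorphic_on UNIV"
      by (rule holomorphic_on_eval_fps) (simp add: bessel_fps_conv_radius[OF nu])
    show "(deriv ^^ n) (eval_fps (bessel_fps \<nu>)) z = 0" for n unfolding deriv_D by (rule 0)
  qed auto
  then show False by (simp add: eval_fps_at_0 bessel_fps_def)
qed

section \<open>The logarithmic derivative\<close>

text \<open>A polynomial of degree below \<open>M\<close> does not dominate \<open>r ^ M\<close>.\<close>

lemma power_series_eventually_negative:
  fixes d :: "nat \<Rightarrow> real"
  assumes summ: "\<And>r. r \<ge> 0 \<Longrightarrow> summable (\<lambda>m. d m * r ^ m)"
    and nonneg: "\<And>r. r \<ge> 0 \<Longrightarrow> 0 \<le> (\<Sum>m. d m * r ^ m)"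
    and neg: "\<And>m. m \<ge> M \<Longrightarrow> d m \<le> 0" "d M < 0"
  shows False
proof -
  have ge: "- d M \<le> (\<Sum>m<M. d m * (1 / r ^ (M - m)))" if r: "r > 0" for r :: real
  proof -
    have "0 \<le> (\<Sum>m. d m * r ^ m)" using nonneg r by simp
    also have "\<dots> = (\<Sum>m. d (m + Suc M) * r ^ (m + Suc M)) + (\<Sum>m<Suc M. d m * r ^ m)"
      by (rule suminf_split_initial_segment) (use summ r in simp)
    also have "(\<Sum>m. d (m + Suc M) * r ^ (m + Suc M)) \<le> 0"
    proof (rule suminf_le_const)
      show "summable (\<lambda>m. d (m + Suc M) * r ^ (m + Suc M))"
        by (rule summable_ignore_initial_segment) (use summ r in simp)
      show "(\<Sum>m<n. d (m + Suc M) * r ^ (m + Suc M)) \<le> 0" for n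
        using neg(1) r by (intro sum_nonpos mult_nonpos_nonneg) auto
    qed
    finally have "0 \<le> (\<Sum>m<M. d m * r ^ m) + d M * r ^ M" by simp
    then have "0 \<le> ((\<Sum>m<M. d m * r ^ m) + d M * r ^ M) / r ^ M" using r by simp
    also have "\<dots> = (\<Sum>m<M. d m * r ^ m / r ^ M) + d M" using r by (simp add: add_divide_distrib
        sum_divide_distrib)
    also have "(\<Sum>m<M. d m * r ^ m / r ^ M) = (\<Sum>m<M. d m * (1 / r ^ (M - m)))"
    proof (intro sum.cong refl)
      fix m assume "m \<in> {..<M}"
      then have "r ^ M = r ^ m * r ^ (M - m)" by (simp flip: power_add)
      then show "d m * r ^ m / r ^ M = d m * (1 / r ^ (M - m))" using r by simp
    qed
    finally show ?thesis by linarith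
  qed
  have "((\<lambda>r. \<Sum>m<M. d m * (1 / r ^ (M - m))) \<longlongrightarrow> (\<Sum>m<M. d m * 0)) at_top"
  proof (intro tendsto_sum tendsto_mult tendsto_const)
    fix m assume "m \<in> {..<M}"
    then show "((\<lambda>r :: real. 1 / r ^ (M - m)) \<longlongrightarrow> 0) at_top"
      by (intro tendsto_divide_0[OF tendsto_const] filterlim_at_top_imp_at_infinity
          filterlim_pow_at_top filterlim_ident) auto
  qed
  then have "- d M \<le> (\<Sum>m<M. d m * 0)"
    by (rule tendsto_lowerbound) (use ge in \<open>auto intro: eventually_mono[OF
        eventually_gt_at_top[of 0]]\<close>)
  then show False using neg(2) by simp
qed

locale bessel_atoms =
  fixes \<nu> :: real and a :: "nat \<Rightarrow> real"
  assumes nu: "\<nu> > -1" and dec: "decseq a" and nonneg: "\<And>j. 0 \<le> a j" and summ: "summable a"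
    and mass_le: "suminf a \<le> rayleigh \<nu> 1"
    and sums: "\<And>k. k \<ge> 2 \<Longrightarrow> (\<lambda>j. a j ^ k) sums rayleigh \<nu> k"
begin

abbreviation F :: "complex \<Rightarrow> complex" where "F z \<equiv> eval_fps (bessel_fps \<nu>) z"
abbreviation F' :: "complex \<Rightarrow> complex" where "F' z \<equiv> eval_fps (fps_deriv (bessel_fps \<nu>)) z"

text \<open>The squares in the numerators make the Taylor coefficients involve only the power sums
  with k >= 2, for which the atoms reproduce the Rayleigh sums exactly. The term of order 1 is kept
  apart.\<close>

definition G :: "complex \<Rightarrow> complex" where
  "G z = (\<Sum>j. of_real (a j) ^ 2 / (1 - of_real (a j) * z))"

text \<open>The complement of the ray from 1 / a_0 to the right. As a_0 is the largest atom, it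
  avoids all poles. The product form also covers a_0 = 0, not yet excluded, where it is the whole
  plane.\<close>

definition slit_plane :: "complex set" where
  "slit_plane = {z. Im z \<noteq> 0 \<or> Re z * a 0 < 1}"

text \<open>The mass that may have escaped in the limit, spread over many vanishing atoms.\<close>

definition lost_mass :: real where "lost_mass = rayleigh \<nu> 1 - suminf a"

lemma lost_mass_nonneg: "lost_mass \<ge> 0"
  using mass_le by (simp add: lost_mass_def)

lemma a_le: "a j \<le> a 0"
  using dec by (simp add: decseq_def)

lemma a_tendsto: "a \<longlonglongrightarrow> 0"
  by (rule summable_LIMSEQ_zero[OF summ])

lemma summable_square: "summable (\<lambda>j. (a j)\<^sup>2)"
  using sums[of 2] by (simp add: sums_iff)

lemma F_radius: "fps_conv_radius (bessel_fps \<nu>) = \<infinity>" "fps_conv_radius (fps_deriv (bessel_fps \<nu>)) =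
    \<infinity>"
  using bessel_fps_deriv_conv_radius[OF nu, of 0] bessel_fps_deriv_conv_radius[OF nu, of 1] by
      simp_all

lemma slit_nonzero:
  assumes "z \<in> slit_plane"
  shows "1 - of_real (a j) * z \<noteq> 0"
proof
  assume "1 - of_real (a j) * z = 0"
  then have eq: "of_real (a j) * z = 1" by simp
  have re: "a j * Re z = 1" and im: "a j * Im z = 0"
    using arg_cong[OF eq, of Re] arg_cong[OF eq, of Im] by simp_all
  have aj: "a j > 0" using re nonneg[of j] by (cases "a j = 0") auto
  then have "Im z = 0" using im by simp
  then have lt: "Re z * a 0 < 1" using assms by (simp add: slit_plane_def)
  have "Re z = 1 / a j" using re aj by (simp add: field_simps)
  then have "Re z > 0" using aj by simp
  then have "a j * Re z \<le> a 0 * Re z" using a_le by (intro mult_right_mono) auto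
  then show False using re lt by (simp add: mult.commute)
qed

lemma open_slit: "open slit_plane"
proof -
  have "slit_plane = {z. Im z \<noteq> 0} \<union> {z. Re z * a 0 < 1}" by (auto simp: slit_plane_def)
  moreover have "open {z. Im z \<noteq> 0}" by (intro open_Collect_neq continuous_intros)
  moreover have "open {z. Re z * a 0 < 1}" by (intro open_Collect_less continuous_intros)
  ultimately show ?thesis by auto
qed

lemma zero_in_slit: "0 \<in> slit_plane"
  by (simp add: slit_plane_def)

lemma connected_slit: "connected slit_plane"
proof (rule starlike_imp_connected)
  show "starlike slit_plane"
    unfolding starlike_def
  proof (intro bexI[OF _ zero_in_slit] ballI subsetI)
    fix z w assume z: "z \<in> slit_plane" and w: "w \<in> closed_segment 0 z"
    then obtain t where t: "0 \<le> t" "t \<le> 1" "w = t *\<^sub>R z"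
      by (auto simp: closed_segment_def)
    show "w \<in> slit_plane"
    proof (cases "t = 0")
      case False
      show ?thesis
      proof (cases "Im z = 0")
        case True
        then have lt: "Re z * a 0 < 1" using z by (simp add: slit_plane_def)
        have "t * (Re z * a 0) < 1"
        proof (cases "Re z * a 0 \<le> 0")
          case True
          then have "t * (Re z * a 0) \<le> 0" by (rule mult_nonneg_nonpos[OF t(1)])
          then show ?thesis by linarith
        next
          case False
          then have "t * (Re z * a 0) \<le> 1 * (Re z * a 0)" using t(2) by (intro mult_right_mono) auto
          then show ?thesis using lt by linarith
        qed
        then show ?thesis by (simp add: slit_plane_def t(3) mult.assoc)
      next
        case False
        then show ?thesis using \<open>t \<noteq> 0\<close> by (simp add: slit_plane_def t(3))
      qed
    qed (use t zero_in_slit in simp)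
  qed
qed

text \<open>The atoms tend to 0, so on a bounded region all but finitely many denominators stay away
  from 0.\<close>

lemma eventually_term_bound:
  assumes "R > 0"
  shows "\<forall>\<^sub>F j in sequentially. \<forall>z :: complex. norm z \<le> R \<longrightarrow> 1 / 2 \<le> norm (1 - of_real (a j) * z)"
proof -
  have "(\<lambda>j. a j * R) \<longlonglongrightarrow> 0 * R" by (intro tendsto_intros a_tendsto)
  then have "\<forall>\<^sub>F j in sequentially. a j * R < 1 / 2" by (intro order_tendstoD) auto
  then show ?thesis
  proof eventually_elim
    case (elim j)
    show ?case
    proof (intro allI impI)
      fix z :: complex assume "norm z \<le> R"
      then have "a j * norm z \<le> a j * R" using nonneg by (intro mult_left_mono) auto
      then have "norm (of_real (a j) * z) \<le> 1 / 2" using elim nonneg[of j] by (simp add: norm_mult)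
      then show "1 / 2 \<le> norm (1 - of_real (a j) * z)"
        using norm_triangle_ineq2[of 1 "of_real (a j) * z"] by simp
    qed
  qed
qed

text \<open>Weierstrass's test: on a unit ball all but finitely many terms are bounded by 2
  a_j^2.\<close>

lemma G_sums_differentiable:
  assumes "z \<in> slit_plane"
  shows "(\<lambda>j. of_real (a j) ^ 2 / (1 - of_real (a j) * z)) sums G z" "G field_differentiable at z"
proof -
  let ?f = "\<lambda>j z. complex_of_real (a j) ^ 2 / (1 - of_real (a j) * z)"
  have hfd: "?f n field_differentiable at x" if "x \<in> slit_plane" for n x
    using that by (intro field_differentiable_divide field_differentiable_diff
        field_differentiable_mult
        field_differentiable_const field_differentiable_ident field_differentiable_power
            slit_nonzero)
  have to_g: "\<exists>d h. 0 < d \<and> summable h \<and> range h \<subseteq> \<real>\<^sub>\<ge>\<^sub>0 \<and>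
       (\<forall>\<^sub>F n in sequentially. \<forall>y\<in>ball x d \<inter> slit_plane. cmod (?f n y) \<le> cmod (h n))" for x
  proof -
    have "\<forall>\<^sub>F n in sequentially. \<forall>y\<in>ball x 1 \<inter> slit_plane. cmod (?f n y) \<le> cmod (of_real (2 * (a
        n)\<^sup>2))"
      using eventually_term_bound[of "norm x + 1", OF add_nonneg_pos[OF norm_ge_zero zero_less_one]]
    proof eventually_elim
      case (elim n)
      show ?case
      proof
        fix y assume "y \<in> ball x 1 \<inter> slit_plane"
        then have "norm y \<le> norm x + 1"
          using norm_triangle_ineq2[of y x] by (simp add: dist_norm norm_minus_commute)
        then have "1 / 2 \<le> norm (1 - of_real (a n) * y)" using elim by blast
        then have "(a n)\<^sup>2 / norm (1 - of_real (a n) * y) \<le> (a n)\<^sup>2 / (1 / 2)"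
          by (intro divide_left_mono) auto
        then show "cmod (?f n y) \<le> cmod (of_real (2 * (a n)\<^sup>2))"
          by (simp add: norm_divide norm_mult norm_power)
      qed
    qed
    moreover have "summable (\<lambda>n. complex_of_real (2 * (a n)\<^sup>2))"
      by (intro summable_of_real summable_mult summable_square)
    moreover have "range (\<lambda>n. complex_of_real (2 * (a n)\<^sup>2)) \<subseteq> \<real>\<^sub>\<ge>\<^sub>0"
      by (rule image_subsetI) (simp only: nonneg_Reals_of_real_iff, simp)
    ultimately show ?thesis
      by (intro exI[of _ 1] exI[of _ "\<lambda>n. complex_of_real (2 * (a n)\<^sup>2)"] conjI zero_less_one)
  qed
  obtain g where g: "\<forall>x\<in>slit_plane. (\<lambda>n. ?f n x) sums g x \<and> g field_differentiable at x"
    by (rule series_differentiable_comparison_complex[OF open_slit hfd to_g])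
  have gG: "g x = G x" if "x \<in> slit_plane" for x
    using g that unfolding G_def by (auto simp: sums_iff)
  show "(\<lambda>j. of_real (a j) ^ 2 / (1 - of_real (a j) * z)) sums G z"
    using g gG assms by auto
  obtain D where "(g has_field_derivative D) (at z)"
    using g assms by (auto simp: field_differentiable_def)
  then have "(G has_field_derivative D) (at z)"
    by (rule has_field_derivative_transform_within_open[OF _ open_slit assms]) (use gG in auto)
  then show "G field_differentiable at z" by (auto simp: field_differentiable_def)
qed

text \<open>Each term is expanded as a geometric series and the two sums are exchanged. The bound
  a_j^(k+2) <= a_0^k a_j^2 provides the dominating geometric series in k.\<close>

lemma G_power_series:
  assumes z: "norm z * a 0 < 1"
  shows "(\<lambda>k. of_real (rayleigh \<nu> (k + 2)) * z ^ k) sums G z"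
proof -
  let ?f = "\<lambda>k n. of_real (\<Sum>j<n. a j ^ (k + 2)) * z ^ k"
  let ?M = "\<lambda>k. rayleigh \<nu> 2 * (a 0 * norm z) ^ k"
  have s2: "summable (\<lambda>j. (a j)\<^sup>2)" "(\<Sum>j. (a j)\<^sup>2) = rayleigh \<nu> 2" using sums[of 2] by (simp_all
      add: sums_iff)
  have lim: "?f k \<longlonglongrightarrow> of_real (rayleigh \<nu> (k + 2)) * z ^ k" for k
    using sums[of "k + 2"] unfolding sums_def by (intro tendsto_intros) auto
  have "norm (?f k n) \<le> ?M k" for k n
  proof -
    have "(\<Sum>j<n. a j ^ (k + 2)) \<le> (\<Sum>j<n. a 0 ^ k * (a j)\<^sup>2)"
      unfolding power_add using nonneg a_le by (intro sum_mono mult_right_mono power_mono) auto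
    also have "\<dots> \<le> a 0 ^ k * rayleigh \<nu> 2"
      unfolding sum_distrib_left[symmetric] s2(2)[symmetric]
      using nonneg s2(1) by (intro mult_left_mono sum_le_suminf) auto
    finally have "(\<Sum>j<n. a j ^ (k + 2)) * norm z ^ k \<le> a 0 ^ k * rayleigh \<nu> 2 * norm z ^ k"
      by (intro mult_right_mono) auto
    moreover have "0 \<le> (\<Sum>j<n. a j ^ (k + 2))" using nonneg by (intro sum_nonneg) auto
    ultimately show ?thesis
      by (simp add: norm_mult norm_power power_mult_distrib mult_ac del: of_real_sum)
  qed
  then have bd: "\<forall>\<^sub>F k in sequentially. \<forall>n. True \<longrightarrow> norm (?f k n) \<le> ?M k" by simp
  have sM: "summable ?M"
    using z nonneg[of 0] by (intro summable_mult summable_geometric) (simp add: mult.commute)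
  note tan = tannery[of ?f, OF lim bd _ sM]
  have "(\<lambda>n. \<Sum>k. ?f k n) \<longlonglongrightarrow> (\<Sum>k. of_real (rayleigh \<nu> (k + 2)) * z ^ k)"
    by (rule tan(2)) auto
  moreover have "(\<Sum>k. ?f k n) = (\<Sum>j<n. of_real (a j) ^ 2 / (1 - of_real (a j) * z))" for n
  proof -
    have "(\<lambda>k. \<Sum>j<n. of_real (a j) ^ 2 * (of_real (a j) * z) ^ k) sums
        (\<Sum>j<n. of_real (a j) ^ 2 * (1 / (1 - of_real (a j) * z)))"
    proof (intro sums_sum sums_mult geometric_sums)
      fix j
      have "a j * norm z \<le> a 0 * norm z" using a_le by (intro mult_right_mono) auto
      then show "norm (of_real (a j) * z) < 1" using z nonneg[of j] by (simp add: norm_mult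
          mult.commute)
    qed
    then have "(\<Sum>k. \<Sum>j<n. of_real (a j) ^ 2 * (of_real (a j) * z) ^ k) =
        (\<Sum>j<n. of_real (a j) ^ 2 * (1 / (1 - of_real (a j) * z)))"
      by (simp add: sums_iff)
    moreover have "(\<lambda>k. ?f k n) = (\<lambda>k. \<Sum>j<n. of_real (a j) ^ 2 * (of_real (a j) * z) ^ k)"
      by (rule ext) (simp add: sum_distrib_left power_add power_mult_distrib power2_eq_square
          mult_ac)
    ultimately show ?thesis by simp
  qed
  moreover have "z \<in> slit_plane"
  proof -
    have "Re z * a 0 \<le> norm z * a 0" using nonneg complex_Re_le_cmod by (intro mult_right_mono) auto
    then show ?thesis using z by (simp add: slit_plane_def)
  qed
  then have "(\<lambda>n. \<Sum>j<n. of_real (a j) ^ 2 / (1 - of_real (a j) * z)) \<longlonglongrightarrow> G z"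
    using G_sums_differentiable(1) by (simp add: sums_def)
  ultimately have "G z = (\<Sum>k. of_real (rayleigh \<nu> (k + 2)) * z ^ k)"
    using LIMSEQ_unique by fastforce
  moreover have "summable (\<lambda>k. of_real (rayleigh \<nu> (k + 2)) * z ^ k)" by (rule tan(1)) auto
  ultimately show ?thesis by (simp add: sums_iff)
qed

lemma rayleigh_fps_sums:
  assumes "norm z * a 0 < 1"
  shows "(\<lambda>k. fps_nth (rayleigh_fps \<nu>) k * z ^ k) sums (of_real (rayleigh \<nu> 1) + z * G z)"
proof -
  have "(\<lambda>k. fps_nth (rayleigh_fps \<nu>) (Suc k) * z ^ Suc k) sums (z * G z)"
    using sums_mult[OF G_power_series[OF assms], of z]
    by (simp add: rayleigh_fps_def mult_ac)
  from sums_Suc[OF this] show ?thesis by (simp add: rayleigh_fps_def add.commute)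
qed

lemma log_deriv_local:
  assumes z: "norm z * a 0 < 1"
  shows "F' z + F z * (of_real (rayleigh \<nu> 1) + z * G z) = 0"
proof -
  \<comment> \<open>A radius strictly between |z| and 1 / a_0 places z strictly inside the disc of
    convergence, so that the formal identity may be evaluated there.\<close>
  obtain t where t: "norm z < t" "t * a 0 < 1"
  proof (cases "a 0 = 0")
    case True
    then show ?thesis using that[of "norm z + 1"] by simp
  next
    case False
    then have "a 0 > 0" using nonneg[of 0] by simp
    then obtain t where "norm z < t" "t < 1 / a 0"
      using z dense[of "norm z" "1 / a 0"] unfolding pos_less_divide_eq[OF \<open>a 0 > 0\<close>] by blast
    then show ?thesis using \<open>a 0 > 0\<close> by (intro that[of t]) (simp_all only: pos_less_divide_eq)
  qed
  have "t \<ge> 0" using t(1) norm_ge_zero[of z] by linarith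
  then have "norm (complex_of_real t) * a 0 < 1" using t(2) by simp
  then have "summable (\<lambda>k. fps_nth (rayleigh_fps \<nu>) k * of_real t ^ k)"
    by (rule sums_summable[OF rayleigh_fps_sums])
  then have "fps_conv_radius (rayleigh_fps \<nu>) \<ge> norm (complex_of_real t)"
    unfolding fps_conv_radius_def by (rule conv_radius_geI[of "fps_nth (rayleigh_fps \<nu>)" "of_real
        t"])
  then have rad: "ereal (norm z) < fps_conv_radius (rayleigh_fps \<nu>)"
  proof (rule less_le_trans[rotated])
    show "ereal (norm z) < ereal (norm (complex_of_real t))" using t(1) \<open>t \<ge> 0\<close> by simp
  qed
  have "(\<lambda>k. fps_nth (rayleigh_fps \<nu>) k * z ^ k) sums eval_fps (rayleigh_fps \<nu>) z"
    by (rule sums_eval_fps[OF rad])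
  then have "eval_fps (rayleigh_fps \<nu>) z = of_real (rayleigh \<nu> 1) + z * G z"
    using rayleigh_fps_sums[OF z] by (rule sums_unique2)
  moreover have "ereal (norm z) < fps_conv_radius (bessel_fps \<nu> * rayleigh_fps \<nu>)"
    using less_le_trans[OF rad] fps_conv_radius_mult[of "bessel_fps \<nu>" "rayleigh_fps \<nu>"]
    unfolding F_radius by simp
  moreover have "eval_fps (fps_deriv (bessel_fps \<nu>) + bessel_fps \<nu> * rayleigh_fps \<nu>) z = 0"
    unfolding bessel_fps_log_deriv[OF nu] by simp
  moreover have "ereal (norm z) < fps_conv_radius (bessel_fps \<nu>)" "ereal (norm z) <
      fps_conv_radius (fps_deriv (bessel_fps \<nu>))"
    unfolding F_radius by simp_all
  ultimately show ?thesis
    using rad by (simp only: eval_fps_add eval_fps_mult)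
qed

text \<open>The identity theorem: both sides are holomorphic on the connected slit plane and agree
  near 0.\<close>

lemma log_deriv_slit:
  assumes z: "z \<in> slit_plane"
  shows "F' z + F z * (of_real (rayleigh \<nu> 1) + z * G z) = 0"
proof -
  \<comment> \<open>A radius below 1 / a_0 that makes sense for a_0 = 0 as well.\<close>
  define \<rho> where "\<rho> = 1 / (1 + a 0)"
  have \<rho>: "\<rho> > 0" using nonneg[of 0] by (simp add: \<rho>_def)
  have small: "norm w * a 0 < 1" if "w \<in> ball 0 \<rho>" for w :: complex
  proof -
    have "norm w * a 0 \<le> \<rho> * a 0" using that nonneg by (intro mult_right_mono) auto
    also have "\<dots> < 1" using nonneg[of 0] by (simp add: \<rho>_def)
    finally show ?thesis .
  qed
  show ?thesis
  proof (rule analytic_continuation[where f = "\<lambda>z. F' z + F z * (of_real (rayleigh \<nu> 1) + z * G z)"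
        and S = slit_plane and U = "ball 0 \<rho>" and \<xi> = 0])
    have "G holomorphic_on slit_plane"
      using G_sums_differentiable(2) by (auto simp: holomorphic_on_def intro:
          field_differentiable_at_within)
    then show "(\<lambda>z. F' z + F z * (of_real (rayleigh \<nu> 1) + z * G z)) holomorphic_on slit_plane"
      using F_radius by (intro holomorphic_intros) auto
    show "ball 0 \<rho> \<subseteq> slit_plane"
    proof
      fix w :: complex assume "w \<in> ball 0 \<rho>"
      then have "norm w * a 0 < 1" by (rule small)
      moreover have "Re w * a 0 \<le> norm w * a 0" using nonneg complex_Re_le_cmod by (intro
          mult_right_mono) auto
      ultimately show "w \<in> slit_plane" by (simp add: slit_plane_def)
    qed
    show "0 islimpt ball (0 :: complex) \<rho>" using \<rho> by (simp add: islimpt_ball)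
    show "F' w + F w * (of_real (rayleigh \<nu> 1) + w * G w) = 0" if "w \<in> ball 0 \<rho>" for w
      by (rule log_deriv_local[OF small[OF that]])
  qed (use open_slit connected_slit zero_in_slit z in auto)
qed

text \<open>From a + z a^2 / (1 - a z) = a / (1 - a z), summed over the atoms; what the atoms do not
  supply of the first Rayleigh sum remains as the constant \<open>lost_mass\<close>.\<close>

lemma log_deriv:
  assumes z: "z \<in> slit_plane"
  shows "(\<lambda>j. of_real (a j) / (1 - of_real (a j) * z)) sums (of_real (suminf a) + z * G z)"
    and "F' z + F z * (of_real lost_mass + (\<Sum>j. of_real (a j) / (1 - of_real (a j) * z))) = 0"
proof -
  have "(\<lambda>j. of_real (a j) + z * (of_real (a j) ^ 2 / (1 - of_real (a j) * z))) sums (of_real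
      (suminf a) + z * G z)"
    by (intro sums_add sums_mult G_sums_differentiable(1) z sums_of_real summable_sums summ)
  also have "(\<lambda>j. of_real (a j) + z * (of_real (a j) ^ 2 / (1 - of_real (a j) * z))) =
      (\<lambda>j. of_real (a j) / (1 - of_real (a j) * z))"
  proof (rule ext)
    fix j
    define \<alpha> where "\<alpha> = complex_of_real (a j)"
    have nz: "1 - \<alpha> * z \<noteq> 0" unfolding \<alpha>_def by (rule slit_nonzero[OF z])
    have "\<alpha> + z * (\<alpha>\<^sup>2 / (1 - \<alpha> * z)) = (\<alpha> * (1 - \<alpha> * z) + z * \<alpha>\<^sup>2) / (1 - \<alpha> * z)"
      using nz by (simp add: add_divide_distrib)
    also have "\<alpha> * (1 - \<alpha> * z) + z * \<alpha>\<^sup>2 = \<alpha>"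
      by (simp add: algebra_simps power2_eq_square)
    finally show "of_real (a j) + z * (of_real (a j) ^ 2 / (1 - of_real (a j) * z)) =
        of_real (a j) / (1 - of_real (a j) * z)" unfolding \<alpha>_def .
  qed
  finally show 1: "(\<lambda>j. of_real (a j) / (1 - of_real (a j) * z)) sums (of_real (suminf a) + z * G
      z)" .
  have "of_real lost_mass + (\<Sum>j. of_real (a j) / (1 - of_real (a j) * z)) = of_real (rayleigh \<nu> 1)
      + z * G z"
    using 1 by (simp add: sums_iff lost_mass_def)
  then show "F' z + F z * (of_real lost_mass + (\<Sum>j. of_real (a j) / (1 - of_real (a j) * z))) = 0"
    using log_deriv_slit[OF z] by simp
qed

end

section \<open>The zeros of the Bessel function\<close>

lemma summable_bessel_real:
  assumes "\<nu> > -1"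
  shows "summable (\<lambda>m. bessel_coeff \<nu> m * (t :: real) ^ m)"
  using summable_bessel_coeff[OF assms, of t] by simp

definition bessel_entire :: "real \<Rightarrow> real \<Rightarrow> real" where
  "bessel_entire \<nu> t = (\<Sum>m. (-1) ^ m * bessel_coeff \<nu> m * t ^ m)"

lemma summable_bessel_entire:
  assumes "\<nu> > -1"
  shows "summable (\<lambda>m. (-1) ^ m * bessel_coeff \<nu> m * t ^ m)"
  using summable_bessel_real[OF assms, of "- t"] by (simp add: power_minus[of t] mult_ac)

lemma eval_bessel_fps_of_real:
  assumes "\<nu> > -1"
  shows "eval_fps (bessel_fps \<nu>) (of_real t) = of_real (bessel_entire \<nu> t)"
proof -
  have "(\<lambda>m. fps_nth (bessel_fps \<nu>) m * of_real t ^ m) sums eval_fps (bessel_fps \<nu>) (of_real t)"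
    by (rule sums_eval_fps) (simp add: bessel_fps_conv_radius[OF assms])
  then have "(\<lambda>m. complex_of_real ((-1) ^ m * bessel_coeff \<nu> m * t ^ m)) sums eval_fps (bessel_fps
      \<nu>) (of_real t)"
    by (simp add: bessel_fps_def)
  moreover have "(\<lambda>m. complex_of_real ((-1) ^ m * bessel_coeff \<nu> m * t ^ m)) sums of_real
      (bessel_entire \<nu> t)"
    unfolding bessel_entire_def by (intro sums_of_real summable_sums summable_bessel_entire assms)
  ultimately show ?thesis by (rule sums_unique2)
qed

lemma bessel_J_eq:
  assumes nu: "\<nu> > -1" and x: "x > 0"
  shows "bessel_J \<nu> x = (x / 2) powr \<nu> / Gamma (\<nu> + 1) * bessel_entire \<nu> (x\<^sup>2)"
proof -
  have G: "Gamma (real m + \<nu> + 1) = pochhammer (\<nu> + 1) m * Gamma (\<nu> + 1)" for m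
  proof -
    have "\<nu> + 1 \<notin> \<int>\<^sub>\<le>\<^sub>0" using nu by (auto elim!: nonpos_Ints_cases)
    moreover have "\<nu> + 1 > 0" using nu by simp
    then have "Gamma (\<nu> + 1) \<noteq> 0" using Gamma_real_pos by (metis less_irrefl)
    ultimately show ?thesis using pochhammer_Gamma[of "\<nu> + 1" m] by (simp add: add_ac)
  qed
  have terms: "(-1) ^ m / (fact m * Gamma (real m + \<nu> + 1)) * (x / 2) powr (2 * real m + \<nu>) =
     (x / 2) powr \<nu> / Gamma (\<nu> + 1) * ((-1) ^ m * bessel_coeff \<nu> m * (x\<^sup>2) ^ m)" for m
  proof -
    have "(x / 2) powr (2 * real m + \<nu>) = (x / 2) ^ (2 * m) * (x / 2) powr \<nu>"
      using x powr_realpow[of "x / 2" "2 * m"] by (simp add: powr_add)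
    also have "(x / 2) ^ (2 * m) = (x\<^sup>2) ^ m / 4 ^ m"
      by (simp add: power_mult power_divide)
    finally show ?thesis unfolding G bessel_coeff_def by (simp add: mult_ac)
  qed
  show ?thesis
    unfolding bessel_J_def bessel_entire_def terms
    by (rule suminf_mult[OF summable_bessel_entire[OF nu]])
qed

lemma bessel_J_eq_0_iff:
  assumes "\<nu> > -1" "x > 0"
  shows "bessel_J \<nu> x = 0 \<longleftrightarrow> bessel_entire \<nu> (x\<^sup>2) = 0"
proof -
  have "\<nu> + 1 > 0" using assms(1) by simp
  then have "Gamma (\<nu> + 1) \<noteq> 0" using Gamma_real_pos by (metis less_irrefl)
  then show ?thesis using assms by (simp add: bessel_J_eq)
qed

section \<open>Growth on the negative axis, and matching atoms with zeros\<close>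

context bessel_atoms
begin

abbreviation h :: "nat \<Rightarrow> real" where "h \<equiv> bessel_coeff \<nu>"

lemma h_pos: "h m > 0"
  by (rule bessel_coeff_pos[OF nu])

lemma summable_negative_axis:
  assumes "r \<ge> 0"
  shows "summable (\<lambda>j. a j / (1 + a j * r))"
proof (rule summable_comparison_test'[OF summ])
  fix j
  have "0 \<le> a j * r" using assms nonneg by simp
  then have "a j / (1 + a j * r) \<le> a j / 1" using nonneg by (intro divide_left_mono) auto
  then show "norm (a j / (1 + a j * r)) \<le> a j" using \<open>0 \<le> a j * r\<close> nonneg[of j] by simp
qed

text \<open>At z = -r the alternating signs cancel, so f and -f' become power series in r with
  positive coefficients, free of cancellation.\<close>

lemma log_deriv_negative_axis:
  assumes r: "r \<ge> 0"
  shows "(\<lambda>m. real (Suc m) * h (Suc m) * r ^ m) sums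
     ((\<Sum>m. h m * r ^ m) * (lost_mass + (\<Sum>j. a j / (1 + a j * r))))"
proof -
  let ?z = "of_real (- r) :: complex"
  have z: "?z \<in> slit_plane"
  proof -
    have "0 \<le> r * a 0" using r nonneg by simp
    then show ?thesis by (simp add: slit_plane_def)
  qed
  have signs: "(-1) ^ m * (- r) ^ m = r ^ m" for m
    by (simp flip: power_mult_distrib)
  have "(-1) ^ m * h m * (- r) ^ m = h m * r ^ m" for m
    using signs[of m] by (simp only: mult.assoc mult.left_commute[of _ "h m"])
  then have Fz: "F ?z = of_real (\<Sum>m. h m * r ^ m)"
    unfolding eval_bessel_fps_of_real[OF nu] bessel_entire_def by (simp only:)
  have coeff: "- (fps_nth (fps_deriv (bessel_fps \<nu>)) m * ?z ^ m) = complex_of_real (real (Suc m) *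
      h (Suc m) * r ^ m)" for m
  proof -
    have "- (fps_nth (fps_deriv (bessel_fps \<nu>)) m * ?z ^ m) =
        of_real (real (Suc m) * h (Suc m) * ((-1) ^ m * (- r) ^ m))"
      by (simp add: bessel_fps_def mult_ac)
    then show ?thesis unfolding signs .
  qed
  have "(\<lambda>m. fps_nth (fps_deriv (bessel_fps \<nu>)) m * ?z ^ m) sums F' ?z"
    by (rule sums_eval_fps) (simp add: F_radius)
  from sums_minus[OF this] have F'z: "(\<lambda>m. complex_of_real (real (Suc m) * h (Suc m) * r ^ m))
      sums (- F' ?z)"
    by (simp only: coeff)
  have S: "(\<Sum>j. of_real (a j) / (1 - of_real (a j) * ?z)) = of_real (\<Sum>j. a j / (1 + a j * r))"
  proof -
    have "(\<lambda>j. complex_of_real (a j / (1 + a j * r))) sums of_real (\<Sum>j. a j / (1 + a j * r))"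
      by (intro sums_of_real summable_sums summable_negative_axis r)
    then show ?thesis by (simp add: sums_iff)
  qed
  have "F' ?z + of_real (\<Sum>m. h m * r ^ m) * (of_real lost_mass + of_real (\<Sum>j. a j / (1 + a j *
      r))) = 0"
    using log_deriv(2)[OF z] unfolding S Fz .
  from minus_unique[OF this]
  have "- F' ?z = of_real ((\<Sum>m. h m * r ^ m) * (lost_mass + (\<Sum>j. a j / (1 + a j * r))))"
    by (simp only: of_real_mult of_real_add)
  with F'z have "(\<lambda>m. complex_of_real (real (Suc m) * h (Suc m) * r ^ m)) sums
      of_real ((\<Sum>m. h m * r ^ m) * (lost_mass + (\<Sum>j. a j / (1 + a j * r))))"
    by (simp only:)
  then show ?thesis by (simp only: sums_of_real_iff)
qed

text \<open>A constant c > 0 would give -f' >= c f on the negative axis, hence exponential growth.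
  But the coefficients of -f' - c f are eventually negative, because those of -f' and f have ratio 1
  / (4 (\<nu> + 1 + m)).\<close>

lemma lost_mass_eq_0: "lost_mass = 0"
proof (rule ccontr)
  assume "lost_mass \<noteq> 0"
  then have c: "lost_mass > 0" using lost_mass_nonneg by simp
  \<comment> \<open>Chosen so that 4 c (\<nu> + 1 + m) > 1 for all m >= M, where c =
    \<open>lost_mass\<close>.\<close>
  define M where "M = nat \<lceil>1 / (4 * lost_mass)\<rceil> + 1"
  let ?d = "\<lambda>m. real (Suc m) * h (Suc m) - lost_mass * h m"
  have neg: "?d m < 0" if "m \<ge> M" for m
  proof -
    have "1 / (4 * lost_mass) \<le> real M - 1" unfolding M_def by linarith
    also have "\<dots> \<le> real m - 1" using that by simp
    also have "\<dots> < \<nu> + 1 + real m" using nu by linarith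
    finally have "1 < 4 * lost_mass * (\<nu> + 1 + real m)" using c by (simp add: field_simps)
    then have "1 * (real (Suc m) * h (Suc m)) < 4 * lost_mass * (\<nu> + 1 + real m) * (real (Suc m) *
        h (Suc m))"
      using h_pos by (intro mult_strict_right_mono) auto
    also have "\<dots> = lost_mass * (4 * real (Suc m) * (\<nu> + 1 + real m) * h (Suc m))" by (simp only:
        mult_ac)
    also have "\<dots> = lost_mass * h m" unfolding bessel_coeff_Suc[OF nu] ..
    finally show ?thesis by simp
  qed
  show False
  proof (rule power_series_eventually_negative[of ?d M])
    fix r :: real assume r: "r \<ge> 0"
    have "(\<lambda>m. lost_mass * (h m * r ^ m)) sums (lost_mass * (\<Sum>m. h m * r ^ m))"
      by (intro sums_mult summable_sums summable_bessel_real nu)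
    from sums_diff[OF log_deriv_negative_axis[OF r] this]
    have s: "(\<lambda>m. ?d m * r ^ m) sums ((\<Sum>m. h m * r ^ m) * (\<Sum>j. a j / (1 + a j * r)))"
      by (simp add: algebra_simps)
    then show "summable (\<lambda>m. ?d m * r ^ m)" by (rule sums_summable)
    have "0 \<le> (\<Sum>m. h m * r ^ m)"
      using r h_pos by (intro suminf_nonneg summable_bessel_real nu) (auto simp: less_imp_le)
    moreover have "0 \<le> (\<Sum>j. a j / (1 + a j * r))"
      using r nonneg by (intro suminf_nonneg summable_negative_axis) auto
    ultimately show "0 \<le> (\<Sum>m. ?d m * r ^ m)" using s by (simp add: sums_iff)
  qed (use neg less_imp_le in blast)+
qed

text \<open>With only J nonzero atoms r times the logarithmic derivative would be at most J, hence f
  of polynomial growth. The comparison J f - r (d f / d r) has coefficients (J - m) h_m, negative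
  beyond J.\<close>

lemma a_pos: "a J > 0"
proof (rule ccontr)
  assume "\<not> a J > 0"
  then have "a J = 0" using nonneg[of J] by simp
  then have zero: "a j = 0" if "j \<ge> J" for j
    using dec nonneg[of j] that unfolding decseq_def by (metis order_antisym)
  let ?d = "\<lambda>m. (real J - real m) * h m"
  show False
  proof (rule power_series_eventually_negative[of ?d "Suc J"])
    fix r :: real assume r: "r \<ge> 0"
    let ?S = "\<Sum>j<J. a j / (1 + a j * r)"
    have "(\<Sum>j. a j / (1 + a j * r)) = ?S" by (rule suminf_finite) (use zero in auto)
    then have "(\<lambda>m. real (Suc m) * h (Suc m) * r ^ m) sums ((\<Sum>m. h m * r ^ m) * ?S)"
      using log_deriv_negative_axis[OF r] by (simp add: lost_mass_eq_0)
    from sums_mult[OF this, of r]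
    have "(\<lambda>m. real (Suc m) * h (Suc m) * r ^ Suc m) sums ((\<Sum>m. h m * r ^ m) * (r * ?S))"
      by (simp add: mult_ac)
    then have "(\<lambda>m. real m * h m * r ^ m) sums ((\<Sum>m. h m * r ^ m) * (r * ?S))"
      using sums_Suc[of "\<lambda>m. real m * h m * r ^ m"] by simp
    moreover have "(\<lambda>m. real J * (h m * r ^ m)) sums (real J * (\<Sum>m. h m * r ^ m))"
      by (intro sums_mult summable_sums summable_bessel_real nu)
    ultimately have s: "(\<lambda>m. ?d m * r ^ m) sums ((\<Sum>m. h m * r ^ m) * (real J - r * ?S))"
      using sums_diff by (fastforce simp: algebra_simps)
    then show "summable (\<lambda>m. ?d m * r ^ m)" by (rule sums_summable)
    have "0 \<le> (\<Sum>m. h m * r ^ m)"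
      using r h_pos by (intro suminf_nonneg summable_bessel_real nu) (auto simp: less_imp_le)
    moreover have "r * ?S \<le> real J"
    proof -
      have "r * ?S = (\<Sum>j<J. (a j * r) / (1 + a j * r))" by (simp add: sum_distrib_left mult_ac)
      also have "\<dots> \<le> (\<Sum>j<J. 1)"
      proof (rule sum_mono)
        fix j
        have "0 \<le> a j * r" using r nonneg by simp
        then show "(a j * r) / (1 + a j * r) \<le> 1" by simp
      qed
      finally show ?thesis by simp
    qed
    ultimately show "0 \<le> (\<Sum>m. ?d m * r ^ m)" using s by (simp add: sums_iff)
  next
    fix m assume "m \<ge> Suc J"
    then show "?d m \<le> 0" using h_pos[of m] by (intro mult_nonpos_nonneg) auto
  next
    show "?d (Suc J) < 0" using h_pos by simp
  qed
qed

lemma F_field_derivative: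
  "(eval_fps (bessel_fps \<nu>) has_field_derivative F' z) (at z)"
  by (rule has_field_derivative_eval_fps) (simp add: F_radius)

text \<open>Approaching \<open>z\<^sub>0\<close> vertically, \<open>\<epsilon>\<close> times the logarithmic derivative isolates the poles at
    \<open>z\<^sub>0\<close>.\<close>

lemma card_atoms:
  assumes z0: "z0 > 0"
  shows "finite {j. a j * z0 = 1}"
    and "card {j. a j * z0 = 1} = (if bessel_entire \<nu> z0 = 0 then 1 else 0)"
proof -
  let ?A = "{j. a j * z0 = 1}"
  let ?w = "complex_of_real z0"
  let ?z = "\<lambda>\<epsilon>. ?w + \<i> * of_real \<epsilon>"
  let ?f = "\<lambda>j \<epsilon>. of_real \<epsilon> * (of_real (a j) / (1 - of_real (a j) * ?z \<epsilon>))"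
  let ?g = "\<lambda>j. if a j * z0 = 1 then \<i> else 0"
  have "(\<lambda>j. a j * z0) \<longlonglongrightarrow> 0 * z0" by (intro tendsto_intros a_tendsto)
  then have "\<forall>\<^sub>F j in sequentially. a j * z0 < 1" by (intro order_tendstoD) auto
  then obtain K where K: "\<And>j. j \<ge> K \<Longrightarrow> a j * z0 < 1" by (auto simp: eventually_sequentially)
  have "?A \<subseteq> {..<K}"
  proof
    fix j assume "j \<in> ?A"
    then show "j \<in> {..<K}" using K[of j] by (cases "j < K") auto
  qed
  then show fin: "finite ?A" using finite_subset by blast
  have z_lim: "(?z \<longlongrightarrow> ?w) (at_right 0)"
    by (auto intro!: tendsto_eq_intros)
  have lim: "(?f j \<longlongrightarrow> ?g j) (at_right 0)" for j
  proof (cases "a j * z0 = 1")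
    case True
    then have "a j \<noteq> 0" by auto
    \<comment> \<open>At a pole the denominator is exactly -i a_j \<epsilon>, so the term does not
      depend on \<epsilon>.\<close>
    have "?f j \<epsilon> = \<i>" if "\<epsilon> > 0" for \<epsilon>
    proof -
      have "1 - of_real (a j) * ?z \<epsilon> = - (\<i> * of_real (a j) * of_real \<epsilon>)"
        using True by (simp add: algebra_simps flip: of_real_mult)
      then show ?thesis using that \<open>a j \<noteq> 0\<close> by (simp add: field_simps)
    qed
    then have "\<forall>\<^sub>F \<epsilon> in at_right 0. ?f j \<epsilon> = \<i>"
      by (intro eventually_mono[OF eventually_at_right_less]) auto
    then show ?thesis using True by (simp add: tendsto_eventually)
  next
    case False
    have "1 - of_real (a j) * ?w \<noteq> 0"
    proof
      assume "1 - of_real (a j) * ?w = 0"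
      then have "complex_of_real (a j * z0) = 1" by simp
      then show False using False by (simp only: of_real_eq_1_iff)
    qed
    then have "(?f j \<longlongrightarrow> of_real 0 * (of_real (a j) / (1 - of_real (a j) * ?w))) (at_right 0)"
      by (intro tendsto_mult tendsto_divide tendsto_diff tendsto_const z_lim tendsto_of_real
          tendsto_ident_at)
    then show ?thesis using False by simp
  qed
  have bd: "\<forall>\<^sub>F j in sequentially. \<forall>\<epsilon>. \<epsilon> \<in> {0<..<1} \<longrightarrow> norm (?f j \<epsilon>) \<le> 2 * a j"
    using eventually_term_bound[of "z0 + 1", OF add_pos_pos[OF z0 zero_less_one]]
  proof eventually_elim
    case (elim j)
    show ?case
    proof (intro allI impI)
      fix \<epsilon> :: real assume \<epsilon>: "\<epsilon> \<in> {0<..<1}"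
      have "norm (?z \<epsilon>) \<le> norm ?w + norm (\<i> * of_real \<epsilon>)" by (rule norm_triangle_ineq)
      then have "norm (?z \<epsilon>) \<le> z0 + 1" using z0 \<epsilon> by (simp add: norm_mult)
      then have ge: "1 / 2 \<le> norm (1 - of_real (a j) * ?z \<epsilon>)" using elim by blast
      have "norm (?f j \<epsilon>) = \<epsilon> * (a j / norm (1 - of_real (a j) * ?z \<epsilon>))"
        using \<epsilon> nonneg[of j] by (simp add: norm_mult norm_divide)
      also have "\<dots> \<le> 1 * (a j / (1 / 2))"
        using \<epsilon> nonneg[of j] ge by (intro mult_mono divide_left_mono) auto
      finally show "norm (?f j \<epsilon>) \<le> 2 * a j" by simp
    qed
  qed
  have ev: "\<forall>\<^sub>F \<epsilon> in at_right (0 :: real). \<epsilon> \<in> {0<..<1}"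
    by (rule eventually_at_right_real) simp
  have "((\<lambda>\<epsilon>. \<Sum>j. ?f j \<epsilon>) \<longlongrightarrow> (\<Sum>j. ?g j)) (at_right 0)"
    by (rule tannery(2)[OF lim bd ev summable_mult[OF summ]]) simp
  moreover have "(\<Sum>j. ?g j) = (\<Sum>j\<in>?A. ?g j)" by (rule suminf_finite[OF fin]) auto
  ultimately have L: "((\<lambda>\<epsilon>. \<Sum>j. ?f j \<epsilon>) \<longlongrightarrow> of_nat (card ?A) * \<i>) (at_right 0)" by simp
  \<comment> \<open>The logarithmic derivative identity multiplied by \<epsilon>. Points with
    positive imaginary part always lie in the slit plane.\<close>
  have eq: "of_real \<epsilon> * F' (?z \<epsilon>) + F (?z \<epsilon>) * (\<Sum>j. ?f j \<epsilon>) = 0" if "\<epsilon> > 0" for \<epsilon>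
  proof -
    have z: "?z \<epsilon> \<in> slit_plane" using that by (simp add: slit_plane_def)
    have "(\<Sum>j. ?f j \<epsilon>) = of_real \<epsilon> * (\<Sum>j. of_real (a j) / (1 - of_real (a j) * ?z \<epsilon>))"
      by (rule suminf_mult[OF sums_summable[OF log_deriv(1)[OF z]]])
    then have "of_real \<epsilon> * F' (?z \<epsilon>) + F (?z \<epsilon>) * (\<Sum>j. ?f j \<epsilon>) =
        of_real \<epsilon> * (F' (?z \<epsilon>) + F (?z \<epsilon>) * (of_real lost_mass + (\<Sum>j. of_real (a j) / (1 - of_real
            (a j) * ?z \<epsilon>))))"
      by (simp add: lost_mass_eq_0 algebra_simps)
    then show ?thesis unfolding log_deriv(2)[OF z] by simp
  qed
  have contF: "isCont (eval_fps (bessel_fps \<nu>)) ?w" by (rule DERIV_isCont[OF F_field_derivative])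
  have "(eval_fps (fps_deriv (bessel_fps \<nu>)) has_field_derivative eval_fps (fps_deriv (fps_deriv
      (bessel_fps \<nu>))) ?w) (at ?w)"
    by (rule has_field_derivative_eval_fps) (simp add: F_radius)
  then have contF': "isCont (eval_fps (fps_deriv (bessel_fps \<nu>))) ?w" by (rule DERIV_isCont)
  have F_lim: "((\<lambda>\<epsilon>. F (?z \<epsilon>)) \<longlongrightarrow> F ?w) (at_right 0)"
    and F'_lim: "((\<lambda>\<epsilon>. F' (?z \<epsilon>)) \<longlongrightarrow> F' ?w) (at_right 0)"
    by (rule isCont_tendsto_compose[OF contF z_lim], rule isCont_tendsto_compose[OF contF' z_lim])
  have ev0: "\<forall>\<^sub>F \<epsilon> in at_right (0 :: real). \<epsilon> > 0" by (rule eventually_at_right_less)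
  show "card ?A = (if bessel_entire \<nu> z0 = 0 then 1 else 0)"
  proof (cases "bessel_entire \<nu> z0 = 0")
    case False
    then have F0: "F ?w \<noteq> 0" by (simp add: eval_bessel_fps_of_real[OF nu])
    have "((\<lambda>\<epsilon>. of_real \<epsilon> * F' (?z \<epsilon>) + F (?z \<epsilon>) * (\<Sum>j. ?f j \<epsilon>)) \<longlongrightarrow>
        of_real 0 * F' ?w + F ?w * (of_nat (card ?A) * \<i>)) (at_right 0)"
      by (intro tendsto_add tendsto_mult F_lim F'_lim L tendsto_of_real tendsto_ident_at)
    moreover have "((\<lambda>\<epsilon>. of_real \<epsilon> * F' (?z \<epsilon>) + F (?z \<epsilon>) * (\<Sum>j. ?f j \<epsilon>)) \<longlongrightarrow> 0) (at_right 0)"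
      by (intro tendsto_eventually eventually_mono[OF ev0] eq)
    ultimately have "of_real 0 * F' ?w + F ?w * (of_nat (card ?A) * \<i>) = 0"
      using tendsto_unique trivial_limit_at_right_real by blast
    then have "card ?A = 0" using F0 by simp
    then show ?thesis using False by simp
  next
    case True
    then have F0: "F ?w = 0" by (simp add: eval_bessel_fps_of_real[OF nu])
    have F'0: "F' ?w \<noteq> 0" using bessel_zeros_simple[OF nu _ F0] z0 by simp
    have "((\<lambda>u. (F u - F ?w) / (u - ?w)) \<longlongrightarrow> F' ?w) (at ?w)"
      using F_field_derivative unfolding has_field_derivative_iff .
    moreover have "filterlim ?z (at ?w) (at_right 0)"
      using z_lim by (rule filterlim_atI) (auto intro: eventually_mono[OF ev0])
    ultimately have "((\<lambda>\<epsilon>. (F (?z \<epsilon>) - F ?w) / (?z \<epsilon> - ?w)) \<longlongrightarrow> F' ?w) (at_right 0)"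
      by (rule filterlim_compose)
    then have Q: "((\<lambda>\<epsilon>. F (?z \<epsilon>) / (\<i> * of_real \<epsilon>)) \<longlongrightarrow> F' ?w) (at_right 0)"
      by (simp add: F0)
    \<comment> \<open>Division by \<epsilon> and F(z) / (i \<epsilon>) --> F'(z0) turn the identity
      into F'(z0) (1 - n) = 0 with n the number of atoms at the pole. Simplicity of the zero forces
      n = 1.\<close>
    have "((\<lambda>\<epsilon>. F' (?z \<epsilon>) + \<i> * (F (?z \<epsilon>) / (\<i> * of_real \<epsilon>)) * (\<Sum>j. ?f j \<epsilon>)) \<longlongrightarrow>
        F' ?w + \<i> * F' ?w * (of_nat (card ?A) * \<i>)) (at_right 0)"
      by (intro tendsto_add tendsto_mult F'_lim Q L tendsto_const)
    moreover have "((\<lambda>\<epsilon>. F' (?z \<epsilon>) + \<i> * (F (?z \<epsilon>) / (\<i> * of_real \<epsilon>)) * (\<Sum>j. ?f j \<epsilon>)) \<longlongrightarrow> 0)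
        (at_right 0)"
    proof (intro tendsto_eventually eventually_mono[OF ev0])
      fix \<epsilon> :: real assume \<epsilon>: "\<epsilon> > 0"
      have "F' (?z \<epsilon>) + \<i> * (F (?z \<epsilon>) / (\<i> * of_real \<epsilon>)) * (\<Sum>j. ?f j \<epsilon>) =
          (of_real \<epsilon> * F' (?z \<epsilon>) + F (?z \<epsilon>) * (\<Sum>j. ?f j \<epsilon>)) / of_real \<epsilon>"
        using \<epsilon> by (simp add: add_divide_distrib)
      then show "F' (?z \<epsilon>) + \<i> * (F (?z \<epsilon>) / (\<i> * of_real \<epsilon>)) * (\<Sum>j. ?f j \<epsilon>) = 0"
        unfolding eq[OF \<epsilon>] by simp
    qed
    ultimately have "F' ?w + \<i> * F' ?w * (of_nat (card ?A) * \<i>) = 0"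
      using tendsto_unique trivial_limit_at_right_real by blast
    then have "F' ?w * (1 - of_nat (card ?A)) = 0" by (simp add: algebra_simps)
    then have "card ?A = 1" using F'0 by (metis eq_iff_diff_eq_0 mult_eq_0_iff of_nat_eq_1_iff)
    then show ?thesis using True by simp
  qed
qed

lemma bessel_entire_eq_0_iff:
  assumes "t > 0"
  shows "bessel_entire \<nu> t = 0 \<longleftrightarrow> (\<exists>j. a j * t = 1)"
proof -
  have "bessel_entire \<nu> t = 0 \<longleftrightarrow> card {j. a j * t = 1} \<noteq> 0"
    using card_atoms(2)[OF assms] by simp
  also have "\<dots> \<longleftrightarrow> (\<exists>j. a j * t = 1)"
    using card_atoms(1)[OF assms] by (simp add: card_eq_0_iff)
  finally show ?thesis .
qed

text \<open>Two equal atoms would be counted twice at z0 = 1 / a_i, but \<open>card_atoms\<close>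
  allows at most one.\<close>

lemma a_strict_decreasing: "i < j \<Longrightarrow> a j < a i"
proof (rule ccontr)
  assume ij: "i < j" and "\<not> a j < a i"
  then have "a i = a j" using dec by (simp add: decseq_def order_antisym)
  then have "{i, j} \<subseteq> {k. a k * (1 / a i) = 1}" using a_pos[of i] a_pos[of j] by auto
  then have "card {i, j} \<le> card {k. a k * (1 / a i) = 1}"
    using a_pos[of i] by (intro card_mono card_atoms(1)) auto
  then show False using card_atoms(2)[of "1 / a i"] a_pos[of i] ij by (simp split: if_splits)
qed

lemma a_less_iff: "a j < a i \<longleftrightarrow> i < j"
  using a_strict_decreasing[of i j] a_strict_decreasing[of j i] by (cases i j rule:
      linorder_cases) auto

text \<open>Decreasing atoms, indexed from 0, correspond to increasing zeros, indexed from 1: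
  exactly j + 1 zeros lie below or at 1 / sqrt (a_j), which is the counting condition in the
  definition.\<close>

lemma bessel_zero_eq: "bessel_zero \<nu> (Suc n) = 1 / sqrt (a n)"
proof -
  let ?x = "\<lambda>j. 1 / sqrt (a j)"
  have pos: "?x j > 0" for j using a_pos by simp
  have zero_iff: "bessel_J \<nu> y = 0 \<longleftrightarrow> (\<exists>j. y = ?x j)" if "y > 0" for y
  proof -
    have "a j * y\<^sup>2 = 1 \<longleftrightarrow> y = ?x j" for j
    proof
      assume "a j * y\<^sup>2 = 1"
      then have "y\<^sup>2 = 1 / a j" using a_pos[of j] by (simp add: field_simps)
      then have "y = sqrt (1 / a j)" using that real_sqrt_unique by fastforce
      then show "y = ?x j" by (simp add: real_sqrt_divide)
    next
      assume "y = ?x j"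
      then show "a j * y\<^sup>2 = 1" using a_pos[of j] by (simp add: power_divide)
    qed
    then show ?thesis using bessel_J_eq_0_iff[OF nu that] bessel_entire_eq_0_iff[of "y\<^sup>2"] that by
        simp
  qed
  have le_iff: "?x i \<le> ?x j \<longleftrightarrow> i \<le> j" for i j
    using a_pos[of i] a_pos[of j] a_less_iff[of i j] by (simp add: divide_simps not_less[symmetric])
  have set_eq: "{y. 0 < y \<and> y \<le> ?x j \<and> bessel_J \<nu> y = 0} = ?x ` {..j}" for j
  proof (intro set_eqI iffI)
    fix y assume "y \<in> {y. 0 < y \<and> y \<le> ?x j \<and> bessel_J \<nu> y = 0}"
    then obtain i where "y = ?x i" "y \<le> ?x j" using zero_iff by blast
    then show "y \<in> ?x ` {..j}" using le_iff by blast
  next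
    fix y assume "y \<in> ?x ` {..j}"
    then obtain i where i: "i \<le> j" "y = ?x i" by blast
    then have "0 < y" "y \<le> ?x j" using pos le_iff by blast+
    then show "y \<in> {y. 0 < y \<and> y \<le> ?x j \<and> bessel_J \<nu> y = 0}" using zero_iff i by blast
  qed
  have inj: "inj_on ?x A" for A
  proof (rule inj_onI)
    fix i j assume "?x i = ?x j"
    then have "?x i \<le> ?x j" "?x j \<le> ?x i" by (simp_all only: order_refl)
    then show "i = j" unfolding le_iff by (rule order_antisym)
  qed
  have card: "card {y. 0 < y \<and> y \<le> ?x j \<and> bessel_J \<nu> y = 0} = Suc j" for j
    unfolding set_eq card_image[OF inj] by simp
  show ?thesis
    unfolding bessel_zero_def
  proof (rule the_equality)
    show "0 < ?x n \<and> bessel_J \<nu> (?x n) = 0 \<and> card {y. 0 < y \<and> y \<le> ?x n \<and> bessel_J \<nu> y = 0} = Suc n"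
      using pos zero_iff card by blast
  next
    fix x assume x: "0 < x \<and> bessel_J \<nu> x = 0 \<and> card {y. 0 < y \<and> y \<le> x \<and> bessel_J \<nu> y = 0} = Suc n"
    then obtain j where j: "x = ?x j" using zero_iff by blast
    then have "Suc j = Suc n" using x card[of j] by simp
    then show "x = ?x n" using j by simp
  qed
qed

lemma bessel_zeta_even:
  assumes k: "k \<ge> 1"
  shows "bessel_zeta \<nu> (of_nat (2 * k)) = of_real (rayleigh \<nu> k)"
proof -
  have terms: "complex_of_real (bessel_zero \<nu> (Suc n)) powr (- of_nat (2 * k)) = of_real (a n ^
      k)" for n
  proof -
    have an: "a n > 0" by (rule a_pos)
    have "complex_of_real (bessel_zero \<nu> (Suc n)) powr (- of_nat (2 * k)) =
        complex_of_real (1 / sqrt (a n)) powr complex_of_real (- real (2 * k))"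
      unfolding bessel_zero_eq by simp
    also have "\<dots> = of_real ((1 / sqrt (a n)) powr (- real (2 * k)))"
      using an by (intro powr_of_real) auto
    also have "(1 / sqrt (a n)) powr (- real (2 * k)) = a n ^ k"
    proof -
      have "(1 / sqrt (a n)) powr (- real (2 * k)) = inverse ((1 / sqrt (a n)) ^ (2 * k))"
        using an powr_realpow[of "1 / sqrt (a n)" "2 * k"] by (simp only: powr_minus) simp
      also have "\<dots> = a n ^ k" using an by (simp add: power_mult power_divide)
      finally show ?thesis .
    qed
    finally show ?thesis .
  qed
  have "(\<lambda>n. a n ^ k) sums rayleigh \<nu> k"
  \<comment> \<open>The first Rayleigh sum is the one case that the compactness argument left open;
    it is closed by \<open>lost_mass_eq_0\<close>.\<close>
  proof (cases "k = 1")
    case True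
    have "rayleigh \<nu> 1 = suminf a" using lost_mass_eq_0 by (simp add: lost_mass_def)
    then show ?thesis using True summable_sums[OF summ] by simp
  next
    case False
    then show ?thesis using k by (intro sums) simp
  qed
  then show ?thesis
    unfolding bessel_zeta_def terms by (intro sums_unique[symmetric] sums_of_real)
qed

end

theorem bessel_zeta_eq_rayleigh:
  assumes "\<nu> > -1" "k \<ge> 1"
  shows "bessel_zeta \<nu> (of_nat (2 * k)) = of_real (rayleigh \<nu> k)"
proof -
  obtain a where "decseq a" "\<forall>j. 0 \<le> a j" "summable a" "suminf a \<le> rayleigh \<nu> 1"
    "\<forall>k\<ge>2. (\<lambda>j. a j ^ k) sums rayleigh \<nu> k"
    using rayleigh_atoms[OF assms(1)] by blast
  then interpret bessel_atoms \<nu> a by unfold_locales (use assms in auto)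
  show ?thesis by (rule bessel_zeta_even[OF assms(2)])
qed

theorem theorem1p8:
  fixes \<nu> :: real and k :: nat and \<beta> :: "nat \<Rightarrow> real"
  assumes "\<nu> > -1" and "k \<ge> 1"
    and "\<And>N. N \<ge> 1 \<Longrightarrow> \<beta> N > 0"
    and "filterlim \<beta> at_top sequentially"
  shows "(\<lambda>N. complex_of_real
            ((\<beta> N / (8 * real N)) ^ k *
              laguerre_moment (\<beta> N) N (- int k) (\<beta> N / 2 * (\<nu> + 1))))
          \<longlonglongrightarrow> bessel_zeta \<nu> (of_nat (2 * k))"
proof -
  interpret growing_beta \<nu> \<beta> by unfold_locales (use assms in auto)
  show ?thesis
    unfolding bessel_zeta_eq_rayleigh[OF assms(1,2)]
    by (intro tendsto_of_real scaled_moment_tendsto assms(2))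
qed

end
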